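(* Let $S$ be an inverse semigroup with zero, let $\varphi : S \to G^0$ be a grading of $S$ by a group $G$, and let $H = \varphi^{-1}(1_G) \cup \{0\}$. Suppose that $H$ is $C^*$-isometric in $S$. Let $\varepsilon_f : C^*_0(S) \to \overline{\mathbb{C}_0 H}$ be the conditional expectation extending the restriction map $\mathbb{C}_0 S \to \mathbb{C}_0 H$. Then $S$ has weak containment if and only if $\varepsilon_f$ is faithful and $H$ has weak containment.
   Context: All inverse semigroups and groups are discrete. An inverse semigroup is a semigroup $S$ in which each $s$ has a unique $s^*$ with $s = ss^*s$ and $s^* = s^*ss^*$. $\mathbb{C}S$ is the complex $*$-algebra of finite formal sums over $S$, with product extending that of $S$ and involution $(\sum \alpha_s s)^* = \sum \overline{\alpha_s}\, s^*$. A representation of $S$ is a map $\pi$ from $S$ to the partial isometries on a Hilbert space with $\pi(st)=\pi(s)\pi(t)$ and $\pi(s^* )=\pi(s)^*$. The full $C^*$-algebra $C^*(S)$ is the completion of $\mathbb{C}S$ in the norm $\|f\|_{C^*(S)} = \sup_\pi \|\pi(f)\|$ over all representations $\pi$ of $S$. The left regular representation $\Lambda$ of $S$ on $\ell^2(S)$ is given by $\Lambda(a)\delta_b = \delta_{ab}$ if $a^*ab = b$, and $\Lambda(a)\delta_b = 0$ otherwise. It induces a $*$-homomorphism $\Lambda : C^*(S) \to \mathcal{B}(\ell^2(S))$ with image denoted $C^*_r(S)$. $S$ has weak containment if $\Lambda : C^*(S) \to C^*_r(S)$ is an isomorphism. An inverse subsemigroup $H$ of $S$ is $C^*$-isometric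 in $S$ if $\|f\|_{C^*(S)} = \|f\|_{C^*(H)}$ for all $f \in \mathbb{C}H$. $G^0$ is the group $G$ with a zero adjoined. A grading of an inverse semigroup $S$ with zero by $G$ is a map $\varphi : S \to G^0$ such that $\varphi^{-1}(0) = \{0\}$ and $\varphi(ab) = \varphi(a)\varphi(b)$ whenever $ab \neq 0$. For an inverse semigroup with zero, $\mathbb{C}_0 S$ and $C^*_0(S)$ denote the quotients of $\mathbb{C}S$ and $C^*(S)$, respectively, by the ideal generated by the zero element of $S$; so $\mathbb{C}_0S$ has as basis the nonzero elements of $S$ and is dense in $C^*_0(S)$. The restriction map $\mathbb{C}_0 S \to \mathbb{C}_0 H$ is $\sum_{s} \alpha_s s \mapsto \sum_{h \in H} \alpha_h h$; it extends continuously to a conditional expectation $\varepsilon_f$ of $C^*_0(S)$ onto the closure $\overline{\mathbb{C}_0 H}$ of $\mathbb{C}_0H$ in $C^*_0(S)$. Faithful means: $\varepsilon_f(a^*a)=0$ implies $a = 0$. *)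

theory Defs
  imports
    "HOL-Analysis.Analysis"
    "HOL-Algebra.Group"
    "HOL-Library.Poly_Mapping"
    "HOL-Library.Function_Algebras"
begin

section \<open>Inverse semigroups and gradings\<close>

locale inverse_semigroup =
  fixes S :: "'a set" and mul :: "'a \<Rightarrow> 'a \<Rightarrow> 'a"
  assumes closed: "a \<in> S \<Longrightarrow> b \<in> S \<Longrightarrow> mul a b \<in> S"
    and assoc: "a \<in> S \<Longrightarrow> b \<in> S \<Longrightarrow> c \<in> S \<Longrightarrow> mul (mul a b) c = mul a (mul b c)"
    and ex1_inverse: "s \<in> S \<Longrightarrow> \<exists>!t. t \<in> S \<and> s = mul (mul s t) s \<and> t = mul (mul t s) t"

definition sinv :: "'a set \<Rightarrow> ('a \<Rightarrow> 'a \<Rightarrow> 'a) \<Rightarrow> 'a \<Rightarrow> 'a" where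
  "sinv S mul s = (THE t. t \<in> S \<and> s = mul (mul s t) s \<and> t = mul (mul t s) t)"

definition zero_element :: "'a set \<Rightarrow> ('a \<Rightarrow> 'a \<Rightarrow> 'a) \<Rightarrow> 'a \<Rightarrow> bool" where
  "zero_element S mul z \<longleftrightarrow> z \<in> S \<and> (\<forall>s\<in>S. mul s z = z \<and> mul z s = z)"

text \<open>The group with zero \<open>G\<^sup>0\<close>; the adjoined zero is \<^term>\<open>None\<close>.\<close>

definition adjoin_zero :: "('g, 'm) monoid_scheme \<Rightarrow> 'g option monoid" where
  "adjoin_zero G = \<lparr>carrier = insert None (Some ` carrier G),
     monoid.mult = (\<lambda>x y. case (x, y) of (Some g, Some h) \<Rightarrow> Some (g \<otimes>\<^bsub>G\<^esub> h) | _ \<Rightarrow> None),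
     one = Some \<one>\<^bsub>G\<^esub>\<rparr>"

definition grading ::
    "'a set \<Rightarrow> ('a \<Rightarrow> 'a \<Rightarrow> 'a) \<Rightarrow> 'a \<Rightarrow> ('g, 'm) monoid_scheme \<Rightarrow> ('a \<Rightarrow> 'g option) \<Rightarrow> bool" where
  "grading S mul z G \<phi> \<longleftrightarrow>
     \<phi> \<in> S \<rightarrow> carrier (adjoin_zero G) \<and>
     {s \<in> S. \<phi> s = None} = {z} \<and>
     (\<forall>a\<in>S. \<forall>b\<in>S. mul a b \<noteq> z \<longrightarrow> \<phi> (mul a b) = \<phi> a \<otimes>\<^bsub>adjoin_zero G\<^esub> \<phi> b)"


section \<open>Complex Hilbert spaces and bounded operators\<close>

text \<open>
  A Hilbert space is a complex subspace of some ambient type, with its own scalar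
  multiplication and inner product (linear in the first argument). The ambient type
  carries no topology, so that quantifying over all structures on a type
  covers, up to isomorphism, all Hilbert spaces of small enough dimension.
\<close>

record 'h hilbert =
  hscale :: "complex \<Rightarrow> 'h \<Rightarrow> 'h"
  hset :: "'h set"
  hip :: "'h \<Rightarrow> 'h \<Rightarrow> complex"

definition hnorm :: "'h hilbert \<Rightarrow> 'h \<Rightarrow> real" where
  "hnorm K x = sqrt (Re (hip K x x))"

locale hilbert_space = vector_space "hscale K" for K :: "'h::ab_group_add hilbert" +
  assumes sub: "subspace (hset K)"
    and ip_add: "x \<in> hset K \<Longrightarrow> y \<in> hset K \<Longrightarrow> w \<in> hset K \<Longrightarrow>
          hip K (x + y) w = hip K x w + hip K y w"
    and ip_scale: "x \<in> hset K \<Longrightarrow> w \<in> hset K \<Longrightarrow> hip K (hscale K c x) w = c * hip K x w"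
    and ip_cnj: "x \<in> hset K \<Longrightarrow> y \<in> hset K \<Longrightarrow> hip K y x = cnj (hip K x y)"
    and ip_pos: "x \<in> hset K \<Longrightarrow> x \<noteq> 0 \<Longrightarrow> Re (hip K x x) > 0"
    and complete: "(\<And>n. u n \<in> hset K) \<Longrightarrow>
          (\<And>e. e > 0 \<Longrightarrow> \<exists>N. \<forall>m\<ge>N. \<forall>n\<ge>N. hnorm K (u m - u n) < e) \<Longrightarrow>
          \<exists>x\<in>hset K. (\<lambda>n::nat. hnorm K (u n - x)) \<longlonglongrightarrow> 0"

context hilbert_space
begin

lemma mem [intro, simp]:
  "0 \<in> hset K"
  "x \<in> hset K \<Longrightarrow> y \<in> hset K \<Longrightarrow> x + y \<in> hset K"
  "x \<in> hset K \<Longrightarrow> y \<in> hset K \<Longrightarrow> x - y \<in> hset K"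
  "x \<in> hset K \<Longrightarrow> hscale K c x \<in> hset K"
  "(\<And>i. i \<in> I \<Longrightarrow> g i \<in> hset K) \<Longrightarrow> sum g I \<in> hset K"
  using sub by (auto simp: subspace_0 subspace_add subspace_diff subspace_scale subspace_sum)

lemma ip_zero_left [simp]: "w \<in> hset K \<Longrightarrow> hip K 0 w = 0"
  using ip_scale[of 0 w 0] by simp

lemma ip_zero_right [simp]: "w \<in> hset K \<Longrightarrow> hip K w 0 = 0"
  using ip_cnj[of 0 w] by simp

lemma ip_diff: "x \<in> hset K \<Longrightarrow> y \<in> hset K \<Longrightarrow> w \<in> hset K \<Longrightarrow> hip K (x - y) w = hip K x w - hip K y w"
  using ip_add[of "x - y" y w] by simp

lemma ip_add_right: "x \<in> hset K \<Longrightarrow> y \<in> hset K \<Longrightarrow> w \<in> hset K \<Longrightarrow> hip K w (x + y) = hip K w x + hip K w y"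
  using ip_cnj[of "x + y" w] ip_cnj[of x w] ip_cnj[of y w] ip_add[of x y w] by simp

lemma ip_diff_right: "x \<in> hset K \<Longrightarrow> y \<in> hset K \<Longrightarrow> w \<in> hset K \<Longrightarrow> hip K w (x - y) = hip K w x - hip K w y"
  using ip_cnj[of "x - y" w] ip_cnj[of x w] ip_cnj[of y w] ip_diff[of x y w] by simp

lemma ip_scale_right: "x \<in> hset K \<Longrightarrow> w \<in> hset K \<Longrightarrow> hip K w (hscale K c x) = cnj c * hip K w x"
  using ip_cnj[of "hscale K c x" w] ip_cnj[of x w] ip_scale[of x w c] by simp

lemma ip_self: "x \<in> hset K \<Longrightarrow> hip K x x = complex_of_real ((hnorm K x)\<^sup>2)"
proof -
  assume x: "x \<in> hset K"
  have im: "Im (hip K x x) = 0" using ip_cnj[OF x x] by (metis complex_cnj cancel_comm_monoid_add_class.diff_cancel complex.sel(2) equation_minus_iff neg_equal_zero cnj.simps(2))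
  have "Re (hip K x x) \<ge> 0" using ip_pos[OF x] x by (cases "x = 0") (auto simp: less_imp_le)
  then show ?thesis using im by (simp add: hnorm_def complex_eq_iff)
qed

lemma hnorm_nonneg [simp]: "x \<in> hset K \<Longrightarrow> 0 \<le> hnorm K x"
  using ip_pos[of x] by (cases "x = 0") (auto simp: hnorm_def less_imp_le)

lemma hnorm_eq_0: "x \<in> hset K \<Longrightarrow> hnorm K x = 0 \<longleftrightarrow> x = 0"
  using ip_pos[of x] by (cases "x = 0") (auto simp: hnorm_def)

lemma cauchy_schwarz:
  assumes x: "x \<in> hset K" and y: "y \<in> hset K"
  shows "cmod (hip K x y) \<le> hnorm K x * hnorm K y"
proof (cases "y = 0")
  case True
  then show ?thesis using x y by simp
next
  case False
  define r where "r = (hnorm K y)\<^sup>2"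
  have r: "r > 0" "hip K y y = complex_of_real r"
    using False y ip_self[OF y] hnorm_eq_0[OF y] by (auto simp: r_def)
  define p where "p = hip K x y"
  define c where "c = p / complex_of_real r"
  define v where "v = x - hscale K c y"
  have v: "v \<in> hset K" using x y by (simp add: v_def)
  have yx: "hip K y x = cnj p" using ip_cnj[OF x y] by (simp add: p_def)
  have "hip K v v = hip K x x - cnj c * p - c * cnj p + c * cnj c * complex_of_real r"
    unfolding v_def using x y
    by (simp add: ip_diff ip_diff_right ip_scale ip_scale_right yx r p_def[symmetric] algebra_simps)
  also have "\<dots> = hip K x x - p * cnj p / complex_of_real r"
    using r by (simp add: c_def field_simps)
  finally have "complex_of_real ((hnorm K v)\<^sup>2) = complex_of_real ((hnorm K x)\<^sup>2 - (cmod p)\<^sup>2 / r)"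
    by (simp add: ip_self v x complex_norm_square [symmetric] del: of_real_power)
  then have "0 \<le> (hnorm K x)\<^sup>2 - (cmod p)\<^sup>2 / r" by (metis of_real_eq_iff zero_le_power2)
  then have "(cmod p)\<^sup>2 \<le> (hnorm K x * hnorm K y)\<^sup>2"
    using r(1) by (simp add: field_simps r_def power_mult_distrib)
  then show ?thesis unfolding p_def using x y by (meson abs_le_square_iff hnorm_nonneg mult_nonneg_nonneg power2_le_imp_le)
qed

lemma hnorm_triangle:
  assumes x: "x \<in> hset K" and y: "y \<in> hset K"
  shows "hnorm K (x + y) \<le> hnorm K x + hnorm K y"
proof -
  have "complex_of_real ((hnorm K (x + y))\<^sup>2) =
      hip K x x + hip K y y + (hip K x y + cnj (hip K x y))"
    using x y ip_cnj[OF x y] by (simp add: ip_self[symmetric] ip_add ip_add_right del: of_real_power)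
  then have "(hnorm K (x + y))\<^sup>2 = (hnorm K x)\<^sup>2 + (hnorm K y)\<^sup>2 + 2 * Re (hip K x y)"
    using x y by (simp add: ip_self complex_eq_iff)
  also have "\<dots> \<le> (hnorm K x)\<^sup>2 + (hnorm K y)\<^sup>2 + 2 * (hnorm K x * hnorm K y)"
    using cauchy_schwarz[OF x y] complex_Re_le_cmod[of "hip K x y"] by linarith
  also have "\<dots> = (hnorm K x + hnorm K y)\<^sup>2" by (simp add: power2_eq_square algebra_simps)
  finally show ?thesis using x y by (meson add_nonneg_nonneg hnorm_nonneg power2_le_imp_le)
qed

lemma hnorm_scale: "x \<in> hset K \<Longrightarrow> hnorm K (hscale K c x) = cmod c * hnorm K x"
proof -
  assume x: "x \<in> hset K"
  have "complex_of_real ((hnorm K (hscale K c x))\<^sup>2) = complex_of_real ((cmod c * hnorm K x)\<^sup>2)"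
    using x by (simp add: ip_self[symmetric] ip_scale ip_scale_right del: of_real_power)
      (simp add: ip_self power_mult_distrib complex_norm_square algebra_simps flip: of_real_power)
  then have "(hnorm K (hscale K c x))\<^sup>2 = (cmod c * hnorm K x)\<^sup>2" by (metis of_real_eq_iff)
  then show ?thesis using x by (simp add: power2_eq_iff_nonneg)
qed

lemma hnorm_sum:
  "(\<And>i. i \<in> I \<Longrightarrow> g i \<in> hset K) \<Longrightarrow> hnorm K (sum g I) \<le> (\<Sum>i\<in>I. hnorm K (g i))"
proof (induction I rule: infinite_finite_induct)
  case (insert i I)
  then show ?case
    using hnorm_triangle[of "g i" "sum g I"] by force
qed (auto simp: hnorm_def)

end

text \<open>Operators are functions that are undefined outside of the space.\<close>

definition bop :: "'h::ab_group_add hilbert \<Rightarrow> ('h \<Rightarrow> 'h) set" where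
  "bop K = {T \<in> hset K \<rightarrow>\<^sub>E hset K.
     (\<forall>x\<in>hset K. \<forall>y\<in>hset K. T (x + y) = T x + T y) \<and>
     (\<forall>c. \<forall>x\<in>hset K. T (hscale K c x) = hscale K c (T x)) \<and>
     (\<exists>c. \<forall>x\<in>hset K. hnorm K (T x) \<le> c * hnorm K x)}"

definition op_norm :: "'h hilbert \<Rightarrow> ('h \<Rightarrow> 'h) \<Rightarrow> real" where
  "op_norm K T = Inf {c. 0 \<le> c \<and> (\<forall>x\<in>hset K. hnorm K (T x) \<le> c * hnorm K x)}"

definition is_adjoint :: "'h hilbert \<Rightarrow> ('h \<Rightarrow> 'h) \<Rightarrow> ('h \<Rightarrow> 'h) \<Rightarrow> bool" where
  "is_adjoint K T T' \<longleftrightarrow> (\<forall>x\<in>hset K. \<forall>y\<in>hset K. hip K (T x) y = hip K x (T' y))"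

definition partial_isometry :: "'h::ab_group_add hilbert \<Rightarrow> ('h \<Rightarrow> 'h) \<Rightarrow> bool" where
  "partial_isometry K T \<longleftrightarrow> T \<in> bop K \<and>
     (\<forall>x\<in>hset K. (\<forall>y\<in>hset K. T y = 0 \<longrightarrow> hip K x y = 0) \<longrightarrow> hnorm K (T x) = hnorm K x)"

definition ell2 :: "'a set \<Rightarrow> ('a \<Rightarrow> complex) hilbert" where
  "ell2 S = \<lparr>hscale = (\<lambda>c f x. c * f x),
     hset = {f. (\<forall>x. x \<notin> S \<longrightarrow> f x = 0) \<and> (\<lambda>x. (cmod (f x))\<^sup>2) summable_on S},
     hip = (\<lambda>f g. \<Sum>\<^sub>\<infinity>x\<in>S. f x * cnj (g x))\<rparr>"


section \<open>Representations and the full norm\<close>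

definition semigroup_rep ::
    "'a set \<Rightarrow> ('a \<Rightarrow> 'a \<Rightarrow> 'a) \<Rightarrow> 'h::ab_group_add hilbert \<Rightarrow> ('a \<Rightarrow> 'h \<Rightarrow> 'h) \<Rightarrow> bool" where
  "semigroup_rep S mul K \<pi> \<longleftrightarrow>
     (\<forall>s\<in>S. partial_isometry K (\<pi> s)) \<and>
     (\<forall>s\<in>S. \<forall>t\<in>S. \<pi> (mul s t) = compose (hset K) (\<pi> s) (\<pi> t)) \<and>
     (\<forall>s\<in>S. is_adjoint K (\<pi> s) (\<pi> (sinv S mul s)))"

text \<open>
  Elements of the complex semigroup algebra are the \<open>f :: 'a \<Rightarrow>\<^sub>0 complex\<close> with
  \<open>keys f \<subseteq> S\<close>. The product that \<open>Poly_Mapping\<close> puts on this type is unrelated (it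
  is the convolution over an additive monoid) and is not used.
\<close>

definition rep_lift ::
    "'h::ab_group_add hilbert \<Rightarrow> ('a \<Rightarrow> 'h \<Rightarrow> 'h) \<Rightarrow> ('a \<Rightarrow>\<^sub>0 complex) \<Rightarrow> 'h \<Rightarrow> 'h" where
  "rep_lift K \<pi> f =
     (\<lambda>x\<in>hset K. \<Sum>s\<in>Poly_Mapping.keys f. hscale K (Poly_Mapping.lookup f s) (\<pi> s x))"

text \<open>
  The supremum over all representations has to range over the Hilbert spaces on one fixed type.
  Those inside \<open>'a option \<Rightarrow> complex\<close> suffice; see \<open>cstar_norm_upper\<close> below for the bound on
  arbitrary Hilbert spaces on arbitrary types. The same type serves for every inverse subsemigroup of \<open>S\<close>.
\<close>

definition cstar_norm :: "'a set \<Rightarrow> ('a \<Rightarrow> 'a \<Rightarrow> 'a) \<Rightarrow> ('a \<Rightarrow>\<^sub>0 complex) \<Rightarrow> real" where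
  "cstar_norm S mul f =
     Sup {op_norm K (rep_lift K \<pi> f) | (K :: ('a option \<Rightarrow> complex) hilbert) \<pi>.
            hilbert_space K \<and> semigroup_rep S mul K \<pi>}"

context hilbert_space
begin

lemma op_norm_le: "0 \<le> c \<Longrightarrow> (\<And>x. x \<in> hset K \<Longrightarrow> hnorm K (T x) \<le> c * hnorm K x) \<Longrightarrow> op_norm K T \<le> c"
  unfolding op_norm_def by (rule cInf_lower) (auto intro: bdd_belowI[of _ 0])

lemma le_op_norm:
  assumes "\<And>x. x \<in> hset K \<Longrightarrow> hnorm K (T x) \<le> c * hnorm K x" and "0 \<le> c" and x: "x \<in> hset K"
  shows "hnorm K (T x) \<le> op_norm K T * hnorm K x"
proof (cases "x = 0")
  case True
  then show ?thesis using assms(1)[OF x] by (simp add: hnorm_def)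
next
  case False
  then have pos: "hnorm K x > 0" using x hnorm_nonneg[OF x] hnorm_eq_0[OF x] by linarith
  have "hnorm K (T x) / hnorm K x \<le> op_norm K T"
    unfolding op_norm_def
  proof (rule cInf_greatest)
    show "{c. 0 \<le> c \<and> (\<forall>x\<in>hset K. hnorm K (T x) \<le> c * hnorm K x)} \<noteq> {}" using assms by blast
    show "hnorm K (T x) / hnorm K x \<le> d"
      if "d \<in> {c. 0 \<le> c \<and> (\<forall>x\<in>hset K. hnorm K (T x) \<le> c * hnorm K x)}" for d
      using that x pos by (simp add: divide_le_eq)
  qed
  then show ?thesis using pos by (simp add: divide_le_eq)
qed

lemma op_norm_nonneg: "op_norm K T \<ge> 0" if "\<And>x. x \<in> hset K \<Longrightarrow> hnorm K (T x) \<le> c * hnorm K x" "0 \<le> c"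
  unfolding op_norm_def by (rule cInf_greatest) (use that in auto)

end
lemma (in inverse_semigroup) sinv_props:
  assumes "s \<in> S"
  shows "sinv S mul s \<in> S" "mul (mul s (sinv S mul s)) s = s"
    "mul (mul (sinv S mul s) s) (sinv S mul s) = sinv S mul s"
  using theI'[OF ex1_inverse[OF assms]] by (auto simp: sinv_def)

lemma (in inverse_semigroup) sinv_sinv: "s \<in> S \<Longrightarrow> sinv S mul (sinv S mul s) = s"
  using sinv_props[of s] the1_equality[OF ex1_inverse[of "sinv S mul s"], of s]
  by (simp add: sinv_def)

lemma (in hilbert_space) regular_contractive:
  assumes lin: "\<And>x. x \<in> hset K \<Longrightarrow> T x \<in> hset K" "\<And>x. x \<in> hset K \<Longrightarrow> T' x \<in> hset K"
    and adj: "is_adjoint K T T'" and adj': "is_adjoint K T' T"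
    and reg: "\<And>x. x \<in> hset K \<Longrightarrow> T (T' (T x)) = T x" and x: "x \<in> hset K"
  shows "hnorm K (T x) \<le> hnorm K x" and "T' (T x) = x \<Longrightarrow> hnorm K (T x) = hnorm K x"
proof -
  let ?P = "\<lambda>x. T' (T x)"
  have Px: "?P x \<in> hset K" using lin x by blast
  have a: "hip K (T x) (T x) = hip K x (?P x)"
    using adj x lin by (simp add: is_adjoint_def)
  have b: "hip K (?P x) (?P x) = hip K (T x) (T x)"
    using adj' x lin Px reg[OF x] by (simp add: is_adjoint_def)
  have eq: "hnorm K (?P x) = hnorm K (T x)" using b by (simp add: hnorm_def)
  have "(hnorm K (T x))\<^sup>2 = cmod (hip K x (?P x))"
    using a ip_self[OF lin(1)[OF x]] by (metis abs_of_nonneg norm_of_real zero_le_power2)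
  also have "\<dots> \<le> hnorm K x * hnorm K (T x)"
    using cauchy_schwarz[OF x Px] eq by simp
  finally show "hnorm K (T x) \<le> hnorm K x"
    using hnorm_nonneg[OF x] hnorm_nonneg[OF lin(1)[OF x]]
    by (metis mult_right_le_imp_le order_le_less power2_eq_square)
  show "T' (T x) = x \<Longrightarrow> hnorm K (T x) = hnorm K x" using eq by simp
qed

lemma rep_facts:
  fixes K :: "'h::ab_group_add hilbert"
  assumes "inverse_semigroup S mul" "hilbert_space K" "semigroup_rep S mul K \<pi>" "s \<in> S"
  shows "\<pi> s \<in> bop K" "\<And>x. x \<in> hset K \<Longrightarrow> \<pi> s x \<in> hset K"
    "\<And>x. x \<in> hset K \<Longrightarrow> hnorm K (\<pi> s x) \<le> hnorm K x"
    "is_adjoint K (\<pi> s) (\<pi> (sinv S mul s))" "is_adjoint K (\<pi> (sinv S mul s)) (\<pi> s)"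
    "\<And>x. x \<in> hset K \<Longrightarrow> \<pi> s (\<pi> (sinv S mul s) (\<pi> s x)) = \<pi> s x"
proof -
  interpret inverse_semigroup S mul by fact
  interpret hilbert_space K by fact
  let ?t = "sinv S mul s"
  have b: "\<pi> s' \<in> bop K" if "s' \<in> S" for s'
    using assms(3) that by (simp add: semigroup_rep_def partial_isometry_def)
  show "\<pi> s \<in> bop K" by (rule b) fact
  have m: "\<pi> s' x \<in> hset K" if "s' \<in> S" "x \<in> hset K" for s' x
    using b[OF that(1)] that(2) by (auto simp: bop_def)
  show "\<And>x. x \<in> hset K \<Longrightarrow> \<pi> s x \<in> hset K" using m assms(4) by blast
  show adj: "is_adjoint K (\<pi> s) (\<pi> ?t)" using assms by (simp add: semigroup_rep_def)
  have "is_adjoint K (\<pi> ?t) (\<pi> (sinv S mul ?t))"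
    using assms(3) sinv_props[OF assms(4)] by (simp add: semigroup_rep_def)
  then show adj': "is_adjoint K (\<pi> ?t) (\<pi> s)" using sinv_sinv assms(4) by simp
  have "\<pi> (mul (mul s ?t) s) = compose (hset K) (compose (hset K) (\<pi> s) (\<pi> ?t)) (\<pi> s)"
    using assms(3) assms(4) sinv_props(1)[OF assms(4)] closed by (simp add: semigroup_rep_def)
  then have "\<pi> s = compose (hset K) (compose (hset K) (\<pi> s) (\<pi> ?t)) (\<pi> s)"
    using sinv_props(2)[OF assms(4)] by simp
  then show reg: "\<pi> s (\<pi> ?t (\<pi> s x)) = \<pi> s x" if "x \<in> hset K" for x
    using that m[OF assms(4) that] by (metis compose_eq)
  show "hnorm K (\<pi> s x) \<le> hnorm K x" if "x \<in> hset K" for x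
    by (rule regular_contractive(1)[where T' = "\<pi> ?t"])
      (use that adj adj' reg m assms(4) sinv_props(1) in auto)
qed

lemma rep_lift_bound:
  fixes K :: "'h::ab_group_add hilbert"
  assumes "inverse_semigroup S mul" "hilbert_space K" "semigroup_rep S mul K \<pi>"
    and f: "Poly_Mapping.keys f \<subseteq> S" and x: "x \<in> hset K"
  shows "rep_lift K \<pi> f x \<in> hset K"
    and "hnorm K (rep_lift K \<pi> f x) \<le>
      (\<Sum>s\<in>Poly_Mapping.keys f. cmod (Poly_Mapping.lookup f s)) * hnorm K x"
proof -
  interpret hilbert_space K by fact
  have m: "\<pi> s x \<in> hset K" if "s \<in> Poly_Mapping.keys f" for s
    using rep_facts(2)[OF assms(1-3) _ x] that f by blast
  show "rep_lift K \<pi> f x \<in> hset K" using x m by (auto simp: rep_lift_def)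
  have "hnorm K (rep_lift K \<pi> f x) \<le>
      (\<Sum>s\<in>Poly_Mapping.keys f. hnorm K (hscale K (Poly_Mapping.lookup f s) (\<pi> s x)))"
    using x m by (auto simp: rep_lift_def intro!: hnorm_sum)
  also have "\<dots> \<le> (\<Sum>s\<in>Poly_Mapping.keys f. cmod (Poly_Mapping.lookup f s) * hnorm K x)"
    using rep_facts(3)[OF assms(1-3) _ x] f m
    by (intro sum_mono) (auto simp: hnorm_scale intro!: mult_left_mono)
  finally show "hnorm K (rep_lift K \<pi> f x) \<le>
      (\<Sum>s\<in>Poly_Mapping.keys f. cmod (Poly_Mapping.lookup f s)) * hnorm K x"
    by (simp add: sum_distrib_right)
qed

lemma cstar_norm_ge:
  fixes S :: "'a set" and K :: "('a option \<Rightarrow> complex) hilbert"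
  assumes "inverse_semigroup S mul" "hilbert_space K" "semigroup_rep S mul K \<pi>"
    and f: "Poly_Mapping.keys f \<subseteq> S"
  shows "op_norm K (rep_lift K \<pi> f) \<le> cstar_norm S mul f"
  unfolding cstar_norm_def
proof (rule cSup_upper)
  show "op_norm K (rep_lift K \<pi> f) \<in> {op_norm K (rep_lift K \<pi> f) | (K :: ('a option \<Rightarrow> complex) hilbert) \<pi>.
            hilbert_space K \<and> semigroup_rep S mul K \<pi>}" using assms by blast
  show "bdd_above {op_norm K (rep_lift K \<pi> f) | (K :: ('a option \<Rightarrow> complex) hilbert) \<pi>.
            hilbert_space K \<and> semigroup_rep S mul K \<pi>}"
    by (rule bdd_aboveI[of _ "\<Sum>s\<in>Poly_Mapping.keys f. cmod (Poly_Mapping.lookup f s)"])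
      (use rep_lift_bound(2)[OF assms(1) _ _ f] in
        \<open>auto intro!: hilbert_space.op_norm_le sum_nonneg\<close>)
qed

text \<open>
  Every representation, on a Hilbert space inside whatever type, is dominated by \<^const>\<open>cstar_norm\<close>.
  For a vector \<open>x\<close>, the closed subspace \<open>W\<close> generated by \<open>x\<close> and the \<open>\<pi> s x\<close> (written as a double
  orthogonal complement) is invariant, and it embeds into \<open>'a option \<Rightarrow> complex\<close> by taking
  inner products with these vectors.
\<close>

lemma cstar_norm_upper:
  fixes S :: "'a set" and K :: "'h::ab_group_add hilbert"
  assumes "inverse_semigroup S mul" "hilbert_space K" "semigroup_rep S mul K \<pi>"
    and f: "Poly_Mapping.keys f \<subseteq> S"
  shows "op_norm K (rep_lift K \<pi> f) \<le> cstar_norm S mul f"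
proof -
  interpret inverse_semigroup S mul by fact
  interpret hilbert_space K by fact
  note rep = rep_facts[OF assms(1-3)]
  have inv: "sinv S mul s \<in> S" if "s \<in> S" for s using sinv_props that by blast
  have key: "hnorm K (rep_lift K \<pi> f x) \<le> cstar_norm S mul f * hnorm K x \<and> 0 \<le> cstar_norm S mul f"
    if x: "x \<in> hset K" for x
  proof -
    define D where "D = insert x ((\<lambda>s. \<pi> s x) ` S)"
    define W where "W = {v \<in> hset K. \<forall>y\<in>hset K. (\<forall>d\<in>D. hip K d y = 0) \<longrightarrow> hip K v y = 0}"
    have D: "D \<subseteq> hset K" using x rep(2) by (auto simp: D_def)
    have WK: "v \<in> hset K" if "v \<in> W" for v using that by (simp add: W_def)
    have xW: "x \<in> W" using x by (auto simp: W_def D_def)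
    have Wsub: "subspace W"
      by (auto simp: subspace_def W_def ip_add ip_scale)
    have pD: "\<pi> s d \<in> D" if sd: "s \<in> S" "d \<in> D" for s d
    proof (cases "d = x")
      case False
      then obtain t where t: "t \<in> S" "d = \<pi> t x" using sd(2) unfolding D_def by blast
      have "\<pi> (mul s t) = compose (hset K) (\<pi> s) (\<pi> t)"
        using assms(3) that(1) t(1) by (simp add: semigroup_rep_def)
      then have "\<pi> s d = \<pi> (mul s t) x" using x by (simp add: t(2) compose_def)
      then show ?thesis using closed that(1) t(1) by (auto simp: D_def)
    qed (use that in \<open>auto simp: D_def\<close>)
    have pW: "\<pi> s v \<in> W" if s: "s \<in> S" and v: "v \<in> W" for s v
    proof -
      have "hip K (\<pi> s v) y = 0" if y: "y \<in> hset K" "\<forall>d\<in>D. hip K d y = 0" for y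
      proof -
        have "hip K d (\<pi> (sinv S mul s) y) = 0" if "d \<in> D" for d
          using rep(4)[OF s] D that y pD[OF s that] by (auto simp: is_adjoint_def subset_iff)
        then have "hip K v (\<pi> (sinv S mul s) y) = 0"
          using v rep(2)[OF inv[OF s] y(1)] by (auto simp: W_def)
        then show ?thesis using rep(4)[OF s] y(1) WK[OF v] by (auto simp: is_adjoint_def)
      qed
      then show ?thesis using rep(2)[OF s] WK[OF v] by (auto simp: W_def)
    qed
    define J where "J = (\<lambda>v w. case w of None \<Rightarrow> hip K v x
       | Some s \<Rightarrow> if s \<in> S then hip K v (\<pi> s x) else 0)"
    have Jadd: "J (v + w) = J v + J w" if "v \<in> hset K" "w \<in> hset K" for v w
      using that x rep(2) by (auto simp: J_def fun_eq_iff ip_add split: option.split)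
    have Jscale: "J (hscale K c v) = (\<lambda>o'. c * J v o')" if "v \<in> hset K" for v c
      using that x rep(2) by (auto simp: J_def fun_eq_iff ip_scale split: option.split)
    have Jdiff: "J (v - w) = J v - J w" if "v \<in> hset K" "w \<in> hset K" for v w
      using Jadd[of "v - w" w] that by simp
    have Jinj: "inj_on J W"
    proof (rule inj_onI)
      fix v w assume vw: "v \<in> W" "w \<in> W" "J v = J w"
      let ?u = "v - w"
      have u: "?u \<in> W" using vw Wsub by (simp add: subspace_diff)
      have "J ?u = 0" using Jdiff vw WK by simp
      then have "hip K ?u x = 0" "\<And>s. s \<in> S \<Longrightarrow> hip K ?u (\<pi> s x) = 0"
        by (auto simp: J_def fun_eq_iff split: option.split_asm if_split_asm)
      then have "hip K ?u d = 0" if "d \<in> D" for d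
        using that by (auto simp: D_def)
      then have "hip K d ?u = 0" if "d \<in> D" for d
        using that D ip_cnj[of ?u d] WK[OF u] by (simp add: subset_iff)
      then have "hip K ?u ?u = 0" using u by (auto simp: W_def)
      then show "v = w" using ip_pos[of ?u] WK[OF u] by auto
    qed
    define L where "L = inv_into W J"
    have LJ [simp]: "L (J v) = v" if "v \<in> W" for v using Jinj that by (simp add: L_def)
    define K' where "K' = \<lparr>hscale = (\<lambda>c g w. c * g w), hset = J ` W, hip = (\<lambda>g h. hip K (L g) (L h))\<rparr>"
    have K'sel: "hscale K' = (\<lambda>c g w. c * g w)" "hset K' = J ` W" "hip K' = (\<lambda>g h. hip K (L g) (L h))"
      by (auto simp: K'_def)
    have Wadd: "v + w \<in> W" if "v \<in> W" "w \<in> W" for v w using that Wsub by (simp add: subspace_add)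
    have Wdiff: "v - w \<in> W" if "v \<in> W" "w \<in> W" for v w using that Wsub by (simp add: subspace_diff)
    have Wscale: "hscale K c v \<in> W" if "v \<in> W" for v c using that Wsub by (simp add: subspace_scale)
    have Jadd': "J v + J w = J (v + w)" if "v \<in> W" "w \<in> W" for v w using that Jadd WK by simp
    have Jdiff': "J v - J w = J (v - w)" if "v \<in> W" "w \<in> W" for v w using that Jdiff WK by simp
    have Jscale': "hscale K' c (J v) = J (hscale K c v)" if "v \<in> W" for v c
      using that Jscale WK by (simp add: K'sel)
    have ip': "hip K' (J v) (J w) = hip K v w" if "v \<in> W" "w \<in> W" for v w
      using that by (simp add: K'sel)
    have norm': "hnorm K' (J v) = hnorm K v" if "v \<in> W" for v
      using that by (simp add: hnorm_def ip')
    have J0: "J 0 = 0" using Jdiff[OF x x] by simp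
    have hilb': "hilbert_space K'"
    proof -
      have vs: "vector_space (hscale K')"
        by unfold_locales (auto simp: K'sel fun_eq_iff algebra_simps)
      then interpret V: vector_space "hscale K'" .
      have sub': "V.subspace (hset K')"
        unfolding V.subspace_def
      proof (intro conjI ballI allI)
        show "0 \<in> hset K'" using J0 Wsub subspace_0 by (force simp: K'sel)
        show "g + h \<in> hset K'" if "g \<in> hset K'" "h \<in> hset K'" for g h
          using that Wadd by (auto simp: K'sel(2) Jadd')
        show "hscale K' c g \<in> hset K'" if "g \<in> hset K'" for g c
          using that Wscale by (auto simp: K'sel(2) Jscale')
      qed
      show ?thesis
      proof (unfold_locales)
        show "V.subspace (hset K')" by (rule sub')
        show "hip K' (g + h) k = hip K' g k + hip K' h k"
          if "g \<in> hset K'" "h \<in> hset K'" "k \<in> hset K'" for g h k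
          using that by (auto simp: K'sel(2) Jadd' ip' Wadd ip_add WK)
        show "hip K' (hscale K' c g) k = c * hip K' g k"
          if "g \<in> hset K'" "k \<in> hset K'" for g k c
          using that by (auto simp: K'sel(2) Jscale' ip' Wscale ip_scale WK)
        show "hip K' h g = cnj (hip K' g h)" if "g \<in> hset K'" "h \<in> hset K'" for g h
          using that by (auto simp: K'sel(2) ip') (metis ip_cnj WK)
        show "Re (hip K' g g) > 0" if g: "g \<in> hset K'" "g \<noteq> 0" for g
        proof -
          obtain v where v: "v \<in> W" "g = J v" using g(1) by (auto simp: K'sel(2))
          then have "v \<noteq> 0" using g(2) J0 by auto
          then show ?thesis using v ip_pos WK by (auto simp: ip')
        qed
        fix u :: "nat \<Rightarrow> 'a option \<Rightarrow> complex"
        assume u: "\<And>n. u n \<in> hset K'"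
          and cau: "\<And>e. e > 0 \<Longrightarrow> \<exists>N. \<forall>m\<ge>N. \<forall>n\<ge>N. hnorm K' (u m - u n) < e"
        define w where "w n = L (u n)" for n
        have w: "w n \<in> W" "u n = J (w n)" for n
          using u[of n] by (auto simp: w_def K'sel(2))
        have "hnorm K' (u m - u n) = hnorm K (w m - w n)" for m n
          using w norm' Jdiff' Wdiff by metis
        then obtain v where v: "v \<in> hset K" "(\<lambda>n. hnorm K (w n - v)) \<longlonglongrightarrow> 0"
          using complete[of w] cau w WK by auto
        have "v \<in> W"
        proof -
          have "hip K v y = 0" if y: "y \<in> hset K" "\<forall>d\<in>D. hip K d y = 0" for y
          proof -
            have "cmod (hip K v y) \<le> hnorm K (w n - v) * hnorm K y" for n
            proof -
              have "hip K (w n) y = 0" using w(1)[of n] y by (auto simp: W_def)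
              then have "hip K (w n - v) y = - hip K v y" using ip_diff[of "w n" v y] w WK v y by simp
              then show ?thesis using cauchy_schwarz[of "w n - v" y] w WK v y by simp
            qed
            moreover have "(\<lambda>n. hnorm K (w n - v) * hnorm K y) \<longlonglongrightarrow> 0 * hnorm K y"
              by (intro tendsto_intros v)
            ultimately have "cmod (hip K v y) \<le> 0 * hnorm K y"
              by (intro tendsto_lowerbound[of _ _ sequentially]) auto
            then show ?thesis by simp
          qed
          then show ?thesis using v by (auto simp: W_def)
        qed
        moreover have "hnorm K' (u n - J v) = hnorm K (w n - v)" for n
          using w norm' Jdiff' Wdiff \<open>v \<in> W\<close> by metis
        ultimately show "\<exists>g\<in>hset K'. (\<lambda>n. hnorm K' (u n - g)) \<longlonglongrightarrow> 0"
          using v by (intro bexI[of _ "J v"]) (auto simp: K'sel(2))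
      qed
    qed
    define \<pi>' where "\<pi>' s = (\<lambda>g\<in>J ` W. J (\<pi> s (L g)))" for s
    have p'J: "\<pi>' s (J v) = J (\<pi> s v)" if "v \<in> W" for s v
      using that by (simp add: \<pi>'_def)
    have bop': "\<pi>' s \<in> bop K'" if s: "s \<in> S" for s
      unfolding bop_def
    proof (intro CollectI conjI ballI allI exI[of _ 1])
      have b: "\<pi> s \<in> bop K" by (rule rep(1)[OF s])
      show "\<pi>' s \<in> hset K' \<rightarrow>\<^sub>E hset K'"
        using pW[OF s] by (auto simp: \<pi>'_def K'sel(2))
      show "\<pi>' s (g + h) = \<pi>' s g + \<pi>' s h" if "g \<in> hset K'" "h \<in> hset K'" for g h
        using that b pW[OF s] by (auto simp: K'sel(2) Jadd' p'J Wadd bop_def WK)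
      show "\<pi>' s (hscale K' c g) = hscale K' c (\<pi>' s g)" if "g \<in> hset K'" for c g
        using that b pW[OF s] by (auto simp: K'sel(2) Jscale' p'J Wscale bop_def WK)
      show "hnorm K' (\<pi>' s g) \<le> 1 * hnorm K' g" if "g \<in> hset K'" for g
        using that rep(3)[OF s] pW[OF s] by (auto simp: K'sel(2) p'J norm' WK)
    qed
    have adj': "is_adjoint K' (\<pi>' s) (\<pi>' (sinv S mul s))" if s: "s \<in> S" for s
      using rep(4)[OF s] pW[OF s] pW[OF inv[OF s]]
      by (auto simp: is_adjoint_def K'sel(2) p'J ip' WK)
    interpret H': hilbert_space K' by (rule hilb')
    have rep': "semigroup_rep S mul K' \<pi>'"
      unfolding semigroup_rep_def
    proof (intro conjI ballI)
      fix s assume s: "s \<in> S"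
      let ?t = "sinv S mul s"
      show "is_adjoint K' (\<pi>' s) (\<pi>' ?t)" by (rule adj'[OF s])
      have adj2: "is_adjoint K' (\<pi>' ?t) (\<pi>' s)" using adj'[OF inv[OF s]] sinv_sinv[OF s] by simp
      have mem': "\<pi>' s g \<in> hset K'" "\<pi>' ?t g \<in> hset K'" if "g \<in> hset K'" for g
        using bop'[OF s] bop'[OF inv[OF s]] that by (auto simp: bop_def)
      have reg': "\<pi>' s (\<pi>' ?t (\<pi>' s g)) = \<pi>' s g" if "g \<in> hset K'" for g
        using that pW[OF s] pW[OF inv[OF s]] rep(6)[OF s] by (auto simp: K'sel(2) p'J WK)
      show "partial_isometry K' (\<pi>' s)"
        unfolding partial_isometry_def
      proof (intro conjI ballI impI)
        show "\<pi>' s \<in> bop K'" by (rule bop'[OF s])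
        fix g assume g: "g \<in> hset K'" and perp: "\<forall>h\<in>hset K'. \<pi>' s h = 0 \<longrightarrow> hip K' g h = 0"
        let ?p = "\<pi>' ?t (\<pi>' s g)" let ?h = "g - ?p"
        have p: "?p \<in> hset K'" and h: "?h \<in> hset K'" using g mem' by auto
        have "\<pi>' s (?h + ?p) = \<pi>' s ?h + \<pi>' s ?p"
          using bop'[OF s] h p unfolding bop_def by blast
        then have ker: "\<pi>' s ?h = 0" using reg'[OF g] by simp
        have "hip K' ?p ?h = hip K' (\<pi>' s g) (\<pi>' s ?h)"
          using adj2 mem' g h by (simp add: is_adjoint_def)
        then have "hip K' ?p ?h = 0" using ker mem' g by simp
        moreover have "hip K' g ?h = 0" using perp h ker by blast
        ultimately have "hip K' ?h ?h = 0" using H'.ip_diff[OF g p h] by simp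
        then have "?h = 0" using H'.ip_pos[OF h] by auto
        then have "?p = g" by simp
        then show "hnorm K' (\<pi>' s g) = hnorm K' g"
          by (intro H'.regular_contractive(2)[of "\<pi>' s" "\<pi>' ?t"])
            (use mem' adj'[OF s] adj2 reg' g in auto)
      qed
      fix t assume t: "t \<in> S"
      have "\<pi> (mul s t) = compose (hset K) (\<pi> s) (\<pi> t)"
        using assms(3) s t by (simp add: semigroup_rep_def)
      then show "\<pi>' (mul s t) = compose (hset K') (\<pi>' s) (\<pi>' t)"
        using pW[OF t] by (auto simp: fun_eq_iff compose_def K'sel(2) p'J WK \<pi>'_def restrict_def)
    qed
    have Jsum: "J (sum g I) = (\<Sum>i\<in>I. J (g i))" if "\<And>i. i \<in> I \<Longrightarrow> g i \<in> W" for g :: "'a \<Rightarrow> 'h" and I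
      using that
    proof (induction I rule: infinite_finite_induct)
      case (insert i I)
      then have "sum g I \<in> W" by (auto intro: subspace_sum[OF Wsub])
      then show ?case using insert by (simp add: Jadd WK)
    qed (auto simp: J0)
    have fW: "rep_lift K \<pi> f x \<in> W"
      using f pW xW Wscale by (auto simp: rep_lift_def x intro!: subspace_sum[OF Wsub])
    have "rep_lift K' \<pi>' f (J x) = J (rep_lift K \<pi> f x)"
      using f pW xW Wscale x
      by (simp add: rep_lift_def K'sel(2) Jsum subset_iff p'J Jscale')
    then have "hnorm K (rep_lift K \<pi> f x) = hnorm K' (rep_lift K' \<pi>' f (J x))"
      using norm'[OF fW] by simp
    also have "\<dots> \<le> op_norm K' (rep_lift K' \<pi>' f) * hnorm K' (J x)"
      by (rule H'.le_op_norm[OF rep_lift_bound(2)[OF assms(1) hilb' rep' f]])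
        (auto simp: K'sel(2) xW intro: sum_nonneg)
    also have "\<dots> \<le> cstar_norm S mul f * hnorm K' (J x)"
      using cstar_norm_ge[OF assms(1) hilb' rep' f] xW x by (intro mult_right_mono) (auto simp: norm')
    finally have "hnorm K (rep_lift K \<pi> f x) \<le> cstar_norm S mul f * hnorm K x"
      using norm'[OF xW] by simp
    moreover have "0 \<le> op_norm K' (rep_lift K' \<pi>' f)"
      by (rule H'.op_norm_nonneg[OF rep_lift_bound(2)[OF assms(1) hilb' rep' f]])
        (auto intro: sum_nonneg)
    ultimately show ?thesis using cstar_norm_ge[OF assms(1) hilb' rep' f] by linarith
  qed
  show ?thesis using key[of 0] key by (intro op_norm_le) auto
qed

definition cstar_isometric :: "'a set \<Rightarrow> ('a \<Rightarrow> 'a \<Rightarrow> 'a) \<Rightarrow> 'a set \<Rightarrow> bool" where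
  "cstar_isometric S mul H \<longleftrightarrow>
     (\<forall>f. Poly_Mapping.keys f \<subseteq> H \<longrightarrow> cstar_norm S mul f = cstar_norm H mul f)"


section \<open>Normed star-algebras, completions and quotients\<close>

record 'b star_algebra = "'b partial_object" +
  alg_add :: "'b \<Rightarrow> 'b \<Rightarrow> 'b"
  alg_zero :: 'b
  alg_scale :: "complex \<Rightarrow> 'b \<Rightarrow> 'b"
  alg_mult :: "'b \<Rightarrow> 'b \<Rightarrow> 'b"
  alg_star :: "'b \<Rightarrow> 'b"
  alg_norm :: "'b \<Rightarrow> real"

definition alg_dist :: "'b star_algebra \<Rightarrow> 'b \<Rightarrow> 'b \<Rightarrow> real" where
  "alg_dist A x y = alg_norm A (alg_add A x (alg_scale A (-1) y))"

definition alg_closure :: "'b star_algebra \<Rightarrow> 'b set \<Rightarrow> 'b set" where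
  "alg_closure A X = {a \<in> carrier A. \<forall>e>0. \<exists>x\<in>X. alg_dist A a x < e}"

definition star_hom :: "'b star_algebra \<Rightarrow> 'c star_algebra \<Rightarrow> ('b \<Rightarrow> 'c) \<Rightarrow> bool" where
  "star_hom A B F \<longleftrightarrow> F \<in> carrier A \<rightarrow> carrier B \<and>
     (\<forall>x\<in>carrier A. \<forall>y\<in>carrier A. F (alg_add A x y) = alg_add B (F x) (F y)) \<and>
     (\<forall>c. \<forall>x\<in>carrier A. F (alg_scale A c x) = alg_scale B c (F x)) \<and>
     (\<forall>x\<in>carrier A. \<forall>y\<in>carrier A. F (alg_mult A x y) = alg_mult B (F x) (F y)) \<and>
     (\<forall>x\<in>carrier A. F (alg_star A x) = alg_star B (F x))"

definition star_iso :: "'b star_algebra \<Rightarrow> 'c star_algebra \<Rightarrow> ('b \<Rightarrow> 'c) \<Rightarrow> bool" where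
  "star_iso A B F \<longleftrightarrow> star_hom A B F \<and> bij_betw F (carrier A) (carrier B)"

definition cauchy_seqs :: "'b star_algebra \<Rightarrow> (nat \<Rightarrow> 'b) set" where
  "cauchy_seqs A = {u. (\<forall>n. u n \<in> carrier A) \<and>
     (\<forall>e>0. \<exists>N. \<forall>m\<ge>N. \<forall>n\<ge>N. alg_dist A (u m) (u n) < e)}"

definition null_rel :: "'b star_algebra \<Rightarrow> ((nat \<Rightarrow> 'b) \<times> (nat \<Rightarrow> 'b)) set" where
  "null_rel A = {(u, v). u \<in> cauchy_seqs A \<and> v \<in> cauchy_seqs A \<and>
     (\<lambda>n. alg_dist A (u n) (v n)) \<longlonglongrightarrow> 0}"

definition pick :: "'b set \<Rightarrow> 'b" where
  "pick X = (SOME x. x \<in> X)"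

definition completion :: "'b star_algebra \<Rightarrow> (nat \<Rightarrow> 'b) set star_algebra" where
  "completion A = \<lparr>
     carrier = cauchy_seqs A // null_rel A,
     alg_add = (\<lambda>X Y. null_rel A `` {\<lambda>n. alg_add A (pick X n) (pick Y n)}),
     alg_zero = null_rel A `` {\<lambda>_. alg_zero A},
     alg_scale = (\<lambda>c X. null_rel A `` {\<lambda>n. alg_scale A c (pick X n)}),
     alg_mult = (\<lambda>X Y. null_rel A `` {\<lambda>n. alg_mult A (pick X n) (pick Y n)}),
     alg_star = (\<lambda>X. null_rel A `` {\<lambda>n. alg_star A (pick X n)}),
     alg_norm = (\<lambda>X. lim (\<lambda>n. alg_norm A (pick X n)))\<rparr>"

definition completion_emb :: "'b star_algebra \<Rightarrow> 'b \<Rightarrow> (nat \<Rightarrow> 'b) set" where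
  "completion_emb A x = null_rel A `` {\<lambda>_. x}"

definition two_sided_ideal :: "'b star_algebra \<Rightarrow> 'b set \<Rightarrow> bool" where
  "two_sided_ideal A I \<longleftrightarrow> I \<subseteq> carrier A \<and> alg_zero A \<in> I \<and>
     (\<forall>x\<in>I. \<forall>y\<in>I. alg_add A x y \<in> I) \<and>
     (\<forall>c. \<forall>x\<in>I. alg_scale A c x \<in> I) \<and>
     (\<forall>a\<in>carrier A. \<forall>x\<in>I. alg_mult A a x \<in> I \<and> alg_mult A x a \<in> I)"

definition generated_ideal :: "'b star_algebra \<Rightarrow> 'b \<Rightarrow> 'b set" where
  "generated_ideal A x = \<Inter>{I. two_sided_ideal A I \<and> x \<in> I}"

definition coset :: "'b star_algebra \<Rightarrow> 'b set \<Rightarrow> 'b \<Rightarrow> 'b set" where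
  "coset A I a = alg_add A a ` I"

definition quotient_algebra :: "'b star_algebra \<Rightarrow> 'b set \<Rightarrow> 'b set star_algebra" where
  "quotient_algebra A I = \<lparr>
     carrier = coset A I ` carrier A,
     alg_add = (\<lambda>X Y. coset A I (alg_add A (pick X) (pick Y))),
     alg_zero = coset A I (alg_zero A),
     alg_scale = (\<lambda>c X. coset A I (alg_scale A c (pick X))),
     alg_mult = (\<lambda>X Y. coset A I (alg_mult A (pick X) (pick Y))),
     alg_star = (\<lambda>X. coset A I (alg_star A (pick X))),
     alg_norm = (\<lambda>X. Inf (alg_norm A ` X))\<rparr>"

text \<open>The bounded operators on a Hilbert space.\<close>

definition bop_algebra :: "'h::ab_group_add hilbert \<Rightarrow> ('h \<Rightarrow> 'h) star_algebra" where
  "bop_algebra K = \<lparr>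
     carrier = bop K,
     alg_add = (\<lambda>T U. \<lambda>x\<in>hset K. T x + U x),
     alg_zero = (\<lambda>x\<in>hset K. 0),
     alg_scale = (\<lambda>c T. \<lambda>x\<in>hset K. hscale K c (T x)),
     alg_mult = compose (hset K),
     alg_star = (\<lambda>T. THE T'. T' \<in> bop K \<and> is_adjoint K T T'),
     alg_norm = op_norm K\<rparr>"


section \<open>The \<open>C\<^sup>*\<close>-algebras of an inverse semigroup\<close>

definition semigroup_algebra ::
    "'a set \<Rightarrow> ('a \<Rightarrow> 'a \<Rightarrow> 'a) \<Rightarrow> ('a \<Rightarrow>\<^sub>0 complex) star_algebra" where
  "semigroup_algebra S mul = \<lparr>
     carrier = {f. Poly_Mapping.keys f \<subseteq> S},
     alg_add = (+),
     alg_zero = 0,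
     alg_scale = (\<lambda>c. Poly_Mapping.map ((*) c)),
     alg_mult = (\<lambda>f g. \<Sum>s\<in>Poly_Mapping.keys f. \<Sum>t\<in>Poly_Mapping.keys g.
        Poly_Mapping.single (mul s t) (Poly_Mapping.lookup f s * Poly_Mapping.lookup g t)),
     alg_star = (\<lambda>f. \<Sum>s\<in>Poly_Mapping.keys f.
        Poly_Mapping.single (sinv S mul s) (cnj (Poly_Mapping.lookup f s))),
     alg_norm = cstar_norm S mul\<rparr>"

definition cstar ::
    "'a set \<Rightarrow> ('a \<Rightarrow> 'a \<Rightarrow> 'a) \<Rightarrow> (nat \<Rightarrow> 'a \<Rightarrow>\<^sub>0 complex) set star_algebra" where
  "cstar S mul = completion (semigroup_algebra S mul)"

definition cstar_emb ::
    "'a set \<Rightarrow> ('a \<Rightarrow> 'a \<Rightarrow> 'a) \<Rightarrow> ('a \<Rightarrow>\<^sub>0 complex) \<Rightarrow> (nat \<Rightarrow> 'a \<Rightarrow>\<^sub>0 complex) set" where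
  "cstar_emb S mul = completion_emb (semigroup_algebra S mul)"

text \<open>
  The matrix form of \<open>\<Lambda>(a)\<close>: the coefficient at \<open>c\<close> of \<open>\<Lambda>(a) \<xi>\<close> collects the \<open>\<xi> b\<close> with
  \<open>\<Lambda>(a) \<delta>\<^sub>b = \<delta>\<^sub>c\<close> (there is at most one such \<open>b\<close>). See \<open>left_regular_delta\<close> below.
\<close>

definition left_regular ::
    "'a set \<Rightarrow> ('a \<Rightarrow> 'a \<Rightarrow> 'a) \<Rightarrow> 'a \<Rightarrow> ('a \<Rightarrow> complex) \<Rightarrow> ('a \<Rightarrow> complex)" where
  "left_regular S mul a = (\<lambda>\<xi>\<in>hset (ell2 S). \<lambda>c.
     \<Sum>\<^sub>\<infinity>b\<in>{b \<in> S. mul (mul (sinv S mul a) a) b = b \<and> mul a b = c}. \<xi> b)"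

lemma (in inverse_semigroup) left_regular_delta:
  assumes a: "a \<in> S" and b: "b \<in> S"
  defines "\<delta> \<equiv> \<lambda>b c. if c = b then 1 else 0 :: complex"
  shows "\<delta> b \<in> hset (ell2 S)"
    and "left_regular S mul a (\<delta> b) =
      (if mul (mul (sinv S mul a) a) b = b then \<delta> (mul a b) else (\<lambda>_. 0))"
proof -
  have "(\<lambda>x. (cmod (\<delta> b x))\<^sup>2) summable_on S"
    by (rule finite_nonzero_values_imp_summable_on, rule finite_subset[of _ "{b}"]) (auto simp: \<delta>_def)
  then show m: "\<delta> b \<in> hset (ell2 S)" using b by (auto simp: ell2_def \<delta>_def)
  have "(\<Sum>\<^sub>\<infinity>b'\<in>M. \<delta> b b') = (if b \<in> M then 1 else 0)" for M
  proof -
    have "(\<Sum>\<^sub>\<infinity>b'\<in>M. \<delta> b b') = (\<Sum>\<^sub>\<infinity>b'\<in>M \<inter> {b}. \<delta> b b')"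
      by (rule infsum_cong_neutral) (auto simp: \<delta>_def)
    then show ?thesis by (auto simp: \<delta>_def)
  qed
  then show "left_regular S mul a (\<delta> b) =
      (if mul (mul (sinv S mul a) a) b = b then \<delta> (mul a b) else (\<lambda>_. 0))"
    using m b by (auto simp: left_regular_def fun_eq_iff \<delta>_def)
qed

text \<open>
  The extension to \<^const>\<open>cstar\<close> of the map on the semigroup algebra induced by a
  representation: the class of a Cauchy sequence \<open>u\<close> is sent to the limit of the operators of the \<open>u n\<close>.
\<close>

definition rep_ext :: "'h::ab_group_add hilbert \<Rightarrow> ('a \<Rightarrow> 'h \<Rightarrow> 'h) \<Rightarrow>
    (nat \<Rightarrow> 'a \<Rightarrow>\<^sub>0 complex) set \<Rightarrow> 'h \<Rightarrow> 'h" where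
  "rep_ext K \<pi> X = (\<lambda>x\<in>hset K. THE y. y \<in> hset K \<and>
     (\<forall>u\<in>X. (\<lambda>n. hnorm K (rep_lift K \<pi> (u n) x - y)) \<longlonglongrightarrow> 0))"

definition cstar_red ::
    "'a set \<Rightarrow> ('a \<Rightarrow> 'a \<Rightarrow> 'a) \<Rightarrow> (('a \<Rightarrow> complex) \<Rightarrow> ('a \<Rightarrow> complex)) star_algebra" where
  "cstar_red S mul = (bop_algebra (ell2 S))
     \<lparr>carrier := rep_ext (ell2 S) (left_regular S mul) ` carrier (cstar S mul)\<rparr>"

definition weak_containment :: "'a set \<Rightarrow> ('a \<Rightarrow> 'a \<Rightarrow> 'a) \<Rightarrow> bool" where
  "weak_containment S mul \<longleftrightarrow>
     star_iso (cstar S mul) (cstar_red S mul) (rep_ext (ell2 S) (left_regular S mul))"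

text \<open>
  The ideal of \<open>C\<^sup>*(S)\<close> generated by the zero \<open>z\<close> of \<open>S\<close> consists of the multiples of \<open>z\<close>, as
  \<open>s z = z = z s\<close>; in particular it is closed.
\<close>

definition cstar0 ::
    "'a set \<Rightarrow> ('a \<Rightarrow> 'a \<Rightarrow> 'a) \<Rightarrow> 'a \<Rightarrow> (nat \<Rightarrow> 'a \<Rightarrow>\<^sub>0 complex) set set star_algebra" where
  "cstar0 S mul z = quotient_algebra (cstar S mul)
     (generated_ideal (cstar S mul) (cstar_emb S mul (Poly_Mapping.single z 1)))"

definition cstar0_emb :: "'a set \<Rightarrow> ('a \<Rightarrow> 'a \<Rightarrow> 'a) \<Rightarrow> 'a \<Rightarrow>
    ('a \<Rightarrow>\<^sub>0 complex) \<Rightarrow> (nat \<Rightarrow> 'a \<Rightarrow>\<^sub>0 complex) set set" where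
  "cstar0_emb S mul z f = coset (cstar S mul)
     (generated_ideal (cstar S mul) (cstar_emb S mul (Poly_Mapping.single z 1))) (cstar_emb S mul f)"

definition restriction :: "'a set \<Rightarrow> ('a \<Rightarrow>\<^sub>0 complex) \<Rightarrow> ('a \<Rightarrow>\<^sub>0 complex)" where
  "restriction H f =
     (\<Sum>h\<in>Poly_Mapping.keys f \<inter> H. Poly_Mapping.single h (Poly_Mapping.lookup f h))"

text \<open>
  \<open>\<epsilon>\<close> is the continuous extension of the restriction map \<open>\<complex>\<^sub>0S \<rightarrow> \<complex>\<^sub>0H\<close>. Elements of
  \<open>\<complex>\<^sub>0S\<close> are written as classes of \<open>f\<close> in \<open>\<complex>S\<close>; as \<open>z \<in> H\<close>, the choice of the coefficient
  of \<open>f\<close> at \<open>z\<close> does not matter. Since \<open>\<complex>\<^sub>0S\<close> is dense, these conditions determine \<open>\<epsilon>\<close> on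
  \<^const>\<open>cstar0\<close>, so its being a conditional expectation is not an extra hypothesis.
\<close>

definition extends_restriction :: "'a set \<Rightarrow> ('a \<Rightarrow> 'a \<Rightarrow> 'a) \<Rightarrow> 'a \<Rightarrow> 'a set \<Rightarrow>
    ((nat \<Rightarrow> 'a \<Rightarrow>\<^sub>0 complex) set set \<Rightarrow> (nat \<Rightarrow> 'a \<Rightarrow>\<^sub>0 complex) set set) \<Rightarrow> bool" where
  "extends_restriction S mul z H \<epsilon> \<longleftrightarrow>
     \<epsilon> \<in> carrier (cstar0 S mul z) \<rightarrow>
         alg_closure (cstar0 S mul z) (cstar0_emb S mul z ` {f. Poly_Mapping.keys f \<subseteq> H}) \<and>
     (\<forall>a\<in>carrier (cstar0 S mul z). \<forall>e>0. \<exists>d>0. \<forall>b\<in>carrier (cstar0 S mul z).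
         alg_dist (cstar0 S mul z) b a < d \<longrightarrow> alg_dist (cstar0 S mul z) (\<epsilon> b) (\<epsilon> a) < e) \<and>
     (\<forall>f. Poly_Mapping.keys f \<subseteq> S \<longrightarrow>
         \<epsilon> (cstar0_emb S mul z f) = cstar0_emb S mul z (restriction H f))"

definition faithful :: "'b star_algebra \<Rightarrow> ('b \<Rightarrow> 'b) \<Rightarrow> bool" where
  "faithful A \<epsilon> \<longleftrightarrow>
     (\<forall>a\<in>carrier A. \<epsilon> (alg_mult A (alg_star A a) a) = alg_zero A \<longrightarrow> a = alg_zero A)"

end

theory Submission
  imports Defs
begin

text \<open>
  Let \<open>N\<close> be the full norm and \<open>\<Lambda>\<close> the left regular representation. An operator that has an adjoint and
  kills all basis vectors \<open>\<delta>\<^sub>b\<close> vanishes, so \<open>S\<close> has weak containment iff every \<open>N\<close>-Cauchy sequence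
  \<open>u\<close> in \<open>\<complex>S\<close> with \<open>\<Lambda>(u\<^sub>n) \<delta>\<^sub>b \<longlonglongrightarrow> 0\<close> for all \<open>b\<close> is \<open>N\<close>-null. Also \<open>\<parallel>\<Lambda>(f) \<delta>\<^sub>b\<parallel>\<^sup>2\<close> is the value at
  \<open>f\<^sup>* f\<close> of the functional that sums the coefficients over the stabilizer of \<open>b\<close>. This functional depends
  only on the idempotent \<open>b b\<^sup>*\<close>, which lies in \<open>H\<close>; hence weak containment passes from \<open>S\<close> to \<open>H\<close>. For
  nonzero \<open>b\<close> the stabilizer lies in \<open>H\<close>, so the functional factors through the restriction \<open>\<epsilon>\<close>; hence
  \<open>\<epsilon>(a\<^sup>* a) = 0\<close> forces \<open>\<Lambda>(a) \<delta>\<^sub>b = 0\<close>. Conversely, restriction to \<open>H\<close> is compression of \<open>\<Lambda>\<close> to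
  homogeneous components, so \<open>\<Lambda>(a) = 0\<close> gives \<open>\<Lambda>(\<epsilon>(a\<^sup>* a)) = 0\<close>, then \<open>\<epsilon>(a\<^sup>* a) = 0\<close> by weak
  containment of \<open>H\<close>, and \<open>a = 0\<close> by faithfulness. The zero \<open>z\<close> of \<open>S\<close> is dealt with by cutting by the
  central projection \<open>1 - z\<close>.
\<close>

section \<open>Inverse semigroups\<close>

text \<open>The zero shapes the proof. Every element of \<open>S\<close> fixes \<open>z\<close>, so
  the functional of \<open>\<delta>_z\<close> is the augmentation \<open>total\<close>: it takes the
  value \<open>1\<close> at \<open>z\<close>, hence does not descend to \<open>C*_0(S)\<close>, and
  in general it does not factor through restriction. So each element is split into its cut by
  \<open>1 - z\<close>, which \<open>\<epsilon>\<close> governs, and a multiple of \<open>z\<close>,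
  which the entry of \<open>\<Lambda>(u_n) \<delta>_z\<close> at \<open>z\<close> governs. Elements
  of \<open>C*_0(S)\<close> are cosets of classes of Cauchy sequences, with operations on chosen
  representatives and an infimum as norm. All statements about it are moved to sequences in the
  semigroup algebra, where the seminorm \<open>znorm\<close> of the cut element replaces the
  quotient norm. The two are equivalent up to the factor \<open>2\<close>, and equivalence is enough
  to detect Cauchy and null sequences. Stabilizers of nonzero elements lie in \<open>H\<close> by
  cancellation in \<open>G\<close>: \<open>s b = b\<close> forces degree one on \<open>s\<close>.
  That \<open>H\<close> is C*-isometric makes Cauchy and null sequences in the algebra of
  \<open>H\<close> the same for both full norms. The map \<open>\<epsilon>\<close> is given by
  continuity and its values on a dense set; \<open>extension_eq\<close> turns this into termwise
  restriction of sequences.\<close>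

context inverse_semigroup
begin

abbreviation star :: "'a \<Rightarrow> 'a" where "star \<equiv> sinv S mul"

lemma star_closed [simp]: "s \<in> S \<Longrightarrow> star s \<in> S"
  by (rule sinv_props)

lemma mul_star_mul [simp]: "s \<in> S \<Longrightarrow> mul s (mul (star s) s) = s"
  using sinv_props(2)[of s] assoc[of s "star s" s] by simp

lemma star_mul_star [simp]: "s \<in> S \<Longrightarrow> mul (star s) (mul s (star s)) = star s"
  using sinv_props(3)[of s] assoc[of "star s" s "star s"] by simp

declare closed [simp] assoc [simp] sinv_sinv [simp]

text \<open>With \<open>assoc\<close> as a simp rule all products are nested to the right, so
  \<open>s (star s) s\<close> also occurs with a further factor \<open>x\<close>. This variant and
  the next let simplification cancel there too.\<close>

lemma mul_star_mul_left [simp]: "s \<in> S \<Longrightarrow> x \<in> S \<Longrightarrow> mul s (mul (star s) (mul s x)) = mul s x"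
  using assoc[of s "mul (star s) s" x] by simp

lemma star_mul_star_left [simp]:
  "s \<in> S \<Longrightarrow> x \<in> S \<Longrightarrow> mul (star s) (mul s (mul (star s) x)) = mul (star s) x"
  using assoc[of "star s" "mul s (star s)" x] by simp

lemma star_unique:
  "s \<in> S \<Longrightarrow> t \<in> S \<Longrightarrow> mul s (mul t s) = s \<Longrightarrow> mul t (mul s t) = t \<Longrightarrow> star s = t"
  using ex1_inverse[of s] star_closed[of s] by (metis assoc mul_star_mul star_mul_star)

lemma star_idem: "e \<in> S \<Longrightarrow> mul e e = e \<Longrightarrow> star e = e"
  by (rule star_unique) simp_all

text \<open>For \<open>x\<close> the inverse of \<open>e f\<close>, the element \<open>f x e\<close>
  is an inverse of \<open>e f\<close> as well, so \<open>x = f x e\<close> by uniqueness. Then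
  \<open>x x = x\<close>, so \<open>x\<close> is its own inverse; but its inverse is
  \<open>e f\<close>.\<close>

lemma idem_mul_idem:
  assumes e: "e \<in> S" "mul e e = e" and f: "f \<in> S" "mul f f = f"
  shows "mul (mul e f) (mul e f) = mul e f"
proof -
  define x where "x = star (mul e f)"
  have x: "x \<in> S" using e f by (simp add: x_def)
  have ee: "mul e (mul e y) = mul e y" if "y \<in> S" for y using e that by (metis assoc)
  have ff: "mul f (mul f y) = mul f y" if "y \<in> S" for y using f that by (metis assoc)
  have 1: "mul e (mul f (mul x (mul e f))) = mul e f"
    using e f mul_star_mul[of "mul e f"] by (simp add: x_def[symmetric] x)
  have 2: "mul x (mul e (mul f x)) = x"
    using e f star_mul_star[of "mul e f"] by (simp add: x_def[symmetric] x)
  have h3: "mul x (mul e (mul f (mul x y))) = mul x y" if "y \<in> S" for y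
    using 2 e f x that by (metis assoc closed)
  have "star (mul e f) = mul f (mul x e)"
    using e f x 1 2 h3 by (intro star_unique) (simp_all add: ee ff)
  then have xe: "x = mul f (mul x e)" by (simp add: x_def)
  have "mul x x = mul (mul f (mul x e)) (mul f (mul x e))" using xe by simp
  also have "\<dots> = mul f (mul x e)" using e f x h3 by simp
  finally have xx: "mul x x = x" using xe by simp
  then have "star x = x" using x star_idem by blast
  then have "mul e f = x" using e f by (simp add: x_def)
  then show ?thesis using xx by simp
qed

text \<open>As \<open>e f\<close> and \<open>f e\<close> are idempotent, both are inverses of
  \<open>e f\<close>.\<close>

lemma idem_commute:
  assumes e: "e \<in> S" "mul e e = e" and f: "f \<in> S" "mul f f = f"
  shows "mul e f = mul f e"
proof -
  have ee: "mul e (mul e y) = mul e y" if "y \<in> S" for y using e that by (metis assoc)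
  have ff: "mul f (mul f y) = mul f y" if "y \<in> S" for y using f that by (metis assoc)
  have ef: "mul (mul e f) (mul e f) = mul e f" by (rule idem_mul_idem[OF e f])
  have fe: "mul (mul f e) (mul f e) = mul f e" by (rule idem_mul_idem[OF f e])
  have "star (mul e f) = mul e f" using e f ef by (intro star_idem) simp_all
  moreover have "star (mul e f) = mul f e"
    using e f ef fe by (intro star_unique) (simp_all add: ee ff)
  ultimately show ?thesis by simp
qed

text \<open>The idempotents \<open>mul (star s) s\<close> and \<open>mul t (star t)\<close> commute;
  the right-nested form with a trailing \<open>x\<close> is the shape in which they occur after
  simplification.\<close>

lemma source_range_commute:
  assumes "s \<in> S" "t \<in> S" "x \<in> S"
  shows "mul (star s) (mul s (mul t (mul (star t) x))) = mul t (mul (star t) (mul (star s) (mul s x)))"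
  using idem_commute[of "mul (star s) s" "mul t (star t)"] assms
    assoc[of "mul (star s) s" "mul t (star t)" x] assoc[of "mul t (star t)" "mul (star s) s" x]
  by simp

lemma star_mul:
  assumes s: "s \<in> S" and t: "t \<in> S"
  shows "star (mul s t) = mul (star t) (star s)"
proof (rule star_unique)
  show "mul (mul s t) (mul (mul (star t) (star s)) (mul s t)) = mul s t"
    using s t source_range_commute[OF s t t] by simp
  have "mul t (mul (star t) (mul (star s) (mul s (star s)))) =
      mul (star s) (mul s (mul t (mul (star t) (star s))))"
    by (rule source_range_commute[symmetric]) (use s t in auto)
  then show "mul (mul (star t) (star s)) (mul (mul s t) (mul (star t) (star s))) = mul (star t) (star s)"
    using s t by simp
qed (use s t in simp_all)

text \<open>Left multiplication by \<open>a\<close> maps the elements fixed by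
  \<open>mul (star a) a\<close> bijectively onto those fixed by \<open>mul a (star a)\<close>, with
  inverse given by \<open>star a\<close>. So each row of the matrix of \<open>\<Lambda>(a)\<close>
  has at most one nonzero entry.\<close>

lemma translate_iff:
  assumes "a \<in> S" "b \<in> S" "c \<in> S"
  shows "mul (star a) (mul a b) = b \<and> mul a b = c \<longleftrightarrow> mul a (mul (star a) c) = c \<and> b = mul (star a) c"
  using assms by auto

text \<open>The domain condition behind multiplicativity of \<open>\<Lambda>\<close>: being fixed by
  the range idempotent of \<open>mul s t\<close> splits into one condition for \<open>s\<close> and
  one for \<open>t\<close>, once the source of \<open>s\<close> is commuted past the range of
  \<open>t\<close>.\<close>

lemma mul_range_iff:
  assumes s: "s \<in> S" and t: "t \<in> S" and c: "c \<in> S"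
  shows "mul s (mul t (mul (star t) (mul (star s) c))) = c \<longleftrightarrow>
    mul s (mul (star s) c) = c \<and> mul t (mul (star t) (mul (star s) c)) = mul (star s) c"
proof
  assume eq: "mul s (mul t (mul (star t) (mul (star s) c))) = c"
  then have 1: "mul s (mul (star s) c) = c"
    using s t c by (metis closed star_closed mul_star_mul_left)
  have "mul (star s) c = mul (star s) (mul s (mul t (mul (star t) (mul (star s) c))))"
    by (simp add: eq)
  also have "\<dots> = mul t (mul (star t) (mul (star s) c))"
    using s t c by (simp add: source_range_commute)
  finally show "mul s (mul (star s) c) = c \<and> mul t (mul (star t) (mul (star s) c)) = mul (star s) c"
    using 1 by simp
qed (use s t c in auto)

text \<open>\<open>b\<close> and \<open>mul b (star b)\<close> arise from each other by right
  multiplication, which commutes with left multiplication by \<open>t\<close>.\<close>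

lemma fix_range_iff:
  assumes "b \<in> S" "t \<in> S"
  shows "mul t (mul b (star b)) = mul b (star b) \<longleftrightarrow> mul t b = b"
proof
  assume "mul t (mul b (star b)) = mul b (star b)"
  then have "mul (mul t (mul b (star b))) b = mul (mul b (star b)) b" by simp
  then show "mul t b = b" using assms by simp
next
  assume "mul t b = b"
  then show "mul t (mul b (star b)) = mul b (star b)" using assms by (metis assoc star_closed)
qed

end

section \<open>The left regular representation\<close>

lemma hset_ell2: "hset (ell2 S) = {f. (\<forall>x. x \<notin> S \<longrightarrow> f x = 0) \<and> (\<lambda>x. (cmod (f x))\<^sup>2) summable_on S}"
  and hip_ell2: "hip (ell2 S) f g = (\<Sum>\<^sub>\<infinity>x\<in>S. f x * cnj (g x))"
  and hscale_ell2: "hscale (ell2 S) c f = (\<lambda>x. c * f x)"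
  by (simp_all add: ell2_def)

lemma ell2_outside: "f \<in> hset (ell2 S) \<Longrightarrow> x \<notin> S \<Longrightarrow> f x = 0"
  by (simp add: hset_ell2)

lemma ell2_summable: "f \<in> hset (ell2 S) \<Longrightarrow> (\<lambda>x. (cmod (f x))\<^sup>2) summable_on S"
  by (simp add: hset_ell2)

lemma ell2_prod_summable:
  assumes "f \<in> hset (ell2 S)" "g \<in> hset (ell2 S)"
  shows "(\<lambda>x. f x * cnj (g x)) summable_on S"
proof (rule abs_summable_summable)
  show "(\<lambda>x. norm (f x * cnj (g x))) summable_on S"
  proof (rule Infinite_Sum.abs_summable_on_comparison_test')
    show "(\<lambda>x. (cmod (f x))\<^sup>2 + (cmod (g x))\<^sup>2) summable_on S"
      using assms by (intro summable_on_add ell2_summable)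
    show "norm (f x * cnj (g x)) \<le> (cmod (f x))\<^sup>2 + (cmod (g x))\<^sup>2" for x
    proof -
      have "0 \<le> (cmod (f x) - cmod (g x))\<^sup>2" "0 \<le> cmod (f x) * cmod (g x)" by simp_all
      then show ?thesis unfolding norm_mult complex_mod_cnj power2_diff by linarith
    qed
  qed
qed

lemma hip_ell2_self:
  assumes "f \<in> hset (ell2 S)"
  shows "hip (ell2 S) f f = complex_of_real (\<Sum>\<^sub>\<infinity>x\<in>S. (cmod (f x))\<^sup>2)"
  unfolding hip_ell2 complex_norm_square[symmetric]
  by (intro infsumI has_sum_of_real_iff[THEN iffD2] has_sum_infsum ell2_summable assms)

lemma hnorm_ell2:
  "f \<in> hset (ell2 S) \<Longrightarrow> (hnorm (ell2 S) f)\<^sup>2 = (\<Sum>\<^sub>\<infinity>x\<in>S. (cmod (f x))\<^sup>2)"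
  by (simp add: hnorm_def hip_ell2_self infsum_nonneg)

lemma hnorm_ell2_nonneg: "f \<in> hset (ell2 S) \<Longrightarrow> 0 \<le> hnorm (ell2 S) f"
  by (simp add: hnorm_def hip_ell2_self infsum_nonneg)

text \<open>Nonnegative series are controlled by their finite partial sums, so one uniform bound
  gives membership and the norm estimate together.\<close>

lemma ell2_I:
  assumes "\<And>x. x \<notin> S \<Longrightarrow> f x = 0"
    and "\<And>F. finite F \<Longrightarrow> F \<subseteq> S \<Longrightarrow> (\<Sum>x\<in>F. (cmod (f x))\<^sup>2) \<le> e\<^sup>2" and "0 \<le> e"
  shows "f \<in> hset (ell2 S)" "hnorm (ell2 S) f \<le> e"
proof -
  have s: "(\<lambda>x. (cmod (f x))\<^sup>2) summable_on S"
    by (rule nonneg_bdd_above_summable_on) (use assms in \<open>auto intro!: bdd_aboveI[of _ "e\<^sup>2"]\<close>)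
  then show m: "f \<in> hset (ell2 S)" using assms(1) by (simp add: hset_ell2)
  have "(\<Sum>\<^sub>\<infinity>x\<in>S. (cmod (f x))\<^sup>2) \<le> e\<^sup>2"
    using s assms(2) by (rule infsum_le_finite_sums)
  then have "(hnorm (ell2 S) f)\<^sup>2 \<le> e\<^sup>2" using hnorm_ell2[OF m] by simp
  then show "hnorm (ell2 S) f \<le> e" using \<open>0 \<le> e\<close> by (rule power2_le_imp_le)
qed

lemma ell2_finite_sum_le:
  assumes "f \<in> hset (ell2 S)" "finite F" "F \<subseteq> S"
  shows "(\<Sum>x\<in>F. (cmod (f x))\<^sup>2) \<le> (hnorm (ell2 S) f)\<^sup>2"
  using assms by (simp add: hnorm_ell2 finite_sum_le_infsum ell2_summable)

lemma ell2_component_le: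
  assumes "f \<in> hset (ell2 S)"
  shows "cmod (f x) \<le> hnorm (ell2 S) f"
proof (cases "x \<in> S")
  case True
  then have "(cmod (f x))\<^sup>2 \<le> (hnorm (ell2 S) f)\<^sup>2"
    using ell2_finite_sum_le[OF assms, of "{x}"] by simp
  then show ?thesis using hnorm_ell2_nonneg[OF assms] by (rule power2_le_imp_le)
qed (use assms hnorm_ell2_nonneg in \<open>auto simp: ell2_outside\<close>)

text \<open>Its later use: truncating a vector to \<open>H\<close> does not increase the
  norm.\<close>

lemma ell2_dominated:
  assumes "g \<in> hset (ell2 S)" "\<And>x. cmod (f x) \<le> cmod (g x)"
  shows "f \<in> hset (ell2 S)" "hnorm (ell2 S) f \<le> hnorm (ell2 S) g"
proof -
  have *: "f x = 0" if "x \<notin> S" for x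
    using assms(2)[of x] ell2_outside[OF assms(1) that] by simp
  have **: "(\<Sum>x\<in>F. (cmod (f x))\<^sup>2) \<le> (hnorm (ell2 S) g)\<^sup>2" if "finite F" "F \<subseteq> S" for F
    using ell2_finite_sum_le[OF assms(1) that] by (rule order_trans[rotated])
      (intro sum_mono power_mono assms(2), simp)
  show "f \<in> hset (ell2 S)" "hnorm (ell2 S) f \<le> hnorm (ell2 S) g"
    using ell2_I[of S f, OF * ** hnorm_ell2_nonneg[OF assms(1)]] by auto
qed

lemma ell2_add:
  assumes "f \<in> hset (ell2 S)" "g \<in> hset (ell2 S)"
  shows "f + g \<in> hset (ell2 S)"
proof -
  have "(\<lambda>x. (cmod (f x + g x))\<^sup>2) summable_on S"
  proof (rule summable_on_comparison_test)
    show "(\<lambda>x. 2 * ((cmod (f x))\<^sup>2 + (cmod (g x))\<^sup>2)) summable_on S"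
      using assms by (intro summable_on_cmult_right summable_on_add ell2_summable)
    show "(cmod (f x + g x))\<^sup>2 \<le> 2 * ((cmod (f x))\<^sup>2 + (cmod (g x))\<^sup>2)" for x
    proof -
      have "(cmod (f x + g x))\<^sup>2 \<le> (cmod (f x) + cmod (g x))\<^sup>2"
        by (simp add: norm_triangle_ineq power_mono)
      also have "\<dots> \<le> 2 * ((cmod (f x))\<^sup>2 + (cmod (g x))\<^sup>2)"
        using zero_le_power2[of "cmod (f x) - cmod (g x)"] by (simp add: power2_diff power2_sum)
      finally show ?thesis .
    qed
  qed auto
  then show ?thesis using assms by (simp add: hset_ell2)
qed

lemma ell2_scale: "f \<in> hset (ell2 S) \<Longrightarrow> hscale (ell2 S) c f \<in> hset (ell2 S)"
  by (auto simp: hset_ell2 hscale_ell2 norm_mult power_mult_distrib intro: summable_on_cmult_right)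

text \<open>The limit is taken pointwise, and bounds on finite partial sums pass to it. That
  differences lie in the space is an assumption because this lemma is itself a step towards the
  Hilbert space axioms.\<close>

lemma ell2_complete:
  assumes u: "\<And>n. u n \<in> hset (ell2 S)"
    and diff: "\<And>m n. u m - u n \<in> hset (ell2 S)"
    and cauchy: "\<And>e. e > 0 \<Longrightarrow> \<exists>N. \<forall>m\<ge>N. \<forall>n\<ge>N. hnorm (ell2 S) (u m - u n) < e"
  shows "\<exists>g\<in>hset (ell2 S). (\<lambda>n::nat. hnorm (ell2 S) (u n - g)) \<longlonglongrightarrow> 0"
proof -
  have "Cauchy (\<lambda>n. u n x)" for x
    unfolding Cauchy_def dist_norm
  proof (intro allI impI)
    fix e :: real assume "e > 0"
    then obtain N where "\<forall>m\<ge>N. \<forall>n\<ge>N. hnorm (ell2 S) (u m - u n) < e" using cauchy by blast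
    moreover have "cmod (u m x - u n x) \<le> hnorm (ell2 S) (u m - u n)" for m n
      using ell2_component_le[OF diff, of m n x] by simp
    ultimately show "\<exists>N. \<forall>m\<ge>N. \<forall>n\<ge>N. cmod (u m x - u n x) < e"
      by (meson le_less_trans)
  qed
  then have conv: "convergent (\<lambda>n. u n x)" for x by (rule Cauchy_convergent)
  define g where "g x = lim (\<lambda>n. u n x)" for x
  have g: "(\<lambda>n. u n x) \<longlonglongrightarrow> g x" for x
    using conv[of x] by (simp add: g_def convergent_LIMSEQ_iff)
  have g0: "g x = 0" if "x \<notin> S" for x
  proof -
    have "u n x = 0" for n using u that by (rule ell2_outside)
    then show ?thesis using g[of x] by (simp add: LIMSEQ_const_iff)
  qed
  have close: "\<exists>N. \<forall>n\<ge>N. u n - g \<in> hset (ell2 S) \<and> hnorm (ell2 S) (u n - g) \<le> e" if "e > 0" for e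
  proof -
    obtain N where N: "\<And>m n. m \<ge> N \<Longrightarrow> n \<ge> N \<Longrightarrow> hnorm (ell2 S) (u m - u n) < e"
      using cauchy[OF \<open>e > 0\<close>] by blast
    have le: "(\<Sum>x\<in>F. (cmod ((u n - g) x))\<^sup>2) \<le> e\<^sup>2" if "n \<ge> N" "finite F" "F \<subseteq> S" for n F
    proof (rule LIMSEQ_le_const2)
      show "(\<lambda>m. \<Sum>x\<in>F. (cmod (u n x - u m x))\<^sup>2) \<longlonglongrightarrow> (\<Sum>x\<in>F. (cmod ((u n - g) x))\<^sup>2)"
        using g by (auto intro!: tendsto_intros)
      have "(\<Sum>x\<in>F. (cmod (u n x - u m x))\<^sup>2) \<le> e\<^sup>2" if "m \<ge> N" for m
      proof -
        have "(\<Sum>x\<in>F. (cmod (u n x - u m x))\<^sup>2) \<le> (hnorm (ell2 S) (u n - u m))\<^sup>2"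
          using ell2_finite_sum_le[OF diff \<open>finite F\<close> \<open>F \<subseteq> S\<close>] by simp
        also have "\<dots> \<le> e\<^sup>2"
          using N[OF \<open>n \<ge> N\<close> that] hnorm_ell2_nonneg[OF diff] by (intro power_mono) (auto simp: less_imp_le)
        finally show ?thesis .
      qed
      then show "\<exists>M. \<forall>m\<ge>M. (\<Sum>x\<in>F. (cmod (u n x - u m x))\<^sup>2) \<le> e\<^sup>2" by blast
    qed
    have out: "(u n - g) x = 0" if "x \<notin> S" for n x
      using g0[OF that] ell2_outside[OF u that] by simp
    show ?thesis
      using ell2_I[of S, OF out le] \<open>e > 0\<close> by (meson less_imp_le)
  qed
  \<comment> \<open>Membership of \<open>g\<close> itself, from \<open>g = u N - (u N - g)\<close>
    for a single \<open>N\<close>.\<close>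
  obtain N where "u N - g \<in> hset (ell2 S)" using close[of 1] by auto
  then have "hscale (ell2 S) (-1) (u N - g) + u N \<in> hset (ell2 S)"
    using u by (intro ell2_add ell2_scale)
  moreover have "hscale (ell2 S) (-1) (u N - g) + u N = g" by (auto simp: hscale_ell2)
  ultimately have "g \<in> hset (ell2 S)" by simp
  moreover have "(\<lambda>n. hnorm (ell2 S) (u n - g)) \<longlonglongrightarrow> 0"
  proof (rule LIMSEQ_I)
    fix e :: real assume "e > 0"
    then obtain N where "\<forall>n\<ge>N. u n - g \<in> hset (ell2 S) \<and> hnorm (ell2 S) (u n - g) \<le> e / 2"
      using close[of "e / 2"] by auto
    then have "norm (hnorm (ell2 S) (u n - g) - 0) < e" if "n \<ge> N" for n
      using \<open>e > 0\<close> that hnorm_ell2_nonneg[of "u n - g" S] by fastforce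
    then show "\<exists>N. \<forall>n\<ge>N. norm (hnorm (ell2 S) (u n - g) - 0) < e" by blast
  qed
  ultimately show ?thesis by blast
qed

lemma hilbert_space_ell2: "hilbert_space (ell2 S)"
proof -
  interpret V: vector_space "hscale (ell2 S)"
    by unfold_locales (auto simp: hscale_ell2 fun_eq_iff algebra_simps)
  have sub: "V.subspace (hset (ell2 S))"
    unfolding V.subspace_def
  proof (intro conjI ballI allI ell2_add ell2_scale)
    show "0 \<in> hset (ell2 S)" by (simp add: hset_ell2)
  qed
  show ?thesis
  proof unfold_locales
    show "V.subspace (hset (ell2 S))" by (rule sub)
    show "hip (ell2 S) (x + y) w = hip (ell2 S) x w + hip (ell2 S) y w"
      if "x \<in> hset (ell2 S)" "y \<in> hset (ell2 S)" "w \<in> hset (ell2 S)" for x y w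
      using infsum_add[OF ell2_prod_summable[OF that(1,3)] ell2_prod_summable[OF that(2,3)]]
      by (simp add: hip_ell2 distrib_right)
    show "hip (ell2 S) (hscale (ell2 S) c x) w = c * hip (ell2 S) x w" for x w c
      by (simp add: hip_ell2 hscale_ell2 mult.assoc infsum_cmult_right')
    show "hip (ell2 S) y x = cnj (hip (ell2 S) x y)" for x y
      by (simp add: hip_ell2 infsum_cnj[symmetric] mult.commute)
    show "Re (hip (ell2 S) x x) > 0" if x: "x \<in> hset (ell2 S)" "x \<noteq> 0" for x
    proof -
      obtain a where "x a \<noteq> 0" using x(2) by (auto simp: fun_eq_iff)
      then have "0 < hnorm (ell2 S) x" using ell2_component_le[OF x(1), of a]
        by (meson less_le_trans zero_less_norm_iff)
      then show ?thesis by (simp add: hnorm_def)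
    qed
    fix u :: "nat \<Rightarrow> 'a \<Rightarrow> complex"
    assume u: "\<And>n. u n \<in> hset (ell2 S)"
      and "\<And>e. e > 0 \<Longrightarrow> \<exists>N. \<forall>m\<ge>N. \<forall>n\<ge>N. hnorm (ell2 S) (u m - u n) < e"
    then show "\<exists>x\<in>hset (ell2 S). (\<lambda>n. hnorm (ell2 S) (u n - x)) \<longlonglongrightarrow> 0"
      by (intro ell2_complete V.subspace_diff[OF sub])
  qed
qed

definition ket :: "'a \<Rightarrow> 'a \<Rightarrow> complex" where
  "ket b = (\<lambda>c. if c = b then 1 else 0)"

lemma ket_mem:
  assumes "b \<in> S"
  shows "ket b \<in> hset (ell2 S)"
proof -
  have "(\<lambda>x. (cmod (ket b x))\<^sup>2) summable_on S"
    by (rule finite_nonzero_values_imp_summable_on, rule finite_subset[of _ "{b}"]) (auto simp: ket_def)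
  then show ?thesis using assms by (auto simp: hset_ell2 ket_def)
qed

lemma hip_ket:
  assumes "b \<in> S"
  shows "hip (ell2 S) f (ket b) = f b"
proof -
  have "hip (ell2 S) f (ket b) = (\<Sum>\<^sub>\<infinity>x\<in>{b}. f x * cnj (ket b x))"
    unfolding hip_ell2 using assms by (intro infsum_cong_neutral) (auto simp: ket_def)
  then show ?thesis by (simp add: ket_def)
qed

lemma hnorm_ket: "b \<in> S \<Longrightarrow> hnorm (ell2 S) (ket b) = 1"
  by (simp add: hnorm_def hip_ket) (simp add: ket_def)

text \<open>If \<open>g\<close> is orthogonal to the kernel of \<open>T\<close>, then
  \<open>g - T' (T g)\<close> lies in that kernel and is orthogonal both to \<open>g\<close> and to
  \<open>T' (T g)\<close>, hence is zero. So \<open>T'\<close> undoes \<open>T\<close> at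
  \<open>g\<close>, and the norm is preserved.\<close>

lemma (in hilbert_space) partial_isometry_if_regular:
  assumes bop: "T \<in> bop K" and mem': "\<And>x. x \<in> hset K \<Longrightarrow> T' x \<in> hset K"
    and adj: "is_adjoint K T T'" and adj': "is_adjoint K T' T"
    and reg: "\<And>x. x \<in> hset K \<Longrightarrow> T (T' (T x)) = T x"
  shows "partial_isometry K T"
  unfolding partial_isometry_def
proof (intro conjI ballI impI)
  show "T \<in> bop K" by (rule bop)
  have mem: "T x \<in> hset K" if "x \<in> hset K" for x using bop that by (auto simp: bop_def)
  fix g assume g: "g \<in> hset K" and perp: "\<forall>h\<in>hset K. T h = 0 \<longrightarrow> hip K g h = 0"
  let ?p = "T' (T g)" let ?h = "g - ?p"
  have p: "?p \<in> hset K" and h: "?h \<in> hset K" using g mem mem' by auto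
  have "T (?h + ?p) = T ?h + T ?p" using bop h p unfolding bop_def by blast
  then have ker: "T ?h = 0" using reg[OF g] by simp
  have "hip K ?p ?h = hip K (T g) (T ?h)" using adj' mem g h by (simp add: is_adjoint_def)
  then have "hip K ?p ?h = 0" using ker mem g by simp
  moreover have "hip K g ?h = 0" using perp h ker by blast
  ultimately have "hip K ?h ?h = 0" using ip_diff[OF g p h] by simp
  then have "?h = 0" using ip_pos[OF h] by auto
  then have "?p = g" by simp
  then show "hnorm K (T g) = hnorm K g"
    by (intro regular_contractive(2)[of T T']) (use mem mem' adj adj' reg g in auto)
qed

section \<open>The left regular representation consists of partial isometries\<close>

context inverse_semigroup
begin

abbreviation lreg :: "'a \<Rightarrow> ('a \<Rightarrow> complex) \<Rightarrow> 'a \<Rightarrow> complex" where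
  "lreg \<equiv> left_regular S mul"

text \<open>By \<open>translate_iff\<close> the infinite sum in the definition has at most the one
  term \<open>b = mul (star a) c\<close>.\<close>

lemma lreg_apply:
  assumes a: "a \<in> S" and f: "f \<in> hset (ell2 S)"
  shows "lreg a f c = (if c \<in> S \<and> mul a (mul (star a) c) = c then f (mul (star a) c) else 0)"
proof -
  have "{b \<in> S. mul (mul (star a) a) b = b \<and> mul a b = c} =
      (if c \<in> S \<and> mul a (mul (star a) c) = c then {mul (star a) c} else {})"
    using a translate_iff[OF a _, of _ c] by auto
  then show ?thesis using f by (simp add: left_regular_def)
qed

text \<open>On the elements fixed by \<open>mul a (star a)\<close>, left multiplication by
  \<open>star a\<close> is injective, so a finite sum of squares for \<open>lreg a f\<close> is a
  finite sum of squares for \<open>f\<close>.\<close>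

lemma lreg_mem_norm:
  assumes a: "a \<in> S" and f: "f \<in> hset (ell2 S)"
  shows "lreg a f \<in> hset (ell2 S)" "hnorm (ell2 S) (lreg a f) \<le> hnorm (ell2 S) f"
proof -
  have *: "(\<Sum>c\<in>F. (cmod (lreg a f c))\<^sup>2) \<le> (hnorm (ell2 S) f)\<^sup>2" if F: "finite F" "F \<subseteq> S" for F
  proof -
    let ?F = "{c \<in> F. mul a (mul (star a) c) = c}"
    have "(\<Sum>c\<in>F. (cmod (lreg a f c))\<^sup>2) = (\<Sum>c\<in>?F. (cmod (f (mul (star a) c)))\<^sup>2)"
      using F by (intro sum.mono_neutral_cong_right) (auto simp: lreg_apply[OF a f])
    also have "\<dots> = (\<Sum>b\<in>mul (star a) ` ?F. (cmod (f b))\<^sup>2)"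
    proof (subst sum.reindex)
      show "inj_on (mul (star a)) ?F" by (rule inj_on_inverseI[of _ "mul a"]) simp
    qed simp
    also have "\<dots> \<le> (hnorm (ell2 S) f)\<^sup>2"
      using F a by (intro ell2_finite_sum_le[OF f]) auto
    finally show ?thesis .
  qed
  show "lreg a f \<in> hset (ell2 S)" "hnorm (ell2 S) (lreg a f) \<le> hnorm (ell2 S) f"
    using ell2_I[of S "lreg a f", OF _ * hnorm_ell2_nonneg[OF f]] by (auto simp: lreg_apply[OF a f])
qed

lemma lreg_bop:
  assumes a: "a \<in> S"
  shows "lreg a \<in> bop (ell2 S)"
  unfolding bop_def
proof (intro CollectI conjI ballI allI exI[of _ 1])
  interpret L: hilbert_space "ell2 S" by (rule hilbert_space_ell2)
  show "lreg a \<in> hset (ell2 S) \<rightarrow>\<^sub>E hset (ell2 S)"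
    using lreg_mem_norm(1)[OF a] by (auto simp: left_regular_def)
  show "lreg a (f + g) = lreg a f + lreg a g" if "f \<in> hset (ell2 S)" "g \<in> hset (ell2 S)" for f g
    using that a by (auto simp: lreg_apply fun_eq_iff)
  show "lreg a (hscale (ell2 S) c f) = hscale (ell2 S) c (lreg a f)" if "f \<in> hset (ell2 S)" for c f
    using that a L.mem(4)[OF that] by (auto simp: lreg_apply fun_eq_iff hscale_ell2)
qed (use lreg_mem_norm[OF a] in auto)

text \<open>Both inner products are the same series, reindexed along the bijection
  \<open>mul a\<close> between the two sets of fixed elements.\<close>

lemma lreg_adjoint:
  assumes a: "a \<in> S"
  shows "is_adjoint (ell2 S) (lreg a) (lreg (star a))"
  unfolding is_adjoint_def
proof (intro ballI)
  fix f g assume f: "f \<in> hset (ell2 S)" and g: "g \<in> hset (ell2 S)"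
  let ?A = "{b \<in> S. mul (star a) (mul a b) = b}" and ?B = "{c \<in> S. mul a (mul (star a) c) = c}"
  have "hip (ell2 S) (lreg a f) g = (\<Sum>\<^sub>\<infinity>c\<in>?B. f (mul (star a) c) * cnj (g c))"
    unfolding hip_ell2 by (intro infsum_cong_neutral) (auto simp: lreg_apply[OF a f])
  also have "\<dots> = (\<Sum>\<^sub>\<infinity>b\<in>?A. f (mul (star a) (mul a b)) * cnj (g (mul a b)))"
    by (rule infsum_reindex_bij_betw[symmetric])
      (use a in \<open>auto intro!: bij_betw_byWitness[where f' = "mul (star a)"]\<close>)
  also have "\<dots> = hip (ell2 S) f (lreg (star a) g)"
    unfolding hip_ell2 using a by (intro infsum_cong_neutral) (auto simp: lreg_apply[OF _ g])
  finally show "hip (ell2 S) (lreg a f) g = hip (ell2 S) f (lreg (star a) g)" .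
qed

lemma lreg_mul:
  assumes s: "s \<in> S" and t: "t \<in> S"
  shows "lreg (mul s t) = compose (hset (ell2 S)) (lreg s) (lreg t)"
proof
  fix f
  show "lreg (mul s t) f = compose (hset (ell2 S)) (lreg s) (lreg t) f"
  proof (cases "f \<in> hset (ell2 S)")
    case True
    show ?thesis
    proof
      fix c
      show "lreg (mul s t) f c = compose (hset (ell2 S)) (lreg s) (lreg t) f c"
        using True s t lreg_mem_norm(1)[OF t True] mul_range_iff[OF s t, of c]
        by (auto simp: lreg_apply compose_def star_mul)
    qed
  qed (auto simp: left_regular_def compose_def)
qed

lemma lreg_rep: "semigroup_rep S mul (ell2 S) lreg"
  unfolding semigroup_rep_def
proof (intro conjI ballI)
  fix s assume s: "s \<in> S"
  interpret L: hilbert_space "ell2 S" by (rule hilbert_space_ell2)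
  show adj: "is_adjoint (ell2 S) (lreg s) (lreg (star s))" using s by (rule lreg_adjoint)
  have reg: "lreg s (lreg (star s) (lreg s f)) = lreg s f" if f: "f \<in> hset (ell2 S)" for f
  proof -
    have "lreg s (lreg (star s) (lreg s f)) = lreg (mul (mul s (star s)) s) f"
      using s f lreg_mem_norm(1) by (simp only: lreg_mul closed star_closed compose_def restrict_def if_True)
    then show ?thesis using s by simp
  qed
  show "partial_isometry (ell2 S) (lreg s)"
    using lreg_bop[OF s] lreg_mem_norm(1)[OF star_closed[OF s]] adj lreg_adjoint[OF star_closed[OF s]] reg s
    by (intro L.partial_isometry_if_regular[where T' = "lreg (star s)"]) auto
  show "lreg (mul s t) = compose (hset (ell2 S)) (lreg s) (lreg t)" if "t \<in> S" for t
    using s that by (rule lreg_mul)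
qed

end

section \<open>The semigroup algebra and its full norm\<close>

abbreviation keys :: "('a \<Rightarrow>\<^sub>0 complex) \<Rightarrow> 'a set" where "keys \<equiv> Poly_Mapping.keys"
abbreviation lookup :: "('a \<Rightarrow>\<^sub>0 complex) \<Rightarrow> 'a \<Rightarrow> complex" where "lookup \<equiv> Poly_Mapping.lookup"
abbreviation single :: "'a \<Rightarrow> complex \<Rightarrow> ('a \<Rightarrow>\<^sub>0 complex)" where "single \<equiv> Poly_Mapping.single"

definition supp_in :: "'a set \<Rightarrow> ('a \<Rightarrow>\<^sub>0 complex) set" where
  "supp_in S = {f. keys f \<subseteq> S}"

abbreviation cscale :: "complex \<Rightarrow> ('a \<Rightarrow>\<^sub>0 complex) \<Rightarrow> ('a \<Rightarrow>\<^sub>0 complex)" where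
  "cscale c \<equiv> Poly_Mapping.map ((*) c)"

text \<open>Depends on \<open>mul\<close> alone, so the algebras of \<open>S\<close> and
  \<open>H\<close> share it. In contrast, \<open>astar\<close> takes the involution as an argument,
  because \<open>sinv\<close> refers to a carrier.\<close>

definition amul :: "('a \<Rightarrow> 'a \<Rightarrow> 'a) \<Rightarrow> ('a \<Rightarrow>\<^sub>0 complex) \<Rightarrow> ('a \<Rightarrow>\<^sub>0 complex) \<Rightarrow> ('a \<Rightarrow>\<^sub>0 complex)" where
  "amul mul f g = (\<Sum>s\<in>keys f. \<Sum>t\<in>keys g. single (mul s t) (lookup f s * lookup g t))"

definition astar :: "('a \<Rightarrow> 'a) \<Rightarrow> ('a \<Rightarrow>\<^sub>0 complex) \<Rightarrow> ('a \<Rightarrow>\<^sub>0 complex)" where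
  "astar st f = (\<Sum>s\<in>keys f. single (st s) (cnj (lookup f s)))"

lemma semigroup_algebra_sel:
  "carrier (semigroup_algebra S mul) = supp_in S"
  "alg_add (semigroup_algebra S mul) = (+)"
  "alg_zero (semigroup_algebra S mul) = 0"
  "alg_scale (semigroup_algebra S mul) = cscale"
  "alg_mult (semigroup_algebra S mul) = amul mul"
  "alg_star (semigroup_algebra S mul) = astar (sinv S mul)"
  "alg_norm (semigroup_algebra S mul) = cstar_norm S mul"
  by (simp_all add: semigroup_algebra_def supp_in_def amul_def[abs_def] astar_def[abs_def])

lemma lookup_cscale [simp]: "lookup (cscale c f) s = c * lookup f s"
  by (simp add: Poly_Mapping.map.rep_eq when_def)

lemma cscale_minus1: "cscale (-1) f = - f"
  by (rule poly_mapping_eqI) simp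

lemma cscale_diff: "cscale c (f - g) = cscale c f - cscale c g"
  by (rule poly_mapping_eqI) (simp add: lookup_minus algebra_simps)

lemma single_sum: "single s (\<Sum>i\<in>I. c i) = (\<Sum>i\<in>I. single s (c i))"
  by (induction I rule: infinite_finite_induct) (simp_all add: single_add)

lemma supp_in_zero [simp]: "0 \<in> supp_in S"
  and supp_in_single [simp]: "s \<in> S \<Longrightarrow> single s c \<in> supp_in S"
  by (simp_all add: supp_in_def)

lemma supp_in_add [simp]: "f \<in> supp_in S \<Longrightarrow> g \<in> supp_in S \<Longrightarrow> f + g \<in> supp_in S"
  and supp_in_diff [simp]: "f \<in> supp_in S \<Longrightarrow> g \<in> supp_in S \<Longrightarrow> f - g \<in> supp_in S"
  using Poly_Mapping.keys_add[of f g] keys_diff[of f g] by (auto simp: supp_in_def)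

lemma supp_in_uminus [simp]: "f \<in> supp_in S \<Longrightarrow> - f \<in> supp_in S"
  by (simp add: supp_in_def)

lemma supp_in_cscale [simp]: "f \<in> supp_in S \<Longrightarrow> cscale c f \<in> supp_in S"
  by (auto simp: supp_in_def in_keys_iff)

lemma supp_in_sum: "(\<And>i. i \<in> I \<Longrightarrow> F i \<in> supp_in S) \<Longrightarrow> (\<Sum>i\<in>I. F i) \<in> supp_in S"
  by (induction I rule: infinite_finite_induct) auto

lemma supp_in_mono: "H \<subseteq> S \<Longrightarrow> f \<in> supp_in H \<Longrightarrow> f \<in> supp_in S"
  by (auto simp: supp_in_def)

text \<open>The linear functional with values \<open>\<theta> s\<close> on the basis. Matrix entries
  of \<open>\<Lambda>\<close>, stabilizer sums and the augmentation are all of this form.\<close>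

definition pairing :: "('a \<Rightarrow> complex) \<Rightarrow> ('a \<Rightarrow>\<^sub>0 complex) \<Rightarrow> complex" where
  "pairing \<theta> f = (\<Sum>s\<in>keys f. lookup f s * \<theta> s)"

text \<open>Cancellation can shrink the support of a sum, so linearity is checked over a common
  finite superset of the supports; \<open>amul_superset\<close> and \<open>act_superset\<close>
  serve the same end.\<close>

lemma pairing_superset:
  "finite A \<Longrightarrow> keys f \<subseteq> A \<Longrightarrow> pairing \<theta> f = (\<Sum>s\<in>A. lookup f s * \<theta> s)"
  unfolding pairing_def by (rule sum.mono_neutral_left) (auto simp: in_keys_iff)

lemma pairing_zero [simp]: "pairing \<theta> 0 = 0"
  by (simp add: pairing_def)

lemma pairing_add: "pairing \<theta> (f + g) = pairing \<theta> f + pairing \<theta> g"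
proof -
  let ?A = "keys f \<union> keys g"
  have "pairing \<theta> (f + g) = (\<Sum>s\<in>?A. lookup (f + g) s * \<theta> s)"
    by (rule pairing_superset) (use Poly_Mapping.keys_add[of f g] in auto)
  moreover have "pairing \<theta> f = (\<Sum>s\<in>?A. lookup f s * \<theta> s)" "pairing \<theta> g = (\<Sum>s\<in>?A. lookup g s * \<theta> s)"
    by (rule pairing_superset; auto)+
  ultimately show ?thesis by (simp add: lookup_add sum.distrib algebra_simps)
qed

lemma pairing_cscale: "pairing \<theta> (cscale c f) = c * pairing \<theta> f"
proof -
  have "pairing \<theta> (cscale c f) = (\<Sum>s\<in>keys f. lookup (cscale c f) s * \<theta> s)"
    by (rule pairing_superset) (auto simp: in_keys_iff)
  then show ?thesis by (simp add: pairing_def sum_distrib_left mult.assoc)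
qed

lemma pairing_diff: "pairing \<theta> (f - g) = pairing \<theta> f - pairing \<theta> g"
  using pairing_add[of \<theta> "f - g" g] by simp

lemma pairing_single [simp]: "pairing \<theta> (single s c) = c * \<theta> s"
  by (cases "c = 0") (simp_all add: pairing_def)

lemma pairing_sum: "pairing \<theta> (\<Sum>i\<in>I. F i) = (\<Sum>i\<in>I. pairing \<theta> (F i))"
  by (induction I rule: infinite_finite_induct) (simp_all add: pairing_add)

lemma pairing_amul:
  "pairing \<theta> (amul mul f g) = (\<Sum>s\<in>keys f. \<Sum>t\<in>keys g. lookup f s * lookup g t * \<theta> (mul s t))"
  by (simp add: amul_def pairing_sum)

lemma pairing_astar: "pairing \<theta> (astar st f) = (\<Sum>s\<in>keys f. cnj (lookup f s) * \<theta> (st s))"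
  by (simp add: astar_def pairing_sum)

lemma pairing_cong: "(\<And>s. s \<in> keys f \<Longrightarrow> \<theta> s = \<theta>' s) \<Longrightarrow> pairing \<theta> f = pairing \<theta>' f"
  by (simp add: pairing_def)

lemma amul_superset:
  assumes "finite A" "keys f \<subseteq> A" "finite B" "keys g \<subseteq> B"
  shows "amul mul f g = (\<Sum>s\<in>A. \<Sum>t\<in>B. single (mul s t) (lookup f s * lookup g t))"
proof -
  have "amul mul f g = (\<Sum>s\<in>keys f. \<Sum>t\<in>B. single (mul s t) (lookup f s * lookup g t))"
    unfolding amul_def using assms by (intro sum.cong refl sum.mono_neutral_left) (auto simp: in_keys_iff)
  also have "\<dots> = (\<Sum>s\<in>A. \<Sum>t\<in>B. single (mul s t) (lookup f s * lookup g t))"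
    using assms by (intro sum.mono_neutral_left) (auto simp: in_keys_iff)
  finally show ?thesis .
qed

lemma amul_diff_left: "amul mul (f - f') g = amul mul f g - amul mul f' g"
proof -
  let ?A = "keys f \<union> keys f'"
  have "amul mul h g = (\<Sum>s\<in>?A. \<Sum>t\<in>keys g. single (mul s t) (lookup h s * lookup g t))"
    if "keys h \<subseteq> ?A" for h
    using that by (intro amul_superset) auto
  from this[of f] this[of f'] this[of "f - f'"] show ?thesis
    using keys_diff[of f f']
    by (simp add: lookup_minus left_diff_distrib single_diff sum_subtractf)
qed

lemma amul_diff_right: "amul mul f (g - g') = amul mul f g - amul mul f g'"
proof -
  let ?A = "keys g \<union> keys g'"
  have "amul mul f h = (\<Sum>s\<in>keys f. \<Sum>t\<in>?A. single (mul s t) (lookup f s * lookup h t))"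
    if "keys h \<subseteq> ?A" for h
    using that by (intro amul_superset) auto
  from this[of g] this[of g'] this[of "g - g'"] show ?thesis
    using keys_diff[of g g']
    by (simp add: lookup_minus right_diff_distrib single_diff sum_subtractf)
qed

lemma astar_diff: "astar st (f - g) = astar st f - astar st g"
proof -
  let ?A = "keys f \<union> keys g"
  have "astar st h = (\<Sum>s\<in>?A. single (st s) (cnj (lookup h s)))" if "keys h \<subseteq> ?A" for h
    unfolding astar_def using that by (intro sum.mono_neutral_left) (auto simp: in_keys_iff)
  from this[of f] this[of g] this[of "f - g"] show ?thesis
    using keys_diff[of f g] by (simp add: lookup_minus single_diff sum_subtractf)
qed

lemma astar_single [simp]: "astar st (single s c) = single (st s) (cnj c)"
  by (cases "c = 0") (simp_all add: astar_def)

lemma restriction_supp: "restriction H f \<in> supp_in H"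
  unfolding restriction_def by (rule supp_in_sum) simp

lemma lookup_restriction: "lookup (restriction H f) s = (if s \<in> H then lookup f s else 0)"
proof -
  have "lookup (restriction H f) s = (\<Sum>h\<in>keys f \<inter> H. if h = s then lookup f h else 0)"
    unfolding restriction_def by (simp add: lookup_sum lookup_single when_def)
  then show ?thesis by (auto simp: in_keys_iff)
qed

lemma pairing_restriction: "pairing \<theta> (restriction H f) = pairing (\<lambda>s. if s \<in> H then \<theta> s else 0) f"
proof -
  have "pairing \<theta> (restriction H f) = (\<Sum>s\<in>keys f. lookup (restriction H f) s * \<theta> s)"
    by (rule pairing_superset) (auto simp: in_keys_iff lookup_restriction split: if_splits)
  then show ?thesis by (auto simp: pairing_def lookup_restriction intro: sum.cong)
qed

context inverse_semigroup
begin

abbreviation conv :: "('a \<Rightarrow>\<^sub>0 complex) \<Rightarrow> ('a \<Rightarrow>\<^sub>0 complex) \<Rightarrow> ('a \<Rightarrow>\<^sub>0 complex)" where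
  "conv \<equiv> amul mul"
abbreviation invol :: "('a \<Rightarrow>\<^sub>0 complex) \<Rightarrow> ('a \<Rightarrow>\<^sub>0 complex)" where "invol \<equiv> astar star"
abbreviation cnorm :: "('a \<Rightarrow>\<^sub>0 complex) \<Rightarrow> real" where "cnorm \<equiv> cstar_norm S mul"

lemma conv_supp [simp]: "f \<in> supp_in S \<Longrightarrow> g \<in> supp_in S \<Longrightarrow> conv f g \<in> supp_in S"
  unfolding amul_def by (intro supp_in_sum supp_in_single) (auto simp: supp_in_def intro: closed)

lemma invol_supp [simp]: "f \<in> supp_in S \<Longrightarrow> invol f \<in> supp_in S"
  unfolding astar_def by (intro supp_in_sum supp_in_single) (auto simp: supp_in_def intro: closed)

end

section \<open>The semigroup algebra acting through a representation\<close>

locale isg_rep = inverse_semigroup S mul + hilbert_space K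
  for S :: "'a set" and mul and K :: "'h::ab_group_add hilbert" +
  fixes \<pi> :: "'a \<Rightarrow> 'h \<Rightarrow> 'h"
  assumes rep: "semigroup_rep S mul K \<pi>"
begin

lemmas rep_facts' = rep_facts[OF inverse_semigroup_axioms hilbert_space_axioms rep]

abbreviation act :: "('a \<Rightarrow>\<^sub>0 complex) \<Rightarrow> 'h \<Rightarrow> 'h" where "act \<equiv> rep_lift K \<pi>"

lemma act_superset:
  assumes "finite A" "keys f \<subseteq> A" "x \<in> hset K"
  shows "act f x = (\<Sum>s\<in>A. hscale K (lookup f s) (\<pi> s x))"
  using assms unfolding rep_lift_def
  by (auto intro!: sum.mono_neutral_left simp: in_keys_iff)

lemma act_zero [simp]: "x \<in> hset K \<Longrightarrow> act 0 x = 0"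
  by (simp add: rep_lift_def)

lemma act_add: "x \<in> hset K \<Longrightarrow> act (f + g) x = act f x + act g x"
proof -
  assume x: "x \<in> hset K"
  let ?A = "keys f \<union> keys g"
  have "act h x = (\<Sum>s\<in>?A. hscale K (lookup h s) (\<pi> s x))" if "keys h \<subseteq> ?A" for h
    using that x by (intro act_superset) auto
  from this[of f] this[of g] this[of "f + g"] show ?thesis
    using Poly_Mapping.keys_add[of f g] by (simp add: lookup_add scale_left_distrib sum.distrib)
qed

lemma act_cscale: "x \<in> hset K \<Longrightarrow> act (cscale c f) x = hscale K c (act f x)"
proof -
  assume x: "x \<in> hset K"
  have "act (cscale c f) x = (\<Sum>s\<in>keys f. hscale K (lookup (cscale c f) s) (\<pi> s x))"
    using x by (intro act_superset) (auto simp: in_keys_iff)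
  then show ?thesis using x by (simp add: rep_lift_def scale_sum_right)
qed

lemma act_diff: "x \<in> hset K \<Longrightarrow> act (f - g) x = act f x - act g x"
  using act_add[of x "f - g" g] by simp

lemma act_single: "x \<in> hset K \<Longrightarrow> act (single s c) x = hscale K c (\<pi> s x)"
  by (cases "c = 0") (simp_all add: rep_lift_def)

lemma act_sum: "x \<in> hset K \<Longrightarrow> act (\<Sum>i\<in>I. F i) x = (\<Sum>i\<in>I. act (F i) x)"
  by (induction I rule: infinite_finite_induct) (simp_all add: act_add)

lemma act_mem [simp]: "f \<in> supp_in S \<Longrightarrow> x \<in> hset K \<Longrightarrow> act f x \<in> hset K"
  using rep_lift_bound(1)[OF inverse_semigroup_axioms hilbert_space_axioms rep] by (simp add: supp_in_def)

lemma rep_add: "s \<in> S \<Longrightarrow> x \<in> hset K \<Longrightarrow> y \<in> hset K \<Longrightarrow> \<pi> s (x + y) = \<pi> s x + \<pi> s y"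
  and rep_scale: "s \<in> S \<Longrightarrow> x \<in> hset K \<Longrightarrow> \<pi> s (hscale K c x) = hscale K c (\<pi> s x)"
  using rep_facts'(1)[of s] by (auto simp: bop_def)

lemma rep_zero: "s \<in> S \<Longrightarrow> \<pi> s 0 = 0"
  using rep_add[of s 0 0] by simp

lemma rep_sum: "s \<in> S \<Longrightarrow> (\<And>i. i \<in> I \<Longrightarrow> g i \<in> hset K) \<Longrightarrow> \<pi> s (\<Sum>i\<in>I. g i) = (\<Sum>i\<in>I. \<pi> s (g i))"
  by (induction I rule: infinite_finite_induct) (simp_all add: rep_add rep_zero)

lemma rep_mul: "s \<in> S \<Longrightarrow> t \<in> S \<Longrightarrow> x \<in> hset K \<Longrightarrow> \<pi> (mul s t) x = \<pi> s (\<pi> t x)"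
  using rep by (simp add: semigroup_rep_def compose_eq)

lemma act_vec_add:
  assumes "f \<in> supp_in S" "x \<in> hset K" "y \<in> hset K"
  shows "act f (x + y) = act f x + act f y"
proof -
  have "\<pi> s (x + y) = \<pi> s x + \<pi> s y" if "s \<in> keys f" for s
    using assms that by (intro rep_add) (auto simp: supp_in_def)
  then show ?thesis using assms by (simp add: rep_lift_def scale_right_distrib sum.distrib)
qed

lemma act_vec_scale:
  assumes "f \<in> supp_in S" "x \<in> hset K"
  shows "act f (hscale K c x) = hscale K c (act f x)"
proof -
  have "\<pi> s (hscale K c x) = hscale K c (\<pi> s x)" if "s \<in> keys f" for s
    using assms that by (intro rep_scale) (auto simp: supp_in_def)
  then show ?thesis using assms by (simp add: rep_lift_def scale_sum_right mult.commute)
qed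

lemma act_conv:
  assumes f: "f \<in> supp_in S" and g: "g \<in> supp_in S" and x: "x \<in> hset K"
  shows "act (conv f g) x = act f (act g x)"
proof -
  have sf: "s \<in> S" if "s \<in> keys f" for s using that f by (auto simp: supp_in_def)
  have sg: "s \<in> S" if "s \<in> keys g" for s using that g by (auto simp: supp_in_def)
  have "act f (act g x) = (\<Sum>s\<in>keys f. hscale K (lookup f s) (\<pi> s (act g x)))"
    using f g x act_mem[OF g x] by (simp only: rep_lift_def[of K \<pi> f] restrict_apply if_True)
  also have "\<dots> = (\<Sum>s\<in>keys f. hscale K (lookup f s) (\<Sum>t\<in>keys g. hscale K (lookup g t) (\<pi> s (\<pi> t x))))"
    using x sf sg by (intro sum.cong refl) (simp add: rep_lift_def rep_sum rep_scale rep_facts'(2))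
  also have "\<dots> = act (conv f g) x"
    using x sf sg by (simp add: amul_def act_sum act_single scale_sum_right rep_mul)
  finally show ?thesis by simp
qed

lemma hip_sum_left:
  "(\<And>i. i \<in> I \<Longrightarrow> g i \<in> hset K) \<Longrightarrow> y \<in> hset K \<Longrightarrow> hip K (\<Sum>i\<in>I. g i) y = (\<Sum>i\<in>I. hip K (g i) y)"
  by (induction I rule: infinite_finite_induct) (simp_all add: ip_add)

lemma hip_sum_right:
  "(\<And>i. i \<in> I \<Longrightarrow> g i \<in> hset K) \<Longrightarrow> y \<in> hset K \<Longrightarrow> hip K y (\<Sum>i\<in>I. g i) = (\<Sum>i\<in>I. hip K y (g i))"
  by (induction I rule: infinite_finite_induct) (simp_all add: ip_add_right)

lemma act_invol:
  assumes f: "f \<in> supp_in S" and x: "x \<in> hset K" and y: "y \<in> hset K"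
  shows "hip K (act f x) y = hip K x (act (invol f) y)"
proof -
  have sf: "s \<in> S" if "s \<in> keys f" for s using that f by (auto simp: supp_in_def)
  have "hip K (act f x) y = (\<Sum>s\<in>keys f. lookup f s * hip K (\<pi> s x) y)"
    using x y sf by (simp add: rep_lift_def hip_sum_left rep_facts'(2) ip_scale)
  also have "\<dots> = (\<Sum>s\<in>keys f. lookup f s * hip K x (\<pi> (star s) y))"
    using rep_facts'(4)[OF sf] x y by (intro sum.cong refl) (simp add: is_adjoint_def)
  also have "\<dots> = hip K x (act (invol f) y)"
    using x y sf by (simp add: astar_def act_sum act_single hip_sum_right rep_facts'(2) ip_scale_right)
  finally show ?thesis .
qed

text \<open>\<open>cstar_norm\<close> is a supremum over Hilbert spaces inside one fixed type;
  \<open>cstar_norm_upper\<close> makes it a bound on every other type too, in particular for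
  \<open>ell2 S\<close>.\<close>

lemma act_norm:
  assumes f: "f \<in> supp_in S" and x: "x \<in> hset K"
  shows "hnorm K (act f x) \<le> cnorm f * hnorm K x"
proof -
  have "keys f \<subseteq> S" using f by (simp add: supp_in_def)
  note b = rep_lift_bound(2)[OF inverse_semigroup_axioms hilbert_space_axioms rep this]
  have "hnorm K (act f x) \<le> op_norm K (act f) * hnorm K x"
    by (rule le_op_norm[OF b _ x]) (auto intro: sum_nonneg)
  also have "\<dots> \<le> cnorm f * hnorm K x"
    using cstar_norm_upper[OF inverse_semigroup_axioms hilbert_space_axioms rep \<open>keys f \<subseteq> S\<close>] x
    by (intro mult_right_mono) auto
  finally show ?thesis .
qed

end

context inverse_semigroup
begin

text \<open>The zero space guarantees that the supremum in \<open>cstar_norm\<close> is over a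
  nonempty set of reals.\<close>

lemma zero_rep_exists:
  "\<exists>(K :: ('a option \<Rightarrow> complex) hilbert) \<pi>. hilbert_space K \<and> semigroup_rep S mul K \<pi>"
proof -
  define K :: "('a option \<Rightarrow> complex) hilbert" where
    "K = \<lparr>hscale = (\<lambda>c f x. c * f x), hset = {0}, hip = (\<lambda>_ _. 0)\<rparr>"
  interpret V: vector_space "hscale K"
    by unfold_locales (auto simp: K_def fun_eq_iff algebra_simps)
  have "V.subspace {0}" by (auto simp: V.subspace_def)
  then have "hilbert_space K"
    by unfold_locales (auto simp: K_def hnorm_def)
  moreover have "semigroup_rep S mul K (\<lambda>_. \<lambda>x\<in>{0}. 0)"
    by (auto simp: semigroup_rep_def partial_isometry_def bop_def is_adjoint_def K_def
        compose_def hnorm_def fun_eq_iff)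
  ultimately show ?thesis by blast
qed

lemma cnorm_le:
  assumes "0 \<le> c"
    and "\<And>(K :: ('a option \<Rightarrow> complex) hilbert) \<pi> x. isg_rep S mul K \<pi> \<Longrightarrow> x \<in> hset K \<Longrightarrow>
      hnorm K (rep_lift K \<pi> f x) \<le> c * hnorm K x"
  shows "cnorm f \<le> c"
  unfolding cstar_norm_def
proof (rule cSup_least)
  show "{op_norm K (rep_lift K \<pi> f) | (K :: ('a option \<Rightarrow> complex) hilbert) \<pi>.
            hilbert_space K \<and> semigroup_rep S mul K \<pi>} \<noteq> {}" using zero_rep_exists by blast
  fix r assume "r \<in> {op_norm K (rep_lift K \<pi> f) | (K :: ('a option \<Rightarrow> complex) hilbert) \<pi>.
            hilbert_space K \<and> semigroup_rep S mul K \<pi>}"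
  then obtain K :: "('a option \<Rightarrow> complex) hilbert" and \<pi>
    where r: "r = op_norm K (rep_lift K \<pi> f)" and K: "hilbert_space K" "semigroup_rep S mul K \<pi>"
    by blast
  have "isg_rep S mul K \<pi>" using K inverse_semigroup_axioms by (simp add: isg_rep_def isg_rep_axioms_def)
  then show "r \<le> c" unfolding r using assms by (intro hilbert_space.op_norm_le[OF K(1)])
qed

lemma cnorm_nonneg: "f \<in> supp_in S \<Longrightarrow> 0 \<le> cnorm f"
proof -
  assume f: "f \<in> supp_in S"
  obtain K :: "('a option \<Rightarrow> complex) hilbert" and \<pi>
    where K: "hilbert_space K" "semigroup_rep S mul K \<pi>" using zero_rep_exists by blast
  have f': "keys f \<subseteq> S" using f by (simp add: supp_in_def)
  have "0 \<le> op_norm K (rep_lift K \<pi> f)"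
    by (rule hilbert_space.op_norm_nonneg[OF K(1) rep_lift_bound(2)[OF inverse_semigroup_axioms K f']])
      (auto intro: sum_nonneg)
  also have "\<dots> \<le> cnorm f" by (rule cstar_norm_ge[OF inverse_semigroup_axioms K f'])
  finally show ?thesis .
qed

end

text \<open>Abstracted from the full norm so that one calculus of Cauchy sequences also covers
  \<open>znorm\<close>, which vanishes on the multiples of \<open>z\<close>.\<close>

locale star_seminorm = inverse_semigroup S mul for S :: "'a set" and mul +
  fixes M :: "('a \<Rightarrow>\<^sub>0 complex) \<Rightarrow> real"
  assumes nonneg: "f \<in> supp_in S \<Longrightarrow> 0 \<le> M f"
    and triangle: "f \<in> supp_in S \<Longrightarrow> g \<in> supp_in S \<Longrightarrow> M (f + g) \<le> M f + M g"
    and scale: "f \<in> supp_in S \<Longrightarrow> M (cscale c f) \<le> cmod c * M f"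
    and mult: "f \<in> supp_in S \<Longrightarrow> g \<in> supp_in S \<Longrightarrow> M (conv f g) \<le> M f * M g"
    and invol: "f \<in> supp_in S \<Longrightarrow> M (invol f) \<le> M f"

context inverse_semigroup
begin

text \<open>Each inequality holds in every single representation, with constants expressed by
  \<open>cnorm\<close>, and \<open>cnorm_le\<close> passes it to the supremum.\<close>

lemma cnorm_star_seminorm: "star_seminorm S mul cnorm"
proof unfold_locales
  fix f g :: "'a \<Rightarrow>\<^sub>0 complex" assume f: "f \<in> supp_in S"
  show "0 \<le> cnorm f" by (rule cnorm_nonneg[OF f])
  show "cnorm (cscale c f) \<le> cmod c * cnorm f" for c
  proof (rule cnorm_le)
    fix K :: "('a option \<Rightarrow> complex) hilbert" and \<pi> x
    assume K: "isg_rep S mul K \<pi>" and x: "x \<in> hset K"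
    interpret isg_rep S mul K \<pi> by (rule K)
    show "hnorm K (act (cscale c f) x) \<le> cmod c * cnorm f * hnorm K x"
      using act_norm[OF f x] x f
      by (simp add: act_cscale hnorm_scale mult.assoc mult_left_mono)
  qed (use cnorm_nonneg[OF f] in auto)
  show "cnorm (invol f) \<le> cnorm f"
  proof (rule cnorm_le)
    fix K :: "('a option \<Rightarrow> complex) hilbert" and \<pi> x
    assume K: "isg_rep S mul K \<pi>" and x: "x \<in> hset K"
    interpret isg_rep S mul K \<pi> by (rule K)
    let ?y = "act (invol f) x"
    have y: "?y \<in> hset K" using f x by simp
    have "(hnorm K ?y)\<^sup>2 = cmod (hip K ?y ?y)" using ip_self[OF y] by (simp add: norm_power)
    also have "\<dots> = cmod (hip K (act f ?y) x)" using act_invol[OF f y x] by simp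
    also have "\<dots> \<le> hnorm K (act f ?y) * hnorm K x" using f x by (intro cauchy_schwarz) auto
    also have "\<dots> \<le> cnorm f * hnorm K ?y * hnorm K x"
      using act_norm[OF f y] x by (intro mult_right_mono) auto
    \<comment> \<open>One factor \<open>hnorm K ?y\<close> stands on both sides and is cancelled
      below, unless it is zero.\<close>
    finally have "hnorm K ?y * hnorm K ?y \<le> hnorm K ?y * (cnorm f * hnorm K x)"
      by (simp add: power2_eq_square mult_ac)
    then show "hnorm K ?y \<le> cnorm f * hnorm K x"
      using hnorm_nonneg[OF y] hnorm_nonneg[OF x] cnorm_nonneg[OF f]
      by (cases "hnorm K ?y = 0") (auto simp: mult_le_cancel_left)
  qed (rule cnorm_nonneg[OF f])
  assume g: "g \<in> supp_in S"
  show "cnorm (f + g) \<le> cnorm f + cnorm g"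
  proof (rule cnorm_le)
    fix K :: "('a option \<Rightarrow> complex) hilbert" and \<pi> x
    assume K: "isg_rep S mul K \<pi>" and x: "x \<in> hset K"
    interpret isg_rep S mul K \<pi> by (rule K)
    show "hnorm K (act (f + g) x) \<le> (cnorm f + cnorm g) * hnorm K x"
      using act_norm[OF f x] act_norm[OF g x] hnorm_triangle[of "act f x" "act g x"] x f g
      by (simp add: act_add distrib_right)
  qed (use cnorm_nonneg f g in auto)
  show "cnorm (conv f g) \<le> cnorm f * cnorm g"
  proof (rule cnorm_le)
    fix K :: "('a option \<Rightarrow> complex) hilbert" and \<pi> x
    assume K: "isg_rep S mul K \<pi>" and x: "x \<in> hset K"
    interpret isg_rep S mul K \<pi> by (rule K)
    have "hnorm K (act (conv f g) x) \<le> cnorm f * hnorm K (act g x)"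
      using act_norm[of f "act g x"] f g x by (simp add: act_conv)
    also have "\<dots> \<le> cnorm f * (cnorm g * hnorm K x)"
      using act_norm[OF g x] cnorm_nonneg[OF f] by (rule mult_left_mono)
    finally show "hnorm K (act (conv f g) x) \<le> cnorm f * cnorm g * hnorm K x" by (simp add: mult.assoc)
  qed (use cnorm_nonneg f g in auto)
qed

end

section \<open>The completion and weak containment\<close>

context star_seminorm
begin

lemma M_zero [simp]: "M 0 = 0"
proof -
  have "cscale 0 (0 :: 'a \<Rightarrow>\<^sub>0 complex) = 0" by (rule poly_mapping_eqI) simp
  then show ?thesis using scale[of 0 0] nonneg[of 0] by simp
qed

lemma M_uminus: "f \<in> supp_in S \<Longrightarrow> M (- f) = M f"
  using scale[of f "-1"] scale[of "- f" "-1"] by (simp add: cscale_minus1)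

lemma M_diff_commute: "f \<in> supp_in S \<Longrightarrow> g \<in> supp_in S \<Longrightarrow> M (f - g) = M (g - f)"
  using M_uminus[of "f - g"] by simp

lemma M_diff_triangle:
  "f \<in> supp_in S \<Longrightarrow> g \<in> supp_in S \<Longrightarrow> h \<in> supp_in S \<Longrightarrow> M (f - h) \<le> M (f - g) + M (g - h)"
  using triangle[of "f - g" "g - h"] by simp

lemma M_reverse_triangle:
  assumes "f \<in> supp_in S" "g \<in> supp_in S"
  shows "\<bar>M f - M g\<bar> \<le> M (f - g)"
  using triangle[of "f - g" g] triangle[of "g - f" f] M_diff_commute[of f g] assms by simp

definition cau :: "(nat \<Rightarrow> 'a \<Rightarrow>\<^sub>0 complex) \<Rightarrow> bool" where
  "cau u \<longleftrightarrow> (\<forall>n. u n \<in> supp_in S) \<and> (\<forall>e>0. \<exists>N. \<forall>m\<ge>N. \<forall>n\<ge>N. M (u m - u n) < e)"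

lemma cau_supp [simp]: "cau u \<Longrightarrow> u n \<in> supp_in S"
  by (simp add: cau_def)

lemma cauD: "cau u \<Longrightarrow> e > 0 \<Longrightarrow> \<exists>N. \<forall>m\<ge>N. \<forall>n\<ge>N. M (u m - u n) < e"
  by (simp add: cau_def)

lemma cau_const: "f \<in> supp_in S \<Longrightarrow> cau (\<lambda>_. f)"
  by (simp add: cau_def)

text \<open>One criterion for all operations; a unary operation passes its sequence twice. The bound
  \<open>e / (2 * C)\<close> shares \<open>e\<close> between the two sequences.\<close>

lemma cau_dominated:
  assumes u: "cau u" and v: "cau v" and "\<And>n. w n \<in> supp_in S" and "C > 0"
    and le: "\<And>m n. M (w m - w n) \<le> C * (M (u m - u n) + M (v m - v n))"
  shows "cau w"
  unfolding cau_def
proof (intro conjI allI impI)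
  fix e :: real assume "e > 0"
  then have e': "e / (2 * C) > 0" using \<open>C > 0\<close> by simp
  obtain N1 where N1: "\<forall>m\<ge>N1. \<forall>n\<ge>N1. M (u m - u n) < e / (2 * C)" using cauD[OF u e'] by blast
  obtain N2 where N2: "\<forall>m\<ge>N2. \<forall>n\<ge>N2. M (v m - v n) < e / (2 * C)" using cauD[OF v e'] by blast
  have "M (w m - w n) < e" if "m \<ge> max N1 N2" "n \<ge> max N1 N2" for m n
  proof -
    have "C * (M (u m - u n) + M (v m - v n)) < C * (e / (2 * C) + e / (2 * C))"
      using N1 N2 that \<open>C > 0\<close> by (intro mult_strict_left_mono add_strict_mono) auto
    also have "\<dots> = e" using \<open>C > 0\<close> by (simp add: field_simps)
    finally show ?thesis using le[of m n] by linarith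
  qed
  then show "\<exists>N. \<forall>m\<ge>N. \<forall>n\<ge>N. M (w m - w n) < e" by blast
qed fact

lemma cau_convergent: "cau u \<Longrightarrow> convergent (\<lambda>n. M (u n))"
proof (rule real_Cauchy_convergent, rule metric_CauchyI)
  fix e :: real assume u: "cau u" and "e > 0"
  then obtain N where "\<forall>m\<ge>N. \<forall>n\<ge>N. M (u m - u n) < e" using cauD by blast
  then show "\<exists>N. \<forall>m\<ge>N. \<forall>n\<ge>N. dist (M (u m)) (M (u n)) < e"
    unfolding dist_real_def using M_reverse_triangle[OF cau_supp[OF u] cau_supp[OF u]]
    by (meson le_less_trans)
qed

lemma cau_bounded:
  assumes "cau u"
  obtains B where "B > 0" "\<And>n. M (u n) \<le> B"
proof -
  have "Bseq (\<lambda>n. M (u n))" using assms by (intro convergent_imp_Bseq cau_convergent)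
  then obtain B where "B > 0" "\<And>n. norm (M (u n)) \<le> B" by (auto simp: Bseq_def)
  then show ?thesis using that by (metis abs_le_D1 real_norm_def)
qed

lemma null_dominated:
  assumes "(\<lambda>n. M (u n)) \<longlonglongrightarrow> 0" "(\<lambda>n. M (v n)) \<longlonglongrightarrow> 0"
    and "\<And>n. w n \<in> supp_in S" "\<And>n. M (w n) \<le> C * (M (u n) + M (v n))"
  shows "(\<lambda>n. M (w n)) \<longlonglongrightarrow> 0"
proof (rule tendsto_sandwich[of "\<lambda>_. 0"])
  have "(\<lambda>n. C * (M (u n) + M (v n))) \<longlonglongrightarrow> C * (0 + 0)" using assms by (intro tendsto_intros)
  then show "(\<lambda>n. C * (M (u n) + M (v n))) \<longlonglongrightarrow> 0" by simp
qed (use assms nonneg in \<open>auto intro!: always_eventually\<close>)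

text \<open>Telescoping: \<open>f g - f' g' = (f - f') g + f' (g - g')\<close>, which is why
  \<open>B\<close> bounds \<open>f'\<close> and \<open>g\<close>.\<close>

lemma M_conv_diff:
  assumes "f \<in> supp_in S" "f' \<in> supp_in S" "g \<in> supp_in S" "g' \<in> supp_in S" "M f' \<le> B" "M g \<le> B"
  shows "M (conv f g - conv f' g') \<le> B * (M (f - f') + M (g - g'))"
proof -
  have "conv f g - conv f' g' = conv (f - f') g + conv f' (g - g')"
    by (simp add: amul_diff_left amul_diff_right)
  then have "M (conv f g - conv f' g') \<le> M (conv (f - f') g) + M (conv f' (g - g'))"
    using assms triangle by simp
  also have "\<dots> \<le> M (f - f') * M g + M f' * M (g - g')"
    using assms by (intro add_mono mult) auto
  also have "\<dots> \<le> M (f - f') * B + B * M (g - g')"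
    using assms by (intro add_mono mult_left_mono mult_right_mono nonneg) auto
  finally show ?thesis by (simp add: algebra_simps)
qed

lemma cau_add: "cau u \<Longrightarrow> cau v \<Longrightarrow> cau (\<lambda>n. u n + v n)"
proof (rule cau_dominated[of u v _ 1])
  show "M (u m + v m - (u n + v n)) \<le> 1 * (M (u m - u n) + M (v m - v n))" if "cau u" "cau v" for m n
    using that triangle[of "u m - u n" "v m - v n"] by (simp add: algebra_simps)
qed auto

lemma cau_cscale: "cau u \<Longrightarrow> cau (\<lambda>n. cscale c (u n))"
\<comment> \<open>Adding \<open>1\<close> keeps the constant positive when
  \<open>c = 0\<close>.\<close>
proof (rule cau_dominated[of u u _ "cmod c + 1"])
  show "M (cscale c (u m) - cscale c (u n)) \<le> (cmod c + 1) * (M (u m - u n) + M (u m - u n))"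
    if "cau u" for m n
  proof -
    have "M (cscale c (u m - u n)) \<le> cmod c * M (u m - u n)" using that by (intro scale) simp
    moreover have "0 \<le> M (u m - u n)" "0 \<le> cmod c * M (u m - u n)" using that nonneg[of "u m - u n"] by auto
    ultimately have "M (cscale c (u m - u n)) \<le> (cmod c + 1) * (M (u m - u n) + M (u m - u n))"
      by (simp only: distrib_left distrib_right mult_1)
    then show ?thesis by (simp only: cscale_diff)
  qed
qed (auto intro: add_nonneg_pos)

lemma cau_invol: "cau u \<Longrightarrow> cau (\<lambda>n. astar star (u n))"
proof (rule cau_dominated[of u u _ 1])
  show "M (astar star (u m) - astar star (u n)) \<le> 1 * (M (u m - u n) + M (u m - u n))" if "cau u" for m n
    using invol[of "u m - u n"] nonneg[of "u m - u n"] that by (simp add: astar_diff)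
qed auto

lemma cau_conv:
  assumes u: "cau u" and v: "cau v"
  shows "cau (\<lambda>n. conv (u n) (v n))"
proof -
  obtain B where B: "B > 0" "\<And>n. M (u n) \<le> B" using cau_bounded[OF u] by blast
  obtain B' where B': "B' > 0" "\<And>n. M (v n) \<le> B'" using cau_bounded[OF v] by blast
  have "M (conv (u m) (v m) - conv (u n) (v n)) \<le> max B B' * (M (u m - u n) + M (v m - v n))" for m n
    using u v B(2)[of n] B'(2)[of m] by (intro M_conv_diff) auto
  from cau_dominated[OF u v _ _ this] show ?thesis
    using B(1) by (simp add: u v less_max_iff_disj)
qed

text \<open>\<open>v\<close> is \<open>u\<close> plus a null sequence, and null sequences are
  Cauchy. This later recovers a Cauchy sequence of restrictions from a value of
  \<open>\<epsilon>\<close>.\<close>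

lemma cau_if_null_diff:
  assumes u: "cau u" and v: "\<And>n. v n \<in> supp_in S" and null: "(\<lambda>n. M (v n - u n)) \<longlonglongrightarrow> 0"
  shows "cau v"
proof -
  have d: "v n - u n \<in> supp_in S" for n using v u by simp
  have "cau (\<lambda>n. v n - u n)"
    unfolding cau_def
  proof (intro conjI allI impI d)
    fix e :: real assume "e > 0"
    then obtain N where N: "\<And>n. n \<ge> N \<Longrightarrow> M (v n - u n) < e / 2"
      using order_tendstoD(2)[OF null, of "e / 2"] by (auto simp: eventually_sequentially)
    have "M (v m - u m - (v n - u n)) < e" if "m \<ge> N" "n \<ge> N" for m n
      using M_diff_triangle[OF d supp_in_zero d, of m n] M_uminus[OF d, of n] N[OF that(1)] N[OF that(2)]
      by simp
    then show "\<exists>N. \<forall>m\<ge>N. \<forall>n\<ge>N. M (v m - u m - (v n - u n)) < e" by blast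
  qed
  from cau_add[OF u this] show ?thesis by simp
qed

lemma null_diff_sym:
  "cau u \<Longrightarrow> cau v \<Longrightarrow> (\<lambda>n. M (u n - v n)) \<longlonglongrightarrow> 0 \<Longrightarrow> (\<lambda>n. M (v n - u n)) \<longlonglongrightarrow> 0"
  using M_diff_commute by simp

lemma null_diff_trans:
  assumes "cau u" "cau v" "cau w" "(\<lambda>n. M (u n - v n)) \<longlonglongrightarrow> 0" "(\<lambda>n. M (v n - w n)) \<longlonglongrightarrow> 0"
  shows "(\<lambda>n. M (u n - w n)) \<longlonglongrightarrow> 0"
  by (rule null_dominated[OF assms(4,5), of _ 1]) (use assms M_diff_triangle in auto)

lemma null_add:
  assumes "cau u" "cau v" "cau u'" "cau v'"
    and "(\<lambda>n. M (u n - u' n)) \<longlonglongrightarrow> 0" "(\<lambda>n. M (v n - v' n)) \<longlonglongrightarrow> 0"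
  shows "(\<lambda>n. M (u n + v n - (u' n + v' n))) \<longlonglongrightarrow> 0"
proof (rule null_dominated[OF assms(5,6), of _ 1])
  show "M (u n + v n - (u' n + v' n)) \<le> 1 * (M (u n - u' n) + M (v n - v' n))" for n
    using assms triangle[of "u n - u' n" "v n - v' n"] by (simp add: algebra_simps)
qed (use assms in auto)

lemma null_cscale:
  assumes "cau u" "cau u'" "(\<lambda>n. M (u n - u' n)) \<longlonglongrightarrow> 0"
  shows "(\<lambda>n. M (cscale c (u n) - cscale c (u' n))) \<longlonglongrightarrow> 0"
proof (rule null_dominated[OF assms(3,3), of _ "cmod c"])
  show "M (cscale c (u n) - cscale c (u' n)) \<le> cmod c * (M (u n - u' n) + M (u n - u' n))" for n
    using scale[of "u n - u' n" c] mult_nonneg_nonneg[OF norm_ge_zero nonneg, of "u n - u' n" c] assms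
    by (simp add: cscale_diff distrib_left del: zero_le_mult_iff)
qed (use assms in auto)

lemma null_invol:
  assumes "cau u" "cau u'" "(\<lambda>n. M (u n - u' n)) \<longlonglongrightarrow> 0"
  shows "(\<lambda>n. M (astar star (u n) - astar star (u' n))) \<longlonglongrightarrow> 0"
proof (rule null_dominated[OF assms(3,3), of _ 1])
  show "M (astar star (u n) - astar star (u' n)) \<le> 1 * (M (u n - u' n) + M (u n - u' n))" for n
    using invol[of "u n - u' n"] nonneg[of "u n - u' n"] assms by (simp add: astar_diff)
qed (use assms in auto)

lemma null_conv:
  assumes u: "cau u" "cau u'" "(\<lambda>n. M (u n - u' n)) \<longlonglongrightarrow> 0"
    and v: "cau v" "cau v'" "(\<lambda>n. M (v n - v' n)) \<longlonglongrightarrow> 0"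
  shows "(\<lambda>n. M (conv (u n) (v n) - conv (u' n) (v' n))) \<longlonglongrightarrow> 0"
proof -
  obtain B where B: "\<And>n. M (u' n) \<le> B" using cau_bounded[OF u(2)] by blast
  obtain B' where B': "\<And>n. M (v n) \<le> B'" using cau_bounded[OF v(1)] by blast
  have "M (conv (u n) (v n) - conv (u' n) (v' n)) \<le> max B B' * (M (u n - u' n) + M (v n - v' n))" for n
    using u v B[of n] B'[of n] by (intro M_conv_diff) auto
  from null_dominated[OF u(3) v(3) _ this] show ?thesis by (simp add: u v)
qed

text \<open>By the reverse triangle inequality, the limit of the norms does not depend on the
  representative.\<close>

lemma null_diff_lim:
  assumes "cau u" "cau v" "(\<lambda>n. M (u n - v n)) \<longlonglongrightarrow> 0" "(\<lambda>n. M (v n)) \<longlonglongrightarrow> l"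
  shows "(\<lambda>n. M (u n)) \<longlonglongrightarrow> l"
proof -
  have "(\<lambda>n. M (u n) - M (v n)) \<longlonglongrightarrow> 0"
    by (rule tendsto_rabs_zero_cancel, rule tendsto_sandwich[OF _ _ tendsto_const assms(3)])
      (use assms M_reverse_triangle in \<open>auto intro!: always_eventually\<close>)
  from tendsto_add[OF this assms(4)] show ?thesis by simp
qed

end

sublocale inverse_semigroup \<subseteq> cn: star_seminorm S mul cnorm
  by (rule cnorm_star_seminorm)

section \<open>The full C*-algebra in terms of Cauchy sequences\<close>

context inverse_semigroup
begin

text \<open>The point of the completion given by \<open>u\<close>. As \<open>null_rel\<close>
  relates Cauchy sequences only, this is the empty set for any other \<open>u\<close>; hence the
  assumptions \<open>cn.cau\<close> throughout.\<close>

definition cls :: "(nat \<Rightarrow> 'a \<Rightarrow>\<^sub>0 complex) \<Rightarrow> (nat \<Rightarrow> 'a \<Rightarrow>\<^sub>0 complex) set" where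
  "cls u = null_rel (semigroup_algebra S mul) `` {u}"

lemma alg_dist_semigroup_algebra: "alg_dist (semigroup_algebra S mul) f g = cnorm (f - g)"
  by (simp add: alg_dist_def semigroup_algebra_sel cscale_minus1)

lemma cauchy_seqs_semigroup_algebra: "cauchy_seqs (semigroup_algebra S mul) = {u. cn.cau u}"
  by (simp add: cauchy_seqs_def alg_dist_semigroup_algebra semigroup_algebra_sel cn.cau_def)

lemma mem_cls:
  "v \<in> cls u \<longleftrightarrow> cn.cau u \<and> cn.cau v \<and> (\<lambda>n. cnorm (u n - v n)) \<longlonglongrightarrow> 0"
  by (simp add: cls_def null_rel_def cauchy_seqs_semigroup_algebra alg_dist_semigroup_algebra)

lemma cls_eq_iff:
  assumes u: "cn.cau u" and v: "cn.cau v"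
  shows "cls u = cls v \<longleftrightarrow> (\<lambda>n. cnorm (u n - v n)) \<longlonglongrightarrow> 0"
proof
  assume "cls u = cls v"
  moreover have "v \<in> cls v" using v by (simp add: mem_cls)
  ultimately have "v \<in> cls u" by simp
  then show "(\<lambda>n. cnorm (u n - v n)) \<longlonglongrightarrow> 0" by (simp add: mem_cls)
next
  assume uv: "(\<lambda>n. cnorm (u n - v n)) \<longlonglongrightarrow> 0"
  have vu: "(\<lambda>n. cnorm (v n - u n)) \<longlonglongrightarrow> 0" by (rule cn.null_diff_sym[OF u v uv])
  have sub: "w \<in> cls v'" if "w \<in> cls u'" "cn.cau u'" "cn.cau v'"
      "(\<lambda>n. cnorm (v' n - u' n)) \<longlonglongrightarrow> 0" for w u' v'
    using that cn.null_diff_trans[of v' u' w] by (simp add: mem_cls)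
  show "cls u = cls v"
    using sub[OF _ u v vu] sub[OF _ v u uv] by (intro equalityI subsetI)
qed

text \<open>The operations of \<open>completion\<close> act on chosen representatives. Since the
  choice is equivalent to \<open>u\<close>, each of them can be computed termwise on
  \<open>u\<close>.\<close>

lemma pick_cls:
  assumes "cn.cau u"
  shows "cn.cau (pick (cls u))" "(\<lambda>n. cnorm (pick (cls u) n - u n)) \<longlonglongrightarrow> 0"
proof -
  have "u \<in> cls u" using assms by (simp only: mem_cls) simp
  then have "pick (cls u) \<in> cls u" unfolding pick_def by (rule someI[of "\<lambda>v. v \<in> cls u"])
  then have *: "cn.cau (pick (cls u))" "(\<lambda>n. cnorm (u n - pick (cls u) n)) \<longlonglongrightarrow> 0"
    by (simp_all only: mem_cls)
  show "cn.cau (pick (cls u))" by (rule *)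
  show "(\<lambda>n. cnorm (pick (cls u) n - u n)) \<longlonglongrightarrow> 0" by (rule cn.null_diff_sym[OF assms *])
qed

lemma carrier_cstar: "carrier (cstar S mul) = cls ` {u. cn.cau u}"
  by (auto simp: cls_def cstar_def completion_def quotient_def cauchy_seqs_semigroup_algebra)

lemma cstar_emb_eq: "cstar_emb S mul f = cls (\<lambda>_. f)"
  by (simp add: cls_def cstar_emb_def completion_emb_def)

lemma cstar_zero: "alg_zero (cstar S mul) = cls (\<lambda>_. 0)"
  by (simp add: cls_def cstar_def completion_def semigroup_algebra_sel)

lemma cstar_add:
  assumes "cn.cau u" "cn.cau v"
  shows "alg_add (cstar S mul) (cls u) (cls v) = cls (\<lambda>n. u n + v n)"
proof -
  have "alg_add (cstar S mul) (cls u) (cls v) = cls (\<lambda>n. pick (cls u) n + pick (cls v) n)"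
    by (simp add: cls_def cstar_def completion_def semigroup_algebra_sel)
  then show ?thesis
    using assms pick_cls[OF assms(1)] pick_cls[OF assms(2)]
    by (simp only:) (subst cls_eq_iff; intro cn.null_add cn.cau_add; assumption)
qed

lemma cstar_scale:
  assumes "cn.cau u"
  shows "alg_scale (cstar S mul) c (cls u) = cls (\<lambda>n. cscale c (u n))"
proof -
  have "alg_scale (cstar S mul) c (cls u) = cls (\<lambda>n. cscale c (pick (cls u) n))"
    by (simp add: cls_def cstar_def completion_def semigroup_algebra_sel)
  then show ?thesis
    using assms pick_cls[OF assms(1)]
    by (simp only:) (subst cls_eq_iff; intro cn.null_cscale cn.cau_cscale; assumption)
qed

lemma cstar_star:
  assumes "cn.cau u"
  shows "alg_star (cstar S mul) (cls u) = cls (\<lambda>n. astar star (u n))"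
proof -
  have "alg_star (cstar S mul) (cls u) = cls (\<lambda>n. astar star (pick (cls u) n))"
    by (simp add: cls_def cstar_def completion_def semigroup_algebra_sel)
  then show ?thesis
    using assms pick_cls[OF assms(1)]
    by (simp only:) (subst cls_eq_iff; intro cn.null_invol cn.cau_invol; assumption)
qed

lemma cstar_mult:
  assumes "cn.cau u" "cn.cau v"
  shows "alg_mult (cstar S mul) (cls u) (cls v) = cls (\<lambda>n. conv (u n) (v n))"
proof -
  have "alg_mult (cstar S mul) (cls u) (cls v) = cls (\<lambda>n. conv (pick (cls u) n) (pick (cls v) n))"
    by (simp add: cls_def cstar_def completion_def semigroup_algebra_sel)
  then show ?thesis
    using assms pick_cls[OF assms(1)] pick_cls[OF assms(2)]
    by (simp only:) (subst cls_eq_iff; intro cn.null_conv cn.cau_conv; assumption)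
qed

lemma cstar_norm_tendsto:
  assumes "cn.cau u"
  shows "(\<lambda>n. cnorm (u n)) \<longlonglongrightarrow> alg_norm (cstar S mul) (cls u)"
proof -
  obtain l where l: "(\<lambda>n. cnorm (u n)) \<longlonglongrightarrow> l"
    using cn.cau_convergent[OF assms] by (auto simp: convergent_def)
  have "(\<lambda>n. cnorm (pick (cls u) n)) \<longlonglongrightarrow> l"
    using pick_cls[OF assms] assms l by (intro cn.null_diff_lim[of "pick (cls u)" u])
  then have "alg_norm (cstar S mul) (cls u) = l"
    by (simp add: cstar_def completion_def semigroup_algebra_sel limI)
  then show ?thesis using l by simp
qed

end

section \<open>Norm limits of vectors\<close>

context hilbert_space
begin

text \<open>The ambient type carries no topology, so norm convergence is a predicate of its own,
  with membership in the space built in.\<close>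

definition hlim :: "(nat \<Rightarrow> 'h) \<Rightarrow> 'h \<Rightarrow> bool" where
  "hlim X x \<longleftrightarrow> (\<forall>n. X n \<in> hset K) \<and> x \<in> hset K \<and> (\<lambda>n. hnorm K (X n - x)) \<longlonglongrightarrow> 0"

lemma hlim_mem: "hlim X x \<Longrightarrow> X n \<in> hset K" "hlim X x \<Longrightarrow> x \<in> hset K"
  by (simp_all add: hlim_def)

lemma hlim_dominated:
  assumes "\<And>n. X n \<in> hset K" "x \<in> hset K" "\<And>n. hnorm K (X n - x) \<le> a n" "a \<longlonglongrightarrow> 0"
  shows "hlim X x"
  unfolding hlim_def
  using assms by (auto intro!: tendsto_sandwich[OF _ _ tendsto_const assms(4)] always_eventually)

lemma hlim_ip:
  assumes X: "hlim X x" and y: "y \<in> hset K"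
  shows "(\<lambda>n. hip K (X n) y) \<longlonglongrightarrow> hip K x y" "(\<lambda>n. hip K y (X n)) \<longlonglongrightarrow> hip K y x"
proof -
  have l: "(\<lambda>n. hnorm K (X n - x) * hnorm K y) \<longlonglongrightarrow> 0"
    using tendsto_mult_right[of _ 0 sequentially "hnorm K y"] X by (simp add: hlim_def)
  have "(\<lambda>n. hip K (X n) y - hip K x y) \<longlonglongrightarrow> 0"
    by (rule Lim_null_comparison[OF _ l])
      (use cauchy_schwarz[OF _ y] hlim_mem[OF X] y in
        \<open>auto intro!: always_eventually simp: ip_diff[symmetric]\<close>)
  then show *: "(\<lambda>n. hip K (X n) y) \<longlonglongrightarrow> hip K x y" by (simp add: LIM_zero_iff)
  have "(\<lambda>n. cnj (hip K (X n) y)) \<longlonglongrightarrow> cnj (hip K x y)" by (intro tendsto_intros *)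
  then show "(\<lambda>n. hip K y (X n)) \<longlonglongrightarrow> hip K y x"
    using ip_cnj[OF _ y] hlim_mem[OF X] by simp
qed

text \<open>Inner products with \<open>x - y\<close> have only one limit, so \<open>x - y\<close> is
  orthogonal to itself.\<close>

lemma hlim_unique:
  assumes X: "hlim X x" and Y: "hlim X y"
  shows "x = y"
proof -
  have xy: "x - y \<in> hset K" using X Y by (auto dest: hlim_mem)
  have "hip K x (x - y) = hip K y (x - y)"
    using LIMSEQ_unique[OF hlim_ip(1)[OF X xy] hlim_ip(1)[OF Y xy]] .
  then have "hip K (x - y) (x - y) = 0" using xy X Y by (simp add: ip_diff hlim_mem(2))
  then show ?thesis using ip_pos[OF xy] by auto
qed

lemma hlim_add:
  assumes X: "hlim X x" and Y: "hlim Y y"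
  shows "hlim (\<lambda>n. X n + Y n) (x + y)"
proof (rule hlim_dominated)
  show "hnorm K (X n + Y n - (x + y)) \<le> hnorm K (X n - x) + hnorm K (Y n - y)" for n
    using hnorm_triangle[of "X n - x" "Y n - y"] hlim_mem[OF X] hlim_mem[OF Y] by (simp add: add_diff_add)
  show "(\<lambda>n. hnorm K (X n - x) + hnorm K (Y n - y)) \<longlonglongrightarrow> 0"
    using X Y by (intro tendsto_add_zero) (simp_all add: hlim_def)
qed (use X Y in \<open>auto dest: hlim_mem\<close>)

lemma hlim_scale:
  assumes X: "hlim X x"
  shows "hlim (\<lambda>n. hscale K c (X n)) (hscale K c x)"
proof (rule hlim_dominated)
  show "hnorm K (hscale K c (X n) - hscale K c x) \<le> cmod c * hnorm K (X n - x)" for n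
    using hnorm_scale[of "X n - x" c] hlim_mem[OF X] by (simp add: scale_right_diff_distrib)
  show "(\<lambda>n. cmod c * hnorm K (X n - x)) \<longlonglongrightarrow> 0"
    using X tendsto_mult_right_zero[of _ sequentially "cmod c"] by (simp add: hlim_def)
qed (use X in \<open>auto dest: hlim_mem\<close>)

lemma hlim_norm_le:
  assumes X: "hlim X x" and le: "\<And>n. hnorm K (X n) \<le> c"
  shows "hnorm K x \<le> c"
proof (rule LIMSEQ_le_const)
  show "(\<lambda>n. c + hnorm K (X n - x)) \<longlonglongrightarrow> c"
    using X tendsto_add[of "\<lambda>_. c" c sequentially _ 0] by (simp add: hlim_def)
  have "hnorm K x \<le> c + hnorm K (X n - x)" for n
  proof -
    have "hnorm K (X n - x) = hnorm K (x - X n)"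
      using hnorm_scale[of "X n - x" "-1"] hlim_mem[OF X] by simp
    then show ?thesis
      using hnorm_triangle[of "X n" "x - X n"] hlim_mem[OF X] le[of n] by simp
  qed
  then show "\<exists>N. \<forall>n\<ge>N. hnorm K x \<le> c + hnorm K (X n - x)" by blast
qed

end

section \<open>Extending a representation to the completion\<close>

context isg_rep
begin

text \<open>\<open>rep_ext\<close> is a definite description that refers to all representatives of a
  class. Completeness gives a limit for \<open>u\<close>, and equivalent sequences share it because
  \<open>act\<close> is bounded by \<open>cnorm\<close>.\<close>

lemma rep_ext_hlim:
  assumes u: "cn.cau u" and x: "x \<in> hset K"
  shows "hlim (\<lambda>n. act (u n) x) (rep_ext K \<pi> (cls u) x)"
proof -
  have "\<exists>y\<in>hset K. (\<lambda>n. hnorm K (act (u n) x - y)) \<longlonglongrightarrow> 0"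
  proof (rule complete)
    show "act (u n) x \<in> hset K" for n using u x by simp
    fix e :: real assume "e > 0"
    \<comment> \<open>The summand \<open>1\<close> avoids a zero denominator for
      \<open>x = 0\<close>.\<close>
    then have "e / (hnorm K x + 1) > 0" using hnorm_nonneg[OF x] by (intro divide_pos_pos) auto
    from cn.cauD[OF u this] obtain N where
      N: "\<And>m n. m \<ge> N \<Longrightarrow> n \<ge> N \<Longrightarrow> cnorm (u m - u n) < e / (hnorm K x + 1)" by blast
    have "hnorm K (act (u m) x - act (u n) x) < e" if "m \<ge> N" "n \<ge> N" for m n
    proof -
      have "hnorm K (act (u m) x - act (u n) x) \<le> cnorm (u m - u n) * hnorm K x"
        using act_norm[of "u m - u n" x] u x by (simp add: act_diff)
      also have "\<dots> \<le> cnorm (u m - u n) * (hnorm K x + 1)"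
        using u by (intro mult_left_mono cnorm_nonneg) auto
      also have "\<dots> < e"
        using N[OF that] hnorm_nonneg[OF x] by (simp add: pos_less_divide_eq)
      finally show ?thesis .
    qed
    then show "\<exists>N. \<forall>m\<ge>N. \<forall>n\<ge>N. hnorm K (act (u m) x - act (u n) x) < e" by blast
  qed
  then obtain y where y: "hlim (\<lambda>n. act (u n) x) y" using u x by (auto simp: hlim_def)
  have all: "hlim (\<lambda>n. act (v n) x) y" if "v \<in> cls u" for v
  proof -
    have v: "cn.cau v" "(\<lambda>n. cnorm (u n - v n)) \<longlonglongrightarrow> 0" using that by (simp_all only: mem_cls)
    show ?thesis
    proof (rule hlim_dominated)
      show "hnorm K (act (v n) x - y) \<le> cnorm (u n - v n) * hnorm K x + hnorm K (act (u n) x - y)" for n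
      proof -
        have "hnorm K (act (v n) x - y) \<le> hnorm K (act (v n - u n) x) + hnorm K (act (u n) x - y)"
          using hnorm_triangle[of "act (v n) x - act (u n) x" "act (u n) x - y"] u v(1) x hlim_mem(2)[OF y]
          by (simp add: act_diff)
        also have "hnorm K (act (v n - u n) x) \<le> cnorm (u n - v n) * hnorm K x"
          using act_norm[of "v n - u n" x] u v(1) x cn.M_diff_commute[of "u n" "v n"] by simp
        finally show ?thesis by simp
      qed
      show "(\<lambda>n. cnorm (u n - v n) * hnorm K x + hnorm K (act (u n) x - y)) \<longlonglongrightarrow> 0"
        using tendsto_add[OF tendsto_mult_right[OF v(2), of "hnorm K x"]] y by (force simp: hlim_def)
    qed (use v(1) x y in \<open>auto dest: hlim_mem\<close>)
  qed
  have mem: "u \<in> cls u" using u by (simp only: mem_cls) simp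
  have "rep_ext K \<pi> (cls u) x = y"
    unfolding rep_ext_def restrict_apply if_P[OF x]
  proof (rule the_equality)
    show "y \<in> hset K \<and> (\<forall>v\<in>cls u. (\<lambda>n. hnorm K (act (v n) x - y)) \<longlonglongrightarrow> 0)"
      using all hlim_mem(2)[OF y] by (auto simp only: hlim_def)
    fix w assume "w \<in> hset K \<and> (\<forall>v\<in>cls u. (\<lambda>n. hnorm K (act (v n) x - w)) \<longlonglongrightarrow> 0)"
    then have "hlim (\<lambda>n. act (u n) x) w" using mem u x unfolding hlim_def by auto
    then show "w = y" using y by (rule hlim_unique)
  qed
  then show ?thesis using y by simp
qed

lemma rep_ext_eqI:
  "cn.cau u \<Longrightarrow> x \<in> hset K \<Longrightarrow> hlim (\<lambda>n. act (u n) x) y \<Longrightarrow> rep_ext K \<pi> (cls u) x = y"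
  using rep_ext_hlim hlim_unique by blast

lemma rep_ext_mem: "cn.cau u \<Longrightarrow> x \<in> hset K \<Longrightarrow> rep_ext K \<pi> (cls u) x \<in> hset K"
  using rep_ext_hlim hlim_mem(2) by blast

lemma rep_ext_undefined: "x \<notin> hset K \<Longrightarrow> rep_ext K \<pi> X x = undefined"
  by (simp add: rep_ext_def)

lemma rep_ext_norm:
  assumes u: "cn.cau u" and x: "x \<in> hset K" and B: "\<And>n. cnorm (u n) \<le> B"
  shows "hnorm K (rep_ext K \<pi> (cls u) x) \<le> B * hnorm K x"
proof (rule hlim_norm_le[OF rep_ext_hlim[OF u x]])
  show "hnorm K (act (u n) x) \<le> B * hnorm K x" for n
    using act_norm[of "u n" x] B[of n] u x by (meson cn.cau_supp hnorm_nonneg mult_right_mono order_trans)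
qed

lemma rep_ext_bop:
  assumes u: "cn.cau u"
  shows "rep_ext K \<pi> (cls u) \<in> bop K"
proof -
  obtain B where B: "\<And>n. cnorm (u n) \<le> B" using cn.cau_bounded[OF u] by blast
  show ?thesis
    unfolding bop_def
  proof (intro CollectI conjI ballI allI exI[of _ B])
    show "rep_ext K \<pi> (cls u) \<in> hset K \<rightarrow>\<^sub>E hset K"
      using rep_ext_mem[OF u] by (auto simp: rep_ext_undefined)
    show "hnorm K (rep_ext K \<pi> (cls u) x) \<le> B * hnorm K x" if "x \<in> hset K" for x
      by (rule rep_ext_norm[OF u that B])
    show "rep_ext K \<pi> (cls u) (x + y) = rep_ext K \<pi> (cls u) x + rep_ext K \<pi> (cls u) y"
      if "x \<in> hset K" "y \<in> hset K" for x y
      using hlim_add[OF rep_ext_hlim[OF u that(1)] rep_ext_hlim[OF u that(2)]] u that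
      by (intro rep_ext_eqI) (simp_all add: act_vec_add)
    show "rep_ext K \<pi> (cls u) (hscale K c x) = hscale K c (rep_ext K \<pi> (cls u) x)"
      if "x \<in> hset K" for c x
      using hlim_scale[OF rep_ext_hlim[OF u that], of c] u that
      by (intro rep_ext_eqI) (simp_all add: act_vec_scale)
  qed
qed

lemma rep_ext_add:
  assumes "cn.cau u" "cn.cau v" "x \<in> hset K"
  shows "rep_ext K \<pi> (cls (\<lambda>n. u n + v n)) x = rep_ext K \<pi> (cls u) x + rep_ext K \<pi> (cls v) x"
  using hlim_add[OF rep_ext_hlim[OF assms(1,3)] rep_ext_hlim[OF assms(2,3)]] assms
  by (intro rep_ext_eqI cn.cau_add) (simp_all add: act_add)

lemma rep_ext_cscale:
  assumes "cn.cau u" "x \<in> hset K"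
  shows "rep_ext K \<pi> (cls (\<lambda>n. cscale c (u n))) x = hscale K c (rep_ext K \<pi> (cls u) x)"
  using hlim_scale[OF rep_ext_hlim[OF assms], of c] assms
  by (intro rep_ext_eqI cn.cau_cscale) (simp_all add: act_cscale)

text \<open>The error splits into \<open>act (u n)\<close> applied to
  \<open>act (v n) x - ?y\<close> and the error of \<open>act (u n) ?y\<close>. The first part is
  small because the norms of the \<open>u n\<close> are bounded.\<close>

lemma rep_ext_conv:
  assumes u: "cn.cau u" and v: "cn.cau v" and x: "x \<in> hset K"
  shows "rep_ext K \<pi> (cls (\<lambda>n. conv (u n) (v n))) x = rep_ext K \<pi> (cls u) (rep_ext K \<pi> (cls v) x)"
proof (rule rep_ext_eqI[OF cn.cau_conv[OF u v] x])
  let ?y = "rep_ext K \<pi> (cls v) x"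
  let ?z = "rep_ext K \<pi> (cls u) ?y"
  obtain B where B: "\<And>n. cnorm (u n) \<le> B" using cn.cau_bounded[OF u] by blast
  have y: "?y \<in> hset K" by (rule rep_ext_mem[OF v x])
  have z: "?z \<in> hset K" by (rule rep_ext_mem[OF u y])
  have ly: "hlim (\<lambda>n. act (v n) x) ?y" by (rule rep_ext_hlim[OF v x])
  have lz: "hlim (\<lambda>n. act (u n) ?y) ?z" by (rule rep_ext_hlim[OF u y])
  show "hlim (\<lambda>n. act (conv (u n) (v n)) x) ?z"
  proof (rule hlim_dominated)
    fix n
    have vx: "act (v n) x - ?y \<in> hset K" using v x y by simp
    have "act (u n) (act (v n) x - ?y + ?y) = act (u n) (act (v n) x - ?y) + act (u n) ?y"
      using u vx y by (intro act_vec_add) simp_all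
    then have "act (conv (u n) (v n)) x - ?z = act (u n) (act (v n) x - ?y) + (act (u n) ?y - ?z)"
      using u v x by (simp add: act_conv)
    then have "hnorm K (act (conv (u n) (v n)) x - ?z) \<le>
        hnorm K (act (u n) (act (v n) x - ?y)) + hnorm K (act (u n) ?y - ?z)"
      using hnorm_triangle[of "act (u n) (act (v n) x - ?y)" "act (u n) ?y - ?z"] u vx y z by (simp only: act_mem cn.cau_supp mem)
    also have "hnorm K (act (u n) (act (v n) x - ?y)) \<le> B * hnorm K (act (v n) x - ?y)"
      using act_norm[of "u n", OF _ vx] B[of n] u vx
      by (meson cn.cau_supp hnorm_nonneg mult_right_mono order_trans)
    finally show "hnorm K (act (conv (u n) (v n)) x - ?z) \<le>
      B * hnorm K (act (v n) x - ?y) + hnorm K (act (u n) ?y - ?z)" by simp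
  next
    show "(\<lambda>n. B * hnorm K (act (v n) x - ?y) + hnorm K (act (u n) ?y - ?z)) \<longlonglongrightarrow> 0"
      using tendsto_add[OF tendsto_mult_left[of "\<lambda>n. hnorm K (act (v n) x - ?y)" 0 sequentially B],
          of "\<lambda>n. hnorm K (act (u n) ?y - ?z)" 0] ly lz
      by (simp add: hlim_def)
  qed (use u v x z in auto)
qed

lemma rep_ext_invol:
  assumes u: "cn.cau u"
  shows "is_adjoint K (rep_ext K \<pi> (cls u)) (rep_ext K \<pi> (cls (\<lambda>n. astar star (u n))))"
  unfolding is_adjoint_def
proof (intro ballI)
  fix x y assume x: "x \<in> hset K" and y: "y \<in> hset K"
  have "(\<lambda>n. hip K (act (u n) x) y) \<longlonglongrightarrow> hip K (rep_ext K \<pi> (cls u) x) y"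
    by (rule hlim_ip[OF rep_ext_hlim[OF u x] y])
  moreover have "(\<lambda>n. hip K x (act (astar star (u n)) y)) \<longlonglongrightarrow>
      hip K x (rep_ext K \<pi> (cls (\<lambda>n. astar star (u n))) y)"
    by (rule hlim_ip(2)[OF rep_ext_hlim[OF cn.cau_invol[OF u] y] x])
  moreover have "hip K (act (u n) x) y = hip K x (act (astar star (u n)) y)" for n
    using u x y by (intro act_invol) auto
  ultimately show "hip K (rep_ext K \<pi> (cls u) x) y = hip K x (rep_ext K \<pi> (cls (\<lambda>n. astar star (u n))) y)"
    using LIMSEQ_unique by simp
qed

text \<open>The involution of \<open>bop_algebra\<close> is a definite description, so uniqueness is
  required of functions, not only on the space; outside of it both candidates are
  \<open>undefined\<close>.\<close>

lemma adjoint_unique: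
  assumes "T' \<in> bop K" "T'' \<in> bop K" "\<And>x. x \<in> hset K \<Longrightarrow> T x \<in> hset K"
    and "is_adjoint K T T'" "is_adjoint K T T''"
  shows "T' = T''"
proof
  fix y
  show "T' y = T'' y"
  proof (cases "y \<in> hset K")
    case True
    have m: "T' y \<in> hset K" "T'' y \<in> hset K" using assms(1,2) True by (auto simp: bop_def)
    then have d: "T' y - T'' y \<in> hset K" by simp
    have "hip K (T' y - T'' y) (T' y) = hip K (T' y - T'' y) (T'' y)"
      using assms(4,5) True d by (simp add: is_adjoint_def)
    then have "hip K (T' y - T'' y) (T' y - T'' y) = 0" using d m by (simp add: ip_diff_right)
    then show ?thesis using ip_pos[OF d] by auto
  next
    case False
    then show ?thesis using assms(1,2) by (auto simp: bop_def PiE_def extensional_def)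
  qed
qed

text \<open>The carrier of the target is the image, as in \<open>cstar_red\<close>, so weak
  containment reduces to injectivity.\<close>

lemma rep_ext_star_hom:
  "star_hom (cstar S mul) ((bop_algebra K)\<lparr>carrier := rep_ext K \<pi> ` carrier (cstar S mul)\<rparr>) (rep_ext K \<pi>)"
  unfolding star_hom_def
proof (intro conjI ballI allI)
  fix X assume "X \<in> carrier (cstar S mul)"
  then obtain u where X: "X = cls u" and u: "cn.cau u" by (auto simp: carrier_cstar)
  show "rep_ext K \<pi> (alg_scale (cstar S mul) c X) =
      alg_scale ((bop_algebra K)\<lparr>carrier := rep_ext K \<pi> ` carrier (cstar S mul)\<rparr>) c (rep_ext K \<pi> X)" for c
    unfolding X using u
    by (auto simp: fun_eq_iff bop_algebra_def cstar_scale rep_ext_cscale rep_ext_undefined)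
  show "rep_ext K \<pi> (alg_star (cstar S mul) X) =
      alg_star ((bop_algebra K)\<lparr>carrier := rep_ext K \<pi> ` carrier (cstar S mul)\<rparr>) (rep_ext K \<pi> X)"
  proof -
    have "(THE T'. T' \<in> bop K \<and> is_adjoint K (rep_ext K \<pi> (cls u)) T') =
        rep_ext K \<pi> (cls (\<lambda>n. astar star (u n)))"
      using rep_ext_bop[OF cn.cau_invol[OF u]] rep_ext_invol[OF u] rep_ext_mem[OF u]
      by (intro the_equality) (auto intro: adjoint_unique)
    then show ?thesis unfolding X using u by (simp add: bop_algebra_def cstar_star)
  qed
  fix Y assume "Y \<in> carrier (cstar S mul)"
  then obtain v where Y: "Y = cls v" and v: "cn.cau v" by (auto simp: carrier_cstar)
  show "rep_ext K \<pi> (alg_add (cstar S mul) X Y) =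
      alg_add ((bop_algebra K)\<lparr>carrier := rep_ext K \<pi> ` carrier (cstar S mul)\<rparr>) (rep_ext K \<pi> X) (rep_ext K \<pi> Y)"
    unfolding X Y using u v
    by (auto simp: fun_eq_iff bop_algebra_def cstar_add rep_ext_add rep_ext_undefined)
  show "rep_ext K \<pi> (alg_mult (cstar S mul) X Y) =
      alg_mult ((bop_algebra K)\<lparr>carrier := rep_ext K \<pi> ` carrier (cstar S mul)\<rparr>) (rep_ext K \<pi> X) (rep_ext K \<pi> Y)"
    unfolding X Y using u v
    by (auto simp: fun_eq_iff bop_algebra_def cstar_mult rep_ext_conv rep_ext_undefined compose_def)
qed auto

end

section \<open>Weak containment as a statement about sequences\<close>

sublocale inverse_semigroup \<subseteq> reg: isg_rep S mul "ell2 S" lreg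
  by (intro isg_rep.intro isg_rep_axioms.intro inverse_semigroup_axioms hilbert_space_ell2 lreg_rep)

context inverse_semigroup
begin

abbreviation regext :: "(nat \<Rightarrow> 'a \<Rightarrow>\<^sub>0 complex) set \<Rightarrow> ('a \<Rightarrow> complex) \<Rightarrow> 'a \<Rightarrow> complex" where
  "regext \<equiv> rep_ext (ell2 S) lreg"

text \<open>An operator with an adjoint that kills the basis vectors vanishes, since the coefficients
  of the values of the adjoint are inner products with images of basis vectors.\<close>

lemma regext_zero_iff:
  assumes u: "cn.cau u"
  shows "regext (cls u) = regext (cls (\<lambda>_. 0)) \<longleftrightarrow>
    (\<forall>b\<in>S. (\<lambda>n. hnorm (ell2 S) (reg.act (u n) (ket b))) \<longlonglongrightarrow> 0)"
proof -
  have zero: "regext (cls (\<lambda>_. 0)) x = 0" if "x \<in> hset (ell2 S)" for x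
    using that by (intro reg.rep_ext_eqI cn.cau_const) (simp_all add: reg.hlim_def hnorm_def)
  have lim: "reg.hlim (\<lambda>n. reg.act (u n) (ket b)) (regext (cls u) (ket b))" if "b \<in> S" for b
    using that by (intro reg.rep_ext_hlim[OF u] ket_mem)
  show ?thesis
  proof
    assume "regext (cls u) = regext (cls (\<lambda>_. 0))"
    then show "\<forall>b\<in>S. (\<lambda>n. hnorm (ell2 S) (reg.act (u n) (ket b))) \<longlonglongrightarrow> 0"
      using lim zero[OF ket_mem] by (simp add: reg.hlim_def)
  next
    assume null: "\<forall>b\<in>S. (\<lambda>n. hnorm (ell2 S) (reg.act (u n) (ket b))) \<longlonglongrightarrow> 0"
    have ket0: "regext (cls u) (ket b) = 0" if "b \<in> S" for b
      using that null u ket_mem[OF that]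
      by (intro reg.rep_ext_eqI[OF u]) (simp_all add: reg.hlim_def)
    let ?T = "regext (cls u)" and ?T' = "regext (cls (\<lambda>n. astar star (u n)))"
    have adj: "hip (ell2 S) (?T x) y = hip (ell2 S) x (?T' y)"
      if "x \<in> hset (ell2 S)" "y \<in> hset (ell2 S)" for x y
      using reg.rep_ext_invol[OF u] that by (simp add: is_adjoint_def)
    have star0: "?T' y = 0" if y: "y \<in> hset (ell2 S)" for y
    proof
      fix b
      have m: "?T' y \<in> hset (ell2 S)" by (rule reg.rep_ext_mem[OF cn.cau_invol[OF u] y])
      show "?T' y b = 0 b"
      proof (cases "b \<in> S")
        case True
        have "?T' y b = hip (ell2 S) (?T' y) (ket b)" using True by (simp add: hip_ket)
        also have "\<dots> = cnj (hip (ell2 S) (ket b) (?T' y))"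
          using reg.ip_cnj[OF ket_mem[OF True] m] .
        also have "\<dots> = 0" using adj[OF ket_mem[OF True] y] ket0[OF True] y by simp
        finally show ?thesis by simp
      qed (use ell2_outside[OF m] in auto)
    qed
    show "?T = regext (cls (\<lambda>_. 0))"
    proof
      fix x
      show "?T x = regext (cls (\<lambda>_. 0)) x"
      proof (cases "x \<in> hset (ell2 S)")
        case True
        have m: "?T x \<in> hset (ell2 S)" by (rule reg.rep_ext_mem[OF u True])
        have "hip (ell2 S) (?T x) (?T x) = 0" using adj[OF True m] star0[OF m] True by simp
        then have "?T x = 0" using reg.ip_pos[OF m] by auto
        then show ?thesis using zero[OF True] by simp
      qed (simp add: reg.rep_ext_undefined)
    qed
  qed
qed

text \<open>A homomorphism onto its image is an isomorphism iff its kernel is trivial, and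
  \<open>regext_zero_iff\<close> describes the kernel by convergence on basis vectors.\<close>

lemma weak_containment_iff:
  "weak_containment S mul \<longleftrightarrow>
    (\<forall>u. cn.cau u \<longrightarrow> (\<forall>b\<in>S. (\<lambda>n. hnorm (ell2 S) (reg.act (u n) (ket b))) \<longlonglongrightarrow> 0) \<longrightarrow>
      (\<lambda>n. cnorm (u n)) \<longlonglongrightarrow> 0)"
proof -
  have "weak_containment S mul \<longleftrightarrow> inj_on regext (carrier (cstar S mul))"
    using reg.rep_ext_star_hom
    by (simp add: weak_containment_def star_iso_def cstar_red_def bij_betw_def)
  also have "\<dots> \<longleftrightarrow> (\<forall>u. cn.cau u \<longrightarrow> regext (cls u) = regext (cls (\<lambda>_. 0)) \<longrightarrow> cls u = cls (\<lambda>_. 0))"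
  proof
    assume "inj_on regext (carrier (cstar S mul))"
    then show "\<forall>u. cn.cau u \<longrightarrow> regext (cls u) = regext (cls (\<lambda>_. 0)) \<longrightarrow> cls u = cls (\<lambda>_. 0)"
      using cn.cau_const[OF supp_in_zero] by (auto simp: inj_on_def carrier_cstar)
  next
    assume ker: "\<forall>u. cn.cau u \<longrightarrow> regext (cls u) = regext (cls (\<lambda>_. 0)) \<longrightarrow> cls u = cls (\<lambda>_. 0)"
    show "inj_on regext (carrier (cstar S mul))"
    proof (rule inj_onI)
      fix X Y assume XY: "X \<in> carrier (cstar S mul)" "Y \<in> carrier (cstar S mul)" "regext X = regext Y"
      obtain u v where u: "X = cls u" "cn.cau u" and v: "Y = cls v" "cn.cau v"
        using XY by (auto simp: carrier_cstar)
      have v': "cn.cau (\<lambda>n. cscale (-1) (v n))" by (rule cn.cau_cscale[OF v(2)])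
      have uv: "cn.cau (\<lambda>n. u n + cscale (-1) (v n))" by (rule cn.cau_add[OF u(2) v'])
      have "regext (cls (\<lambda>n. u n + cscale (-1) (v n))) = regext (cls (\<lambda>_. 0))"
      proof
        fix x
        show "regext (cls (\<lambda>n. u n + cscale (-1) (v n))) x = regext (cls (\<lambda>_. 0)) x"
        proof (cases "x \<in> hset (ell2 S)")
          case True
          have z: "regext (cls (\<lambda>_. 0)) x = 0"
            using True by (intro reg.rep_ext_eqI cn.cau_const) (simp_all add: reg.hlim_def hnorm_def)
          have "regext (cls (\<lambda>n. u n + cscale (-1) (v n))) x =
              regext (cls u) x + hscale (ell2 S) (-1) (regext (cls v) x)"
            using reg.rep_ext_add[OF u(2) v' True] reg.rep_ext_cscale[OF v(2) True] by simp
          then show ?thesis using z XY(3) u(1) v(1) by simp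
        qed (simp add: reg.rep_ext_undefined)
      qed
      then have "cls (\<lambda>n. u n + cscale (-1) (v n)) = cls (\<lambda>_. 0)" using ker uv by blast
      then have "(\<lambda>n. cnorm (u n - v n)) \<longlonglongrightarrow> 0"
        using uv cls_eq_iff[OF uv cn.cau_const[OF supp_in_zero]] by (simp add: cscale_minus1)
      then show "X = Y" using u v by (simp add: cls_eq_iff)
    qed
  qed
  also have "\<dots> \<longleftrightarrow> (\<forall>u. cn.cau u \<longrightarrow> (\<forall>b\<in>S. (\<lambda>n. hnorm (ell2 S) (reg.act (u n) (ket b))) \<longlonglongrightarrow> 0) \<longrightarrow>
      (\<lambda>n. cnorm (u n)) \<longlonglongrightarrow> 0)"
    using cls_eq_iff[OF _ cn.cau_const[OF supp_in_zero]] by (simp add: regext_zero_iff)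
  finally show ?thesis .
qed

end

section \<open>The quotient by the zero\<close>

context inverse_semigroup
begin

text \<open>The diagonal entry of \<open>\<Lambda>(s)\<close> at \<open>b\<close>. Its linear
  extension is the vector functional of the unit vector \<open>ket b\<close>, see
  \<open>act_ket_self\<close>.\<close>

definition stab :: "'a \<Rightarrow> 'a \<Rightarrow> complex" where
  "stab b s = (if mul (star s) (mul s b) = b \<and> mul s b = b then 1 else 0)"

lemma sum_fun_apply: "(\<Sum>i\<in>I. F i) c = (\<Sum>i\<in>I. F i c)" for F :: "'i \<Rightarrow> 'j \<Rightarrow> complex"
  by (induction I rule: infinite_finite_induct) simp_all

lemma act_ket_apply:
  assumes f: "f \<in> supp_in S" and b: "b \<in> S"
  shows "reg.act f (ket b) c =
    pairing (\<lambda>s. if mul (star s) (mul s b) = b \<and> mul s b = c then 1 else 0) f"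
proof -
  have "lreg s (ket b) c = (if mul (star s) (mul s b) = b \<and> mul s b = c then 1 else 0)"
    if "s \<in> keys f" for s
  proof -
    have s: "s \<in> S" using that f by (auto simp: supp_in_def)
    then show ?thesis
      using left_regular_delta(2)[OF s b] b by (auto simp: ket_def fun_eq_iff)
  qed
  then show ?thesis
    using ket_mem[OF b] by (simp add: rep_lift_def sum_fun_apply hscale_ell2 pairing_def)
qed

lemma act_ket_self:
  "f \<in> supp_in S \<Longrightarrow> b \<in> S \<Longrightarrow> hip (ell2 S) (reg.act f (ket b)) (ket b) = pairing (stab b) f"
  by (simp add: hip_ket act_ket_apply stab_def[abs_def])

lemma stab_pairing_le:
  assumes "f \<in> supp_in S" "b \<in> S"
  shows "cmod (pairing (stab b) f) \<le> cnorm f"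
proof -
  have "cmod (pairing (stab b) f) \<le> hnorm (ell2 S) (reg.act f (ket b)) * hnorm (ell2 S) (ket b)"
    using reg.cauchy_schwarz[of "reg.act f (ket b)" "ket b"] assms ket_mem[OF assms(2)] by (simp add: act_ket_self)
  then show ?thesis using reg.act_norm[OF assms(1) ket_mem[OF assms(2)]] assms by (simp add: hnorm_ket)
qed

text \<open>One factor of the inner product of \<open>reg.act f (ket b)\<close> with itself is moved
  across by the adjoint. The modulus absorbs the conjugation that arises because the entry is read
  in the second slot.\<close>

lemma act_ket_norm:
  assumes f: "f \<in> supp_in S" and b: "b \<in> S"
  shows "(hnorm (ell2 S) (reg.act f (ket b)))\<^sup>2 = cmod (pairing (stab b) (conv (astar star f) f))"
proof -
  let ?k = "ket b" and ?x = "reg.act f (ket b)"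
  have k: "?k \<in> hset (ell2 S)" and x: "?x \<in> hset (ell2 S)" using ket_mem[OF b] f by auto
  have "complex_of_real ((hnorm (ell2 S) ?x)\<^sup>2) = hip (ell2 S) ?x ?x" using reg.ip_self[OF x] by simp
  also have "\<dots> = hip (ell2 S) ?k (reg.act (conv (astar star f) f) ?k)"
    using reg.act_invol[OF f k x] f k by (simp add: reg.act_conv)
  also have "\<dots> = cnj (pairing (stab b) (conv (astar star f) f))"
    using reg.ip_cnj[of "reg.act (conv (astar star f) f) ?k" ?k] f k b by (simp add: act_ket_self)
  finally have "cmod (complex_of_real ((hnorm (ell2 S) ?x)\<^sup>2)) =
      cmod (cnj (pairing (stab b) (conv (astar star f) f)))" by (rule arg_cong)
  then show ?thesis by (simp del: of_real_power)
qed

text \<open>A basis vector \<open>b\<close> and the idempotent \<open>b b\<^sup>*\<close> induce the same vector functional, so it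
  suffices to test on a subsemigroup that contains the idempotents.\<close>

lemma stab_range:
  assumes "b \<in> S" "s \<in> S"
  shows "stab (mul b (star b)) s = stab b s"
  using fix_range_iff[of b "mul (star s) s"] fix_range_iff[of b s] assms by (simp add: stab_def)

end

section \<open>The zero element and the projection \<open>1 - z\<close>\<close>

locale isg_zero = inverse_semigroup S mul for S :: "'a set" and mul +
  fixes z :: 'a
  assumes zero_element: "zero_element S mul z"
begin

lemma z_mem [simp]: "z \<in> S"
  and mul_z [simp]: "s \<in> S \<Longrightarrow> mul s z = z"
  and z_mul [simp]: "s \<in> S \<Longrightarrow> mul z s = z"
  using zero_element by (auto simp: zero_element_def)

lemma star_z [simp]: "star z = z"
  by (rule star_idem) simp_all

text \<open>The augmentation, that is, the trivial character of \<open>S\<close>. It tells how an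
  element multiplies \<open>z\<close>, and it is also the stabilizer functional of
  \<open>z\<close>.\<close>

definition total :: "('a \<Rightarrow>\<^sub>0 complex) \<Rightarrow> complex" where
  "total = pairing (\<lambda>_. 1)"

lemma total_simps [simp]:
  "total 0 = 0" "total (f + g) = total f + total g" "total (f - g) = total f - total g"
  "total (cscale c f) = c * total f" "total (single s c) = c"
  by (simp_all add: total_def pairing_add pairing_diff pairing_cscale)

lemma total_conv: "total (conv f g) = total f * total g"
  by (simp add: total_def pairing_amul sum_product) (simp add: pairing_def sum_product)

lemma total_invol: "total (astar star f) = cnj (total f)"
  by (simp add: total_def pairing_astar) (simp add: pairing_def)

lemma total_le: "f \<in> supp_in S \<Longrightarrow> cmod (total f) \<le> cnorm f"
proof -
  assume f: "f \<in> supp_in S"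
  have "pairing (stab z) f = total f"
    unfolding total_def using f by (intro pairing_cong) (auto simp: stab_def supp_in_def)
  then show ?thesis using stab_pairing_le[OF f z_mem] by simp
qed

lemma conv_single_z: "f \<in> supp_in S \<Longrightarrow> conv f (single z c) = single z (total f * c)"
proof -
  assume f: "f \<in> supp_in S"
  have "conv f (single z c) = (\<Sum>s\<in>keys f. \<Sum>t\<in>{z}. single (mul s t) (lookup f s * lookup (single z c) t))"
    by (rule amul_superset) auto
  also have "\<dots> = (\<Sum>s\<in>keys f. single z (lookup f s * c))"
    using f by (intro sum.cong refl) (auto simp: supp_in_def)
  also have "\<dots> = single z (total f * c)"
    by (simp add: total_def pairing_def single_sum[symmetric] sum_distrib_right)
  finally show ?thesis .
qed

lemma single_z_conv: "f \<in> supp_in S \<Longrightarrow> conv (single z c) f = single z (c * total f)"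
proof -
  assume f: "f \<in> supp_in S"
  have "conv (single z c) f = (\<Sum>s\<in>{z}. \<Sum>t\<in>keys f. single (mul s t) (lookup (single z c) s * lookup f t))"
    by (rule amul_superset) auto
  also have "\<dots> = (\<Sum>s\<in>keys f. single z (c * lookup f s))"
    using f by (auto simp: supp_in_def intro!: sum.cong)
  also have "\<dots> = single z (c * total f)"
    by (simp add: total_def pairing_def single_sum[symmetric] sum_distrib_left)
  finally show ?thesis .
qed

text \<open>Multiplication by the central projection \<open>1 - z\<close>. It identifies the quotient by the ideal
  \<open>\<complex>z\<close> with an ideal of \<open>\<complex>S\<close>, up to the factor \<open>2\<close> in the crude bound below.\<close>

definition cut :: "('a \<Rightarrow>\<^sub>0 complex) \<Rightarrow> ('a \<Rightarrow>\<^sub>0 complex)" where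
  "cut f = f - single z (total f)"

definition znorm :: "('a \<Rightarrow>\<^sub>0 complex) \<Rightarrow> real" where
  "znorm f = cnorm (cut f)"

lemma cut_supp [simp]: "f \<in> supp_in S \<Longrightarrow> cut f \<in> supp_in S"
  by (simp add: cut_def)

lemma total_cut [simp]: "total (cut f) = 0"
  by (simp add: cut_def)

lemma cut_cut [simp]: "cut (cut f) = cut f"
  by (simp add: cut_def)

lemma cut_single_z [simp]: "cut (single z c) = 0"
  by (simp add: cut_def)

lemma cut_add: "cut (f + g) = cut f + cut g"
  by (simp add: cut_def single_add)

lemma cut_diff: "cut (f - g) = cut f - cut g"
  by (simp add: cut_def single_diff)

lemma cut_cscale: "cut (cscale c f) = cscale c (cut f)"
  by (simp add: cut_def cscale_diff)

lemma cut_invol: "cut (astar star f) = astar star (cut f)"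
  by (simp add: cut_def astar_diff total_invol)

text \<open>\<open>1 - z\<close> is central and idempotent, so cutting is multiplicative.\<close>

lemma cut_conv: "f \<in> supp_in S \<Longrightarrow> g \<in> supp_in S \<Longrightarrow> cut (conv f g) = conv (cut f) (cut g)"
  by (simp add: cut_def amul_diff_left amul_diff_right conv_single_z single_z_conv total_conv)

lemma cnorm_single_z: "cnorm (single z c) \<le> cmod c"
proof (rule cnorm_le)
  fix K :: "('a option \<Rightarrow> complex) hilbert" and \<pi> x
  assume K: "isg_rep S mul K \<pi>" and x: "x \<in> hset K"
  interpret isg_rep S mul K \<pi> by (rule K)
  show "hnorm K (act (single z c) x) \<le> cmod c * hnorm K x"
    using x rep_facts'(2,3)[OF z_mem x] by (simp add: act_single hnorm_scale mult_left_mono)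
qed simp

text \<open>\<open>cut f\<close> and \<open>f\<close> differ by \<open>total f\<close> times
  \<open>z\<close>, whose norm is at most \<open>cnorm f\<close>; the triangle inequality then
  yields the factor \<open>2\<close>.\<close>

lemma znorm_le: "f \<in> supp_in S \<Longrightarrow> znorm f \<le> 2 * cnorm f"
proof -
  assume f: "f \<in> supp_in S"
  have "cnorm (cut f) \<le> cnorm (cut f - f) + cnorm (f - 0)"
    using cn.M_diff_triangle[of "cut f" f 0] f by simp
  also have "cnorm (cut f - f) = cnorm (single z (total f))"
    using cn.M_uminus[of "single z (total f)"] by (simp add: cut_def)
  also have "\<dots> \<le> cnorm f" using cnorm_single_z total_le[OF f] by (rule order_trans)
  finally show ?thesis by (simp add: znorm_def)
qed

lemma znorm_single_z [simp]: "znorm (single z c) = 0"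
  by (simp add: znorm_def)

text \<open>\<open>cut\<close> respects all the operations, so \<open>znorm\<close> inherits the
  axioms from \<open>cnorm\<close>.\<close>

lemma znorm_star_seminorm: "star_seminorm S mul znorm"
  by unfold_locales
    (simp_all add: znorm_def cut_add cut_cscale cut_conv cut_invol
      cn.nonneg cn.triangle cn.scale cn.mult cn.invol)

end

sublocale isg_zero \<subseteq> zn: star_seminorm S mul znorm
  by (rule znorm_star_seminorm)

context isg_zero
begin

lemma zn_cau: "cn.cau u \<Longrightarrow> zn.cau u"
  unfolding zn.cau_def
proof (intro conjI allI impI)
  fix e :: real assume u: "cn.cau u" and "e > 0"
  then obtain N where N: "\<And>m n. m \<ge> N \<Longrightarrow> n \<ge> N \<Longrightarrow> cnorm (u m - u n) < e / 2"
    using cn.cauD[OF u, of "e / 2"] by auto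
  have "znorm (u m - u n) < e" if "m \<ge> N" "n \<ge> N" for m n
    using znorm_le[of "u m - u n"] N[OF that] u by simp
  then show "\<exists>N. \<forall>m\<ge>N. \<forall>n\<ge>N. znorm (u m - u n) < e" by blast
qed simp

text \<open>Turns a sequence that is Cauchy modulo \<open>z\<close> into one that is Cauchy for the
  full norm, to which weak containment applies.\<close>

lemma cau_cut_iff:
  assumes "\<And>n. u n \<in> supp_in S"
  shows "cn.cau (\<lambda>n. cut (u n)) \<longleftrightarrow> zn.cau u"
  unfolding cn.cau_def zn.cau_def znorm_def cut_diff using assms by simp

text \<open>The augmentation is bounded by the full norm, see \<open>total_le\<close>, so it maps
  Cauchy sequences to Cauchy sequences.\<close>

lemma total_convergent:
  assumes "cn.cau u"
  obtains l where "(\<lambda>n. total (u n)) \<longlonglongrightarrow> l"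
proof -
  have "Cauchy (\<lambda>n. total (u n))"
    unfolding Cauchy_def dist_norm
  proof (intro allI impI)
    fix e :: real assume "e > 0"
    then obtain N where N: "\<And>m n. m \<ge> N \<Longrightarrow> n \<ge> N \<Longrightarrow> cnorm (u m - u n) < e"
      using cn.cauD[OF assms] by blast
    have "cmod (total (u m) - total (u n)) < e" if "m \<ge> N" "n \<ge> N" for m n
      using total_le[of "u m - u n"] N[OF that] assms by simp
    then show "\<exists>N. \<forall>m\<ge>N. \<forall>n\<ge>N. cmod (total (u m) - total (u n)) < e" by blast
  qed
  then show ?thesis using that Cauchy_convergent convergent_def by blast
qed

lemma cnorm_single_z_null:
  assumes "c \<longlonglongrightarrow> l"
  shows "(\<lambda>n. cnorm (single z (c n) - single z l)) \<longlonglongrightarrow> 0"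
proof (rule tendsto_sandwich[of "\<lambda>_. 0"])
  show "(\<lambda>n. cmod (c n - l)) \<longlonglongrightarrow> 0" using assms by (simp add: LIM_zero tendsto_norm_zero)
  show "\<forall>\<^sub>F n in sequentially. 0 \<le> cnorm (single z (c n) - single z l)"
    by (simp add: cnorm_nonneg)
  show "\<forall>\<^sub>F n in sequentially. cnorm (single z (c n) - single z l) \<le> cmod (c n - l)"
    using cnorm_single_z by (simp add: single_diff[symmetric])
qed simp

lemma cau_single_z:
  assumes "c \<longlonglongrightarrow> l"
  shows "cn.cau (\<lambda>n. single z (c n))"
  unfolding cn.cau_def
proof (intro conjI allI impI)
  fix e :: real assume "e > 0"
  then obtain N where N: "\<And>m n. m \<ge> N \<Longrightarrow> n \<ge> N \<Longrightarrow> dist (c m) (c n) < e"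
    using LIMSEQ_imp_Cauchy[OF assms] unfolding Cauchy_def by blast
  have "cnorm (single z (c m) - single z (c n)) < e" if "m \<ge> N" "n \<ge> N" for m n
    using cnorm_single_z[of "c m - c n"] N[OF that] by (simp add: single_diff dist_norm)
  then show "\<exists>N. \<forall>m\<ge>N. \<forall>n\<ge>N. cnorm (single z (c m) - single z (c n)) < e" by blast
qed simp

definition zcls :: "complex \<Rightarrow> (nat \<Rightarrow> 'a \<Rightarrow>\<^sub>0 complex) set" where
  "zcls c = cls (\<lambda>_. single z c)"

lemma cls_single_z: "c \<longlonglongrightarrow> l \<Longrightarrow> cls (\<lambda>n. single z (c n)) = zcls l"
  unfolding zcls_def
  by (subst cls_eq_iff) (simp_all add: cau_single_z cn.cau_const cnorm_single_z_null)

text \<open>The class of \<open>u\<close> times \<open>z\<close> is \<open>z\<close> times the limit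
  of \<open>total (u n)\<close>, so the multiples of \<open>z\<close> absorb limits as well as
  elements of the semigroup algebra.\<close>

lemma range_zcls_ideal: "two_sided_ideal (cstar S mul) (range zcls)"
  unfolding two_sided_ideal_def
proof (intro conjI ballI allI)
  have z: "cn.cau (\<lambda>_. single z c)" for c by (rule cn.cau_const) simp
  show "range zcls \<subseteq> carrier (cstar S mul)"
    using z by (auto simp: zcls_def carrier_cstar)
  show "alg_zero (cstar S mul) \<in> range zcls"
    by (rule range_eqI[of _ _ 0]) (simp add: zcls_def cstar_zero)
  fix X assume "X \<in> range zcls"
  then obtain c where X: "X = zcls c" by blast
  show "alg_scale (cstar S mul) d X \<in> range zcls" for d
    using z by (auto simp: X zcls_def cstar_scale)
  show "alg_add (cstar S mul) X Y \<in> range zcls" if Y: "Y \<in> range zcls" for Y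
  proof -
    obtain d where Y: "Y = zcls d" using Y by blast
    have "alg_add (cstar S mul) X Y = zcls (c + d)"
      by (simp add: X Y zcls_def cstar_add z single_add)
    then show ?thesis by simp
  qed
  fix A assume "A \<in> carrier (cstar S mul)"
  then obtain u where A: "A = cls u" and u: "cn.cau u" by (auto simp: carrier_cstar)
  obtain l where l: "(\<lambda>n. total (u n)) \<longlonglongrightarrow> l" using total_convergent[OF u] .
  have "alg_mult (cstar S mul) A X = zcls (l * c)"
    using u cls_single_z[OF tendsto_mult_right[OF l, of c]]
    by (simp add: A X zcls_def cstar_mult z conv_single_z)
  moreover have "alg_mult (cstar S mul) X A = zcls (c * l)"
    using u cls_single_z[OF tendsto_mult_left[OF l, of c]]
    by (simp add: A X zcls_def cstar_mult z single_z_conv)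
  ultimately show "alg_mult (cstar S mul) A X \<in> range zcls" "alg_mult (cstar S mul) X A \<in> range zcls"
    by simp_all
qed

lemma generated_ideal_z:
  "generated_ideal (cstar S mul) (cstar_emb S mul (single z 1)) = range zcls"
proof
  have e: "cstar_emb S mul (single z 1) = zcls 1" by (simp add: cstar_emb_eq zcls_def)
  show "generated_ideal (cstar S mul) (cstar_emb S mul (single z 1)) \<subseteq> range zcls"
    unfolding generated_ideal_def e using range_zcls_ideal by auto
  have "zcls c \<in> I" if I: "two_sided_ideal (cstar S mul) I" "zcls 1 \<in> I" for I c
  proof -
    have "alg_scale (cstar S mul) c (zcls 1) \<in> I" using I by (simp add: two_sided_ideal_def)
    then show ?thesis by (simp add: zcls_def cstar_scale cn.cau_const)
  qed
  then show "range zcls \<subseteq> generated_ideal (cstar S mul) (cstar_emb S mul (single z 1))"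
    unfolding generated_ideal_def e by auto
qed

section \<open>The quotient in terms of sequences modulo \<open>znorm\<close>\<close>

definition zcoset :: "(nat \<Rightarrow> 'a \<Rightarrow>\<^sub>0 complex) \<Rightarrow> (nat \<Rightarrow> 'a \<Rightarrow>\<^sub>0 complex) set set" where
  "zcoset u = coset (cstar S mul) (range zcls) (cls u)"

lemma zcoset_cases:
  assumes u: "cn.cau u" and X: "X \<in> zcoset u"
  obtains v where "cn.cau v" "X = cls v" "(\<lambda>n. znorm (v n - u n)) \<longlonglongrightarrow> 0"
proof -
  have z: "cn.cau (\<lambda>_. single z c)" for c by (rule cn.cau_const) simp
  obtain c where "X = cls (\<lambda>n. u n + single z c)"
    using X by (auto simp: zcoset_def coset_def zcls_def cstar_add[OF u z])
  then show ?thesis using that[of "\<lambda>n. u n + single z c"] cn.cau_add[OF u z] by simp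
qed

text \<open>\<open>v n - u n\<close> is its cut, which is null, plus
  \<open>total (v n - u n)\<close> times \<open>z\<close>, whose coefficients tend to
  \<open>l - k\<close>. So \<open>cls v\<close> is \<open>cls u\<close> plus \<open>l - k\<close>
  times \<open>z\<close>.\<close>

lemma zcoset_intro:
  assumes u: "cn.cau u" and v: "cn.cau v" and uv: "(\<lambda>n. znorm (v n - u n)) \<longlonglongrightarrow> 0"
  shows "cls v \<in> zcoset u"
proof -
  have z: "cn.cau (\<lambda>_. single z c)" for c by (rule cn.cau_const) simp
  obtain k where k: "(\<lambda>n. total (u n)) \<longlonglongrightarrow> k" using total_convergent[OF u] .
  obtain l where l: "(\<lambda>n. total (v n)) \<longlonglongrightarrow> l" using total_convergent[OF v] .
  let ?c = "l - k"
  have c: "(\<lambda>n. total (v n - u n)) \<longlonglongrightarrow> ?c" using tendsto_diff[OF l k] by simp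
  have "(\<lambda>n. cnorm (cut (v n - u n) + (single z (total (v n - u n)) - single z ?c))) \<longlonglongrightarrow> 0"
    by (rule cn.null_dominated[OF _ cnorm_single_z_null[OF c], of "\<lambda>n. cut (v n - u n)" _ 1])
      (use uv u v in \<open>simp_all add: znorm_def cn.triangle del: total_simps\<close>)
  then have "(\<lambda>n. cnorm (v n - (u n + single z ?c))) \<longlonglongrightarrow> 0"
    by (simp add: cut_def algebra_simps del: total_simps)
  then have "cls v = cls (\<lambda>n. u n + single z ?c)"
    using cn.cau_add[OF u z] by (simp add: cls_eq_iff[OF v])
  also have "\<dots> = alg_add (cstar S mul) (cls u) (zcls ?c)" by (simp add: zcls_def cstar_add[OF u z])
  finally show ?thesis by (auto simp: zcoset_def coset_def)
qed

text \<open>Every member of a coset is the class of a sequence at \<open>znorm\<close>-distance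
  tending to zero, and a change of sequence within one \<open>cls\<close> is harmless by
  \<open>znorm_le\<close>.\<close>

lemma zcoset_eq_iff:
  assumes u: "cn.cau u" and v: "cn.cau v"
  shows "zcoset u = zcoset v \<longleftrightarrow> (\<lambda>n. znorm (u n - v n)) \<longlonglongrightarrow> 0"
proof
  note u' = zn_cau[OF u] and v' = zn_cau[OF v]
  have sub: "X \<in> zcoset v'" if X: "X \<in> zcoset u'" and u': "cn.cau u'" and v': "cn.cau v'"
    and null: "(\<lambda>n. znorm (u' n - v' n)) \<longlonglongrightarrow> 0" for X u' v'
  proof -
    obtain w where w: "cn.cau w" "X = cls w" "(\<lambda>n. znorm (w n - u' n)) \<longlonglongrightarrow> 0"
      using zcoset_cases[OF u' X] .
    show ?thesis unfolding w(2)
      by (intro zcoset_intro v' w zn.null_diff_trans[OF zn_cau[OF w(1)] zn_cau[OF u'] zn_cau[OF v']] null)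
  qed
  show "zcoset u = zcoset v" if "(\<lambda>n. znorm (u n - v n)) \<longlonglongrightarrow> 0"
    by (intro equalityI subsetI) (erule sub[OF _ u v that] sub[OF _ v u zn.null_diff_sym[OF u' v' that]])+
  assume "zcoset u = zcoset v"
  moreover have "cls u \<in> zcoset u" by (rule zcoset_intro[OF u u]) simp
  ultimately have "cls u \<in> zcoset v" by simp
  then obtain w where w: "cn.cau w" "cls u = cls w" "(\<lambda>n. znorm (w n - v n)) \<longlonglongrightarrow> 0"
    using zcoset_cases[OF v] by blast
  have "(\<lambda>n. cnorm (u n - w n)) \<longlonglongrightarrow> 0" using w u by (simp add: cls_eq_iff)
  then have lim: "(\<lambda>n. 2 * cnorm (u n - w n)) \<longlonglongrightarrow> 0" by (rule tendsto_mult_right_zero)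
  have mem: "u n - w n \<in> supp_in S" for n using u w(1) by simp
  have "(\<lambda>n. znorm (u n - w n)) \<longlonglongrightarrow> 0"
    by (rule tendsto_sandwich[OF _ _ tendsto_const lim])
      (simp_all add: zn.nonneg[OF mem] znorm_le[OF mem])
  then show "(\<lambda>n. znorm (u n - v n)) \<longlonglongrightarrow> 0"
    using zn.null_diff_trans[OF u' zn_cau[OF w(1)] v'] w(3) by blast
qed

lemma pick_zcoset:
  assumes u: "cn.cau u"
  obtains v where "cn.cau v" "pick (zcoset u) = cls v" "zn.cau v" "(\<lambda>n. znorm (v n - u n)) \<longlonglongrightarrow> 0"
proof -
  have "cls u \<in> zcoset u" by (rule zcoset_intro[OF u u]) simp
  then have "pick (zcoset u) \<in> zcoset u" unfolding pick_def by (rule someI[of "\<lambda>X. X \<in> zcoset u"])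
  then show ?thesis using zcoset_cases[OF u] that zn_cau by metis
qed

abbreviation "Q \<equiv> cstar0 S mul z"

lemma carrier_cstar0: "carrier Q = zcoset ` {u. cn.cau u}"
  by (auto simp: cstar0_def quotient_algebra_def generated_ideal_z carrier_cstar zcoset_def)

lemma cstar0_emb_eq: "cstar0_emb S mul z f = zcoset (\<lambda>_. f)"
  unfolding cstar0_emb_def generated_ideal_z unfolding zcoset_def cstar_emb_eq ..

lemma cstar0_sel:
  "alg_zero Q = coset (cstar S mul) (range zcls) (alg_zero (cstar S mul))"
  "alg_add Q X Y = coset (cstar S mul) (range zcls) (alg_add (cstar S mul) (pick X) (pick Y))"
  "alg_scale Q c X = coset (cstar S mul) (range zcls) (alg_scale (cstar S mul) c (pick X))"
  "alg_mult Q X Y = coset (cstar S mul) (range zcls) (alg_mult (cstar S mul) (pick X) (pick Y))"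
  "alg_star Q X = coset (cstar S mul) (range zcls) (alg_star (cstar S mul) (pick X))"
  "alg_norm Q X = Inf (alg_norm (cstar S mul) ` X)"
  by (simp_all add: cstar0_def quotient_algebra_def generated_ideal_z)

lemma cstar0_zero: "alg_zero Q = zcoset (\<lambda>_. 0)"
  by (simp add: cstar0_sel zcoset_def cstar_zero)

text \<open>Each operation of the quotient picks a member of a coset; the null-sequence rules for
  \<open>znorm\<close> replace the picked sequences by the given ones.\<close>

lemma cstar0_star_mult:
  assumes u: "cn.cau u"
  shows "alg_mult Q (alg_star Q (zcoset u)) (zcoset u) = zcoset (\<lambda>n. conv (astar star (u n)) (u n))"
proof -
  note c = cn.cau_conv cn.cau_invol
  obtain v where v: "cn.cau v" "pick (zcoset u) = cls v" "zn.cau v" "(\<lambda>n. znorm (v n - u n)) \<longlonglongrightarrow> 0"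
    using pick_zcoset[OF u] .
  have "alg_star Q (zcoset u) = zcoset (\<lambda>n. astar star (v n))"
    unfolding cstar0_sel v(2) cstar_star[OF v(1)] unfolding zcoset_def ..
  also have "\<dots> = zcoset (\<lambda>n. astar star (u n))"
    using v u zn.null_invol[of v u] by (simp add: zcoset_eq_iff c zn_cau)
  finally have star: "alg_star Q (zcoset u) = zcoset (\<lambda>n. astar star (u n))" .
  have su: "cn.cau (\<lambda>n. astar star (u n))" using u by (rule c)
  obtain w where w: "cn.cau w" "pick (zcoset (\<lambda>n. astar star (u n))) = cls w" "zn.cau w"
      "(\<lambda>n. znorm (w n - astar star (u n))) \<longlonglongrightarrow> 0"
    using pick_zcoset[OF su] .
  have "alg_mult Q (alg_star Q (zcoset u)) (zcoset u) = zcoset (\<lambda>n. conv (w n) (v n))"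
    unfolding star unfolding cstar0_sel w(2) v(2) cstar_mult[OF w(1) v(1)] unfolding zcoset_def ..
  also have "\<dots> = zcoset (\<lambda>n. conv (astar star (u n)) (u n))"
    using v w u su zn.null_conv[of w "\<lambda>n. astar star (u n)" v u] by (simp add: zcoset_eq_iff c zn_cau)
  finally show ?thesis .
qed

text \<open>The class of the cut sequence lies in the coset and has norm \<open>l\<close>, which
  bounds the infimum above. Conversely every member has a sequence with \<open>znorm\<close> tending
  to \<open>l\<close>, and \<open>znorm_le\<close> costs the factor \<open>2\<close>.\<close>

lemma cstar0_norm:
  assumes u: "cn.cau u" and l: "(\<lambda>n. znorm (u n)) \<longlonglongrightarrow> l"
  shows "alg_norm Q (zcoset u) \<le> l" "l \<le> 2 * alg_norm Q (zcoset u)"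
proof -
  have Q: "alg_norm Q (zcoset u) = Inf (alg_norm (cstar S mul) ` zcoset u)"
    by (rule cstar0_sel)
  have low: "l / 2 \<le> alg_norm (cstar S mul) X" if X: "X \<in> zcoset u" for X
  proof -
    obtain v where v: "cn.cau v" "X = cls v" "(\<lambda>n. znorm (v n - u n)) \<longlonglongrightarrow> 0"
      using zcoset_cases[OF u X] .
    have "(\<lambda>n. znorm (v n)) \<longlonglongrightarrow> l" by (rule zn.null_diff_lim[OF zn_cau[OF v(1)] zn_cau[OF u] v(3) l])
    moreover have "(\<lambda>n. 2 * cnorm (v n)) \<longlonglongrightarrow> 2 * alg_norm (cstar S mul) X"
      unfolding v(2) by (intro tendsto_intros cstar_norm_tendsto v)
    ultimately have "l \<le> 2 * alg_norm (cstar S mul) X"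
      by (rule LIMSEQ_le) (use znorm_le v(1) in auto)
    then show ?thesis by simp
  qed
  have cut: "cn.cau (\<lambda>n. cut (u n))" using cau_cut_iff u zn_cau by simp
  have mem: "cls (\<lambda>n. cut (u n)) \<in> zcoset u"
  proof (rule zcoset_intro[OF u cut])
    show "(\<lambda>n. znorm (cut (u n) - u n)) \<longlonglongrightarrow> 0" by (simp add: znorm_def cut_diff)
  qed
  have "(\<lambda>n. cnorm (cut (u n))) \<longlonglongrightarrow> l" using l by (simp add: znorm_def)
  then have cut_norm: "alg_norm (cstar S mul) (cls (\<lambda>n. cut (u n))) = l"
    using cstar_norm_tendsto[OF cut] LIMSEQ_unique by blast
  show "alg_norm Q (zcoset u) \<le> l"
    unfolding Q using low mem cut_norm by (metis bdd_belowI2 cINF_lower)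
  have "l / 2 \<le> alg_norm Q (zcoset u)"
    unfolding Q using low mem by (intro cINF_greatest) auto
  then show "l \<le> 2 * alg_norm Q (zcoset u)" by simp
qed

lemma cstar0_dist:
  assumes u: "cn.cau u" and v: "cn.cau v"
  shows "alg_dist Q (zcoset u) (zcoset v) = alg_norm Q (zcoset (\<lambda>n. u n - v n))"
proof -
  obtain v' where v': "cn.cau v'" "pick (zcoset v) = cls v'" "zn.cau v'" "(\<lambda>n. znorm (v' n - v n)) \<longlonglongrightarrow> 0"
    using pick_zcoset[OF v] .
  have "alg_scale Q (-1) (zcoset v) = zcoset (\<lambda>n. cscale (-1) (v' n))"
    unfolding cstar0_sel v'(2) cstar_scale[OF v'(1)] unfolding zcoset_def ..
  also have "\<dots> = zcoset (\<lambda>n. cscale (-1) (v n))"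
    using v' v zn.null_cscale[of v' v "-1"] by (simp add: zcoset_eq_iff cn.cau_cscale zn_cau)
  finally have neg: "alg_scale Q (-1) (zcoset v) = zcoset (\<lambda>n. cscale (-1) (v n))" .
  have nv: "cn.cau (\<lambda>n. cscale (-1) (v n))" by (rule cn.cau_cscale[OF v])
  obtain w where w: "cn.cau w" "pick (zcoset (\<lambda>n. cscale (-1) (v n))) = cls w" "zn.cau w"
      "(\<lambda>n. znorm (w n - cscale (-1) (v n))) \<longlonglongrightarrow> 0"
    using pick_zcoset[OF nv] .
  obtain u' where u': "cn.cau u'" "pick (zcoset u) = cls u'" "zn.cau u'" "(\<lambda>n. znorm (u' n - u n)) \<longlonglongrightarrow> 0"
    using pick_zcoset[OF u] .
  have "alg_add Q (zcoset u) (zcoset (\<lambda>n. cscale (-1) (v n))) = zcoset (\<lambda>n. u' n + w n)"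
    unfolding cstar0_sel u'(2) w(2) cstar_add[OF u'(1) w(1)] unfolding zcoset_def ..
  also have "\<dots> = zcoset (\<lambda>n. u n + cscale (-1) (v n))"
    using u u' w nv zn.null_add[of u' w u "\<lambda>n. cscale (-1) (v n)"]
    by (simp add: zcoset_eq_iff cn.cau_add zn_cau)
  finally show ?thesis by (simp add: alg_dist_def neg cscale_minus1)
qed

lemma cstar0_emb_close:
  assumes w: "cn.cau w" and "d > 0"
  shows "\<exists>N. \<forall>k\<ge>N. alg_dist Q (zcoset (\<lambda>_. w k)) (zcoset w) < d"
proof -
  \<comment> \<open>The strict bound \<open>d / 2\<close> survives the limit only as
    \<open>l \<le> d / 2\<close>, which is still below \<open>d\<close>.\<close>
  obtain N where N: "\<And>m n. m \<ge> N \<Longrightarrow> n \<ge> N \<Longrightarrow> znorm (w m - w n) < d / 2"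
    using zn.cauD[OF zn_cau[OF w], of "d / 2"] \<open>d > 0\<close> by auto
  have "alg_dist Q (zcoset (\<lambda>_. w k)) (zcoset w) < d" if "k \<ge> N" for k
  proof -
    have wk: "cn.cau (\<lambda>_. w k)" using w by (intro cn.cau_const) simp
    have "cn.cau (\<lambda>n. w k + cscale (-1) (w n))" by (intro cn.cau_add cn.cau_cscale wk w)
    then have diff: "cn.cau (\<lambda>n. w k - w n)" by (simp add: cscale_minus1)
    obtain l where l: "(\<lambda>n. znorm (w k - w n)) \<longlonglongrightarrow> l"
      using zn.cau_convergent[OF zn_cau[OF diff]] by (auto simp: convergent_def)
    have "l \<le> d / 2" by (rule LIMSEQ_le_const2[OF l]) (use N[OF that] in \<open>auto intro: less_imp_le\<close>)
    then show ?thesis using cstar0_norm(1)[OF diff l] \<open>d > 0\<close> by (simp add: cstar0_dist[OF wk w])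
  qed
  then show ?thesis by blast
qed

text \<open>\<open>\<epsilon>\<close> is prescribed on constant sequences. By continuity the
  restrictions of the terms \<open>w k\<close> tend to its value at \<open>w\<close>; with a Cauchy
  sequence \<open>y\<close> for that value, a diagonal argument compares the \<open>k\<close>-th
  terms.\<close>

lemma extension_eq:
  assumes ext: "extends_restriction S mul z H \<epsilon>" and HS: "H \<subseteq> S" and w: "cn.cau w"
  obtains y where "cn.cau y" "\<epsilon> (zcoset w) = zcoset y"
    "(\<lambda>n. znorm (restriction H (w n) - y n)) \<longlonglongrightarrow> 0"
proof -
  have wQ: "zcoset w \<in> carrier Q" using w by (auto simp: carrier_cstar0)
  have "\<epsilon> (zcoset w) \<in> carrier Q"
    using ext wQ by (auto simp: extends_restriction_def alg_closure_def)
  then obtain y where y: "cn.cau y" "\<epsilon> (zcoset w) = zcoset y" by (auto simp: carrier_cstar0)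
  have cont: "\<exists>d>0. \<forall>b\<in>carrier Q. alg_dist Q b (zcoset w) < d \<longrightarrow> alg_dist Q (\<epsilon> b) (zcoset y) < e"
    if "e > 0" for e
    using ext wQ that y(2) unfolding extends_restriction_def by metis
  have rest: "restriction H (w k) \<in> supp_in S" for k
    using supp_in_mono[OF HS] restriction_supp by blast
  have emb: "\<epsilon> (zcoset (\<lambda>_. w k)) = zcoset (\<lambda>_. restriction H (w k))" for k
    using ext cn.cau_supp[OF w, of k] by (simp add: extends_restriction_def cstar0_emb_eq supp_in_def)
  have "\<exists>N. \<forall>k\<ge>N. znorm (restriction H (w k) - y k) < e" if "e > 0" for e
  proof -
    \<comment> \<open>The second bound of \<open>cstar0_norm\<close> doubles \<open>e / 4\<close> to
      \<open>e / 2\<close>; the other \<open>e / 2\<close> pays for passing from \<open>y ?n\<close>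
      to \<open>y k\<close>.\<close>
    obtain d where d: "d > 0"
      "\<And>b. b \<in> carrier Q \<Longrightarrow> alg_dist Q b (zcoset w) < d \<Longrightarrow> alg_dist Q (\<epsilon> b) (zcoset y) < e / 4"
      using cont[of "e / 4"] \<open>e > 0\<close> by auto
    obtain N where N: "\<And>k. k \<ge> N \<Longrightarrow> alg_dist Q (zcoset (\<lambda>_. w k)) (zcoset w) < d"
      using cstar0_emb_close[OF w d(1)] by blast
    obtain N' where N': "\<And>m n. m \<ge> N' \<Longrightarrow> n \<ge> N' \<Longrightarrow> znorm (y m - y n) < e / 2"
      using zn.cauD[OF zn_cau[OF y(1)], of "e / 2"] \<open>e > 0\<close> by auto
    have "znorm (restriction H (w k) - y k) < e" if k: "k \<ge> max N N'" for k
    proof -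
      let ?r = "restriction H (w k)"
      have "zcoset (\<lambda>_. w k) \<in> carrier Q" using w by (auto simp: carrier_cstar0 intro!: cn.cau_const)
      then have dist: "alg_dist Q (zcoset (\<lambda>_. ?r)) (zcoset y) < e / 4"
        using d(2) N k emb by fastforce
      have r: "cn.cau (\<lambda>_. ?r)" by (rule cn.cau_const[OF rest])
      have "cn.cau (\<lambda>n. ?r + cscale (-1) (y n))" by (intro cn.cau_add cn.cau_cscale r y)
      then have diff: "cn.cau (\<lambda>n. ?r - y n)" by (simp add: cscale_minus1)
      obtain l where l: "(\<lambda>n. znorm (?r - y n)) \<longlonglongrightarrow> l"
        using zn.cau_convergent[OF zn_cau[OF diff]] by (auto simp: convergent_def)
      have "l < e / 2" using cstar0_norm(2)[OF diff l] dist by (simp add: cstar0_dist[OF r y(1)])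
      then have "\<forall>\<^sub>F n in sequentially. znorm (?r - y n) < e / 2" using order_tendstoD(2)[OF l] by blast
      then obtain M where M: "\<And>n. n \<ge> M \<Longrightarrow> znorm (?r - y n) < e / 2"
        by (auto simp: eventually_sequentially)
      let ?n = "max M k"
      have "znorm (?r - y k) \<le> znorm (?r - y ?n) + znorm (y ?n - y k)"
        using y by (intro zn.M_diff_triangle rest) auto
      moreover have "znorm (?r - y ?n) < e / 2" by (rule M) simp
      moreover have "znorm (y ?n - y k) < e / 2" using k by (intro N') auto
      ultimately show ?thesis by linarith
    qed
    then show ?thesis by blast
  qed
  then have "(\<lambda>n. znorm (restriction H (w n) - y n)) \<longlonglongrightarrow> 0"
    using zn.nonneg rest y by (intro LIMSEQ_I) simp
  then show ?thesis using that y by blast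
qed

lemma faithful_iff:
  assumes ext: "extends_restriction S mul z H \<epsilon>" and HS: "H \<subseteq> S"
  shows "faithful Q \<epsilon> \<longleftrightarrow> (\<forall>u. cn.cau u \<longrightarrow>
    (\<lambda>n. znorm (restriction H (conv (astar star (u n)) (u n)))) \<longlonglongrightarrow> 0 \<longrightarrow> (\<lambda>n. znorm (u n)) \<longlonglongrightarrow> 0)"
proof -
  have zero: "cn.cau (\<lambda>_. 0)" by (rule cn.cau_const) simp
  have 1: "\<epsilon> (alg_mult Q (alg_star Q (zcoset u)) (zcoset u)) = alg_zero Q \<longleftrightarrow>
      (\<lambda>n. znorm (restriction H (conv (astar star (u n)) (u n)))) \<longlonglongrightarrow> 0" if u: "cn.cau u" for u
  proof -
    let ?w = "\<lambda>n. conv (astar star (u n)) (u n)"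
    have w: "cn.cau ?w" by (intro cn.cau_conv cn.cau_invol u)
    obtain y where y: "cn.cau y" "\<epsilon> (zcoset ?w) = zcoset y"
        "(\<lambda>n. znorm (restriction H (?w n) - y n)) \<longlonglongrightarrow> 0"
      using extension_eq[OF ext HS w] .
    have rest: "restriction H (?w n) \<in> supp_in S" for n
      using supp_in_mono[OF HS] restriction_supp by blast
    have 1: "(\<lambda>n. znorm (restriction H (?w n))) \<longlonglongrightarrow> 0" if "(\<lambda>n. znorm (y n)) \<longlonglongrightarrow> 0"
    proof (rule zn.null_dominated[OF y(3) that, of _ 1])
      show "znorm (restriction H (?w n)) \<le> 1 * (znorm (restriction H (?w n) - y n) + znorm (y n))" for n
        using zn.triangle[of "restriction H (?w n) - y n" "y n"] rest[of n] y(1) by simp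
    qed (rule rest)
    have 2: "(\<lambda>n. znorm (y n)) \<longlonglongrightarrow> 0" if "(\<lambda>n. znorm (restriction H (?w n))) \<longlonglongrightarrow> 0"
    proof (rule zn.null_dominated[OF y(3) that, of _ 1])
      show "znorm (y n) \<le> 1 * (znorm (restriction H (?w n) - y n) + znorm (restriction H (?w n)))" for n
        using zn.triangle[of "y n - restriction H (?w n)" "restriction H (?w n)"]
          zn.M_diff_commute[of "y n" "restriction H (?w n)"] rest[of n] y(1) by simp
    qed (use y in simp)
    have "\<epsilon> (alg_mult Q (alg_star Q (zcoset u)) (zcoset u)) = alg_zero Q \<longleftrightarrow> (\<lambda>n. znorm (y n)) \<longlonglongrightarrow> 0"
      using zcoset_eq_iff[OF y(1) zero] by (simp add: cstar0_star_mult[OF u] cstar0_zero y(2))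
    then show ?thesis using 1 2 by blast
  qed
  have 2: "zcoset u = alg_zero Q \<longleftrightarrow> (\<lambda>n. znorm (u n)) \<longlonglongrightarrow> 0" if "cn.cau u" for u
    using zcoset_eq_iff[OF that zero] by (simp add: cstar0_zero)
  show ?thesis
    unfolding faithful_def carrier_cstar0 using 1 2 by simp
qed

end

section \<open>Gradings\<close>

locale graded_isg = isg_zero S mul z for S :: "'a set" and mul and z +
  fixes G :: "('g, 'm) monoid_scheme" and \<phi> :: "'a \<Rightarrow> 'g option" and H :: "'a set"
  assumes group: "group G"
    and grading: "grading S mul z G \<phi>"
    and H_eq: "H = {s \<in> S. \<phi> s = \<one>\<^bsub>adjoin_zero G\<^esub>} \<union> {z}"
begin

lemma degree_cases:
  assumes "s \<in> S" "s \<noteq> z"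
  obtains g where "g \<in> carrier G" "\<phi> s = Some g"
proof -
  have "\<phi> s \<in> insert None (Some ` carrier G)" "\<phi> s \<noteq> None"
    using grading assms by (auto simp: grading_def adjoin_zero_def)
  then show ?thesis using that by auto
qed

lemma degree_mul:
  assumes "s \<in> S" "t \<in> S" "mul s t \<noteq> z" "\<phi> s = Some g" "\<phi> t = Some h"
  shows "\<phi> (mul s t) = Some (g \<otimes>\<^bsub>G\<^esub> h)"
  using grading assms by (simp add: grading_def adjoin_zero_def)

lemma mem_H_iff: "s \<in> S \<Longrightarrow> s \<noteq> z \<Longrightarrow> s \<in> H \<longleftrightarrow> \<phi> s = Some \<one>\<^bsub>G\<^esub>"
  by (simp add: H_eq adjoin_zero_def)

lemma H_subset: "H \<subseteq> S"
  by (auto simp: H_eq)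

lemma z_in_H: "z \<in> H"
  by (simp add: H_eq)

text \<open>With \<open>s\<close> of degree \<open>g\<close> and \<open>b\<close> of degree
  \<open>h\<close>, the equation \<open>s b = b\<close> gives \<open>g h = h\<close>, and
  \<open>g\<close> cancels to the unit. For \<open>b = z\<close> every \<open>s\<close> would
  qualify.\<close>

lemma fixing_mem_H:
  assumes s: "s \<in> S" and b: "b \<in> S" "b \<noteq> z" and sb: "mul s b = b"
  shows "s \<in> H"
proof -
  have sz: "s \<noteq> z" using sb b by auto
  obtain g where g: "g \<in> carrier G" "\<phi> s = Some g" using degree_cases[OF s sz] .
  obtain h where h: "h \<in> carrier G" "\<phi> b = Some h" using degree_cases[OF b] .
  have "g \<otimes>\<^bsub>G\<^esub> h = h" using degree_mul[OF s b(1) _ g(2) h(2)] sb b h by simp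
  then have "g = \<one>\<^bsub>G\<^esub>" using g h group.r_cancel_one[OF group] by metis
  then show ?thesis using g mem_H_iff[OF s sz] by simp
qed

lemma idem_mem_H: "e \<in> S \<Longrightarrow> mul e e = e \<Longrightarrow> e \<in> H"
  using fixing_mem_H[of e e] z_in_H by blast

text \<open>A right factor of degree one does not change the degree of a nonzero product.\<close>

lemma mul_mem_H_iff:
  assumes s: "s \<in> S" and b: "b \<in> H" and sb: "mul s b \<noteq> z"
  shows "mul s b \<in> H \<longleftrightarrow> s \<in> H"
proof -
  have bS: "b \<in> S" using b H_subset by blast
  have sz: "s \<noteq> z" and bz: "b \<noteq> z" using sb s bS by auto
  obtain g where g: "g \<in> carrier G" "\<phi> s = Some g" using degree_cases[OF s sz] .
  have "\<phi> b = Some \<one>\<^bsub>G\<^esub>" using b mem_H_iff[OF bS bz] by simp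
  then have "\<phi> (mul s b) = Some g"
    using degree_mul[OF s bS sb g(2)] g group.is_monoid[OF group] by (simp add: monoid.r_one)
  then show ?thesis using g(2) s bS sz sb by (simp add: mem_H_iff)
qed

lemma mul_mem_H: "h \<in> H \<Longrightarrow> k \<in> H \<Longrightarrow> mul h k \<in> H"
  using mul_mem_H_iff[of h k] H_subset z_in_H by (cases "mul h k = z") auto

text \<open>For nonzero \<open>h\<close>, the product \<open>mul (star h) h\<close> is a nonzero
  idempotent, hence in \<open>H\<close>; since its right factor is in \<open>H\<close>, so is the
  left one.\<close>

lemma star_mem_H:
  assumes h: "h \<in> H"
  shows "star h \<in> H"
proof (cases "h = z")
  case False
  have hS: "h \<in> S" using h H_subset by blast
  have "mul (star h) h \<noteq> z" using False hS mul_star_mul[OF hS] mul_z[OF hS] by metis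
  moreover have "mul (star h) h \<in> H" using hS by (intro idem_mem_H) simp_all
  ultimately show ?thesis using mul_mem_H_iff[OF _ h] hS by simp
qed (simp add: z_in_H)

lemma inverse_semigroup_H: "inverse_semigroup H mul"
proof
  fix s assume s: "s \<in> H"
  have S: "t \<in> S" if "t \<in> H" for t using that H_subset by blast
  show "\<exists>!t. t \<in> H \<and> s = mul (mul s t) s \<and> t = mul (mul t s) t"
  proof (rule ex1I[of _ "star s"])
    show "star s \<in> H \<and> s = mul (mul s (star s)) s \<and> star s = mul (mul (star s) s) (star s)"
      using s S star_mem_H by simp
    show "t = star s" if "t \<in> H \<and> s = mul (mul s t) s \<and> t = mul (mul t s) t" for t
    proof -
      have "s \<in> S" "t \<in> S" using that s S by auto
      then show ?thesis using that star_unique[of s t] by (metis assoc)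
    qed
  qed
qed (use mul_mem_H H_subset in \<open>auto simp: subset_iff\<close>)

text \<open>\<open>sinv\<close> refers to a carrier, so the inverses taken in \<open>H\<close> and
  in \<open>S\<close> have to be identified by uniqueness.\<close>

lemma sinv_H: "h \<in> H \<Longrightarrow> sinv H mul h = star h"
proof -
  assume h: "h \<in> H"
  interpret H: inverse_semigroup H mul by (rule inverse_semigroup_H)
  show ?thesis
    using h H_subset by (intro H.star_unique star_mem_H) (auto simp: subset_iff)
qed

lemma astar_H: "f \<in> supp_in H \<Longrightarrow> astar (sinv H mul) f = astar star f"
  using sinv_H by (auto simp: astar_def supp_in_def intro!: sum.cong)

lemma stab_H: "b \<in> H \<Longrightarrow> s \<in> H \<Longrightarrow> inverse_semigroup.stab H mul b s = stab b s"
  using sinv_H by (simp add: stab_def inverse_semigroup.stab_def[OF inverse_semigroup_H])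

text \<open>Both norms come from the value at \<open>?g\<close> of stabilizer functionals that agree
  on \<open>H\<close>. Used with \<open>e = mul b (star b)\<close> to pass from \<open>H\<close> to
  \<open>S\<close>, and with \<open>e = b\<close> for the way back.\<close>

lemma act_ket_norm_H:
  assumes f: "f \<in> supp_in H" and b: "b \<in> S" and e: "e \<in> H"
    and stab: "\<And>s. s \<in> S \<Longrightarrow> stab e s = stab b s"
  shows "hnorm (ell2 S) (reg.act f (ket b)) =
    hnorm (ell2 H) (rep_lift (ell2 H) (left_regular H mul) f (ket e))"
proof -
  interpret H: inverse_semigroup H mul by (rule inverse_semigroup_H)
  let ?g = "conv (astar star f) f"
  have fS: "f \<in> supp_in S" using f supp_in_mono[OF H_subset] by blast
  have g: "H.conv (astar (sinv H mul) f) f = ?g" using f by (simp add: astar_H)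
  have gH: "?g \<in> supp_in H" using f g H.conv_supp H.invol_supp by metis
  have "pairing (stab b) ?g = pairing (H.stab e) ?g"
  proof (rule pairing_cong)
    fix s assume "s \<in> keys ?g"
    then have s: "s \<in> H" using gH by (auto simp: supp_in_def)
    then show "stab b s = H.stab e s" using stab_H[OF e s] stab[of s] H_subset by auto
  qed
  then have "(hnorm (ell2 S) (reg.act f (ket b)))\<^sup>2 = (hnorm (ell2 H) (H.reg.act f (ket e)))\<^sup>2"
    using act_ket_norm[OF fS b] H.act_ket_norm[OF f e] g by simp
  then show ?thesis
    using fS f ket_mem[OF b] ket_mem[OF e]
    by (simp add: power2_eq_iff_nonneg)
qed

text \<open>A term \<open>s\<close> contributes to the entry at \<open>c\<close> only if
  \<open>mul s b = c\<close>, and then \<open>s\<close> is in \<open>H\<close> iff \<open>c\<close>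
  is. So restricting coefficients truncates the vector to \<open>H\<close>.\<close>

lemma act_ket_restriction:
  assumes f: "f \<in> supp_in S" and b: "b \<in> H" "b \<noteq> z"
  shows "reg.act (restriction H f) (ket b) c = (if c \<in> H then reg.act f (ket b) c else 0)"
proof -
  have bS: "b \<in> S" using b H_subset by blast
  have r: "restriction H f \<in> supp_in S" using restriction_supp supp_in_mono[OF H_subset] by blast
  have iff: "s \<in> H \<longleftrightarrow> c \<in> H"
    if "s \<in> S" "mul (star s) (mul s b) = b" "mul s b = c" for s
  proof -
    have "mul s b \<noteq> z" using that b(2) by auto
    then show ?thesis using mul_mem_H_iff[OF that(1) b(1)] that(3) by simp
  qed
  show ?thesis
  proof (cases "c \<in> H")
    case True
    then show ?thesis
      unfolding act_ket_apply[OF r bS] act_ket_apply[OF f bS] pairing_restriction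
      using f iff by (auto intro!: pairing_cong simp: supp_in_def subset_iff)
  next
    case False
    have "pairing (\<lambda>s. if s \<in> H then if mul (star s) (mul s b) = b \<and> mul s b = c then 1 else 0 else 0) f =
        pairing (\<lambda>_. 0) f"
      using f iff False by (auto intro!: pairing_cong simp: supp_in_def subset_iff)
    then show ?thesis
      unfolding act_ket_apply[OF r bS] act_ket_apply[OF f bS] pairing_restriction
      using False by (simp add: pairing_def)
  qed
qed

lemma act_ket_restriction_le:
  assumes f: "f \<in> supp_in S" and b: "b \<in> H" "b \<noteq> z"
  shows "hnorm (ell2 S) (reg.act (restriction H f) (ket b)) \<le> hnorm (ell2 S) (reg.act f (ket b))"
proof (rule ell2_dominated)
  have "b \<in> S" using b H_subset by blast
  from ket_mem[OF this] show "reg.act f (ket b) \<in> hset (ell2 S)" using f by simp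
qed (simp add: act_ket_restriction[OF f b])

text \<open>Only elements fixing \<open>b\<close> contribute, and those lie in
  \<open>H\<close>.\<close>

lemma stab_pairing_restriction:
  assumes "f \<in> supp_in S" "b \<in> S" "b \<noteq> z"
  shows "pairing (stab b) (restriction H f) = pairing (stab b) f"
  unfolding pairing_restriction
  using assms fixing_mem_H by (auto intro!: pairing_cong simp: supp_in_def stab_def subset_iff)

lemma stab_pairing_cut:
  assumes "b \<in> S" "b \<noteq> z"
  shows "pairing (stab b) (cut f) = pairing (stab b) f"
  using assms by (simp add: cut_def pairing_diff stab_def)

text \<open>All of \<open>S\<close> fixes \<open>ket z\<close>, so \<open>1 - z\<close> kills it; at
  any other \<open>b\<close> the zero element acts as the zero operator, since
  \<open>mul z b = z\<close>.\<close>

lemma act_cut_ket: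
  assumes f: "f \<in> supp_in S" and b: "b \<in> S"
  shows "reg.act (cut f) (ket b) = (if b = z then 0 else reg.act f (ket b))"
proof
  fix c
  show "reg.act (cut f) (ket b) c = (if b = z then 0 else reg.act f (ket b)) c"
  proof (cases "b = z")
    case True
    have "pairing (\<lambda>s. if mul (star s) (mul s b) = b \<and> mul s b = c then 1 else 0) (cut f) =
        pairing (\<lambda>s. if z = c then 1 else 0) (cut f)"
    proof (rule pairing_cong)
      fix s assume "s \<in> keys (cut f)"
      then have "s \<in> S" using cut_supp[OF f] by (auto simp: supp_in_def)
      then show "(if mul (star s) (mul s b) = b \<and> mul s b = c then 1 else 0) = (if z = c then 1 else 0 :: complex)"
        unfolding True by simp
    qed
    also have "\<dots> = 0"
      using total_cut[of f] unfolding total_def by (cases "z = c") (auto simp: pairing_def)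
    finally have "reg.act (cut f) (ket b) c = 0" by (simp only: act_ket_apply[OF cut_supp[OF f] b])
    then show ?thesis using True by simp
  next
    case False
    then have "reg.act (cut f) (ket b) c = reg.act f (ket b) c"
      unfolding act_ket_apply[OF f b] act_ket_apply[OF cut_supp[OF f] b] unfolding cut_def pairing_diff
      using b by simp
    then show ?thesis using False by simp
  qed
qed

lemma H_cau_iff:
  assumes "cstar_isometric S mul H" "\<And>n. u n \<in> supp_in H"
  shows "star_seminorm.cau H (cstar_norm H mul) u \<longleftrightarrow> cn.cau u"
proof -
  interpret H: inverse_semigroup H mul by (rule inverse_semigroup_H)
  have "cstar_norm H mul (u m - u n) = cnorm (u m - u n)" for m n
    using assms supp_in_diff[OF assms(2) assms(2), of m n] by (simp add: cstar_isometric_def supp_in_def)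
  moreover have "u n \<in> supp_in S" for n using assms(2) supp_in_mono[OF H_subset] by blast
  ultimately show ?thesis unfolding cn.cau_def H.cn.cau_def using assms(2) by simp
qed

section \<open>The three implications that make up the theorem\<close>

lemma weak_containment_imp:
  assumes iso: "cstar_isometric S mul H" and wc: "weak_containment S mul"
  shows "weak_containment H mul"
proof -
  interpret H: inverse_semigroup H mul by (rule inverse_semigroup_H)
  show ?thesis
    unfolding H.weak_containment_iff
  proof (intro allI impI)
    fix u assume u: "H.cn.cau u"
      and null: "\<forall>b\<in>H. (\<lambda>n. hnorm (ell2 H) (H.reg.act (u n) (ket b))) \<longlonglongrightarrow> 0"
    have uH: "u n \<in> supp_in H" for n using u by (rule H.cn.cau_supp)
    have "cn.cau u" using u H_cau_iff[of u, OF iso uH] by blast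
    moreover have "(\<lambda>n. hnorm (ell2 S) (reg.act (u n) (ket b))) \<longlonglongrightarrow> 0" if b: "b \<in> S" for b
    proof -
      \<comment> \<open>\<open>b\<close> itself may lie outside \<open>H\<close>, so the hypothesis
        is tested on this idempotent instead.\<close>
      have "mul b (star b) \<in> H" using b by (intro idem_mem_H) simp_all
      then show ?thesis using null act_ket_norm_H[OF uH b _ stab_range[OF b]] by simp
    qed
    ultimately have "(\<lambda>n. cnorm (u n)) \<longlonglongrightarrow> 0" using wc weak_containment_iff by blast
    moreover have "cstar_norm H mul (u n) = cnorm (u n)" for n
      using iso uH[of n] by (simp add: cstar_isometric_def supp_in_def)
    ultimately show "(\<lambda>n. cstar_norm H mul (u n)) \<longlonglongrightarrow> 0" by simp
  qed
qed

text \<open>Weak containment is applied to \<open>cut (u n)\<close>, because the hypothesis holds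
  only modulo \<open>z\<close>; the cut also disposes of the vector \<open>ket z\<close>.\<close>

lemma faithful_if_weak_containment:
  assumes wc: "weak_containment S mul" and ext: "extends_restriction S mul z H \<epsilon>"
  shows "faithful Q \<epsilon>"
  unfolding faithful_iff[OF ext H_subset]
proof (intro allI impI)
  fix u assume u: "cn.cau u"
  let ?w = "\<lambda>n. conv (astar star (u n)) (u n)"
  assume null: "(\<lambda>n. znorm (restriction H (?w n))) \<longlonglongrightarrow> 0"
  have uS: "u n \<in> supp_in S" and wS: "?w n \<in> supp_in S" for n using u by simp_all
  have rS: "restriction H (?w n) \<in> supp_in S" for n
    using restriction_supp supp_in_mono[OF H_subset] by blast
  have cut: "cn.cau (\<lambda>n. cut (u n))" using zn_cau[OF u] uS by (simp add: cau_cut_iff)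
  have "(\<lambda>n. hnorm (ell2 S) (reg.act (cut (u n)) (ket b))) \<longlonglongrightarrow> 0" if b: "b \<in> S" for b
  proof (cases "b = z")
    case True
    then show ?thesis using b by (simp add: act_cut_ket[OF uS] hnorm_def)
  next
    case False
    let ?x = "\<lambda>n. hnorm (ell2 S) (reg.act (u n) (ket b))"
    \<comment> \<open>At nonzero \<open>b\<close> neither restriction nor cutting changes the
      stabilizer functional, so it can be evaluated at the element that is small by
      hypothesis.\<close>
    have "(?x n)\<^sup>2 = cmod (pairing (stab b) (cut (restriction H (?w n))))" for n
      using act_ket_norm[OF uS b] stab_pairing_restriction[OF wS b False] stab_pairing_cut[OF b False]
      by simp
    then have "(?x n)\<^sup>2 \<le> znorm (restriction H (?w n))" for n
      using stab_pairing_le[OF cut_supp[OF rS] b] by (simp add: znorm_def)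
    then have "(\<lambda>n. (?x n)\<^sup>2) \<longlonglongrightarrow> 0"
      by (intro tendsto_sandwich[OF _ _ tendsto_const null]) auto
    then have "?x \<longlonglongrightarrow> 0" by simp
    then show ?thesis using False b by (simp add: act_cut_ket[OF uS])
  qed
  then have "(\<lambda>n. cnorm (cut (u n))) \<longlonglongrightarrow> 0" using wc cut weak_containment_iff by blast
  then show "(\<lambda>n. znorm (u n)) \<longlonglongrightarrow> 0" by (simp add: znorm_def)
qed

lemma weak_containment_if_faithful:
  assumes iso: "cstar_isometric S mul H" and ext: "extends_restriction S mul z H \<epsilon>"
    and faithful: "faithful Q \<epsilon>" and wcH: "weak_containment H mul"
  shows "weak_containment S mul"
  unfolding weak_containment_iff
proof (intro allI impI)
  interpret H: inverse_semigroup H mul by (rule inverse_semigroup_H)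
  fix u assume u: "cn.cau u"
    and null: "\<forall>b\<in>S. (\<lambda>n. hnorm (ell2 S) (reg.act (u n) (ket b))) \<longlonglongrightarrow> 0"
  let ?w = "\<lambda>n. conv (astar star (u n)) (u n)"
  let ?v = "\<lambda>n. cut (restriction H (?w n))"
  have uS: "u n \<in> supp_in S" and wS: "?w n \<in> supp_in S" for n using u by simp_all
  have rS: "restriction H (?w n) \<in> supp_in S" for n
    using restriction_supp supp_in_mono[OF H_subset] by blast
  \<comment> \<open>\<open>z\<close> is in \<open>H\<close>, so cutting does not leave the algebra
    of \<open>H\<close>.\<close>
  have vH: "?v n \<in> supp_in H" for n
    unfolding cut_def using restriction_supp z_in_H by (intro supp_in_diff supp_in_single)
  have w: "cn.cau ?w" by (intro cn.cau_conv cn.cau_invol u)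
  have v: "cn.cau ?v"
  proof -
    \<comment> \<open>The restrictions inherit the Cauchy property from a sequence representing the
      value of \<open>\<epsilon>\<close>.\<close>
    obtain y where y: "cn.cau y" "(\<lambda>n. znorm (restriction H (?w n) - y n)) \<longlonglongrightarrow> 0"
      using extension_eq[OF ext H_subset w] by metis
    then have "zn.cau (\<lambda>n. restriction H (?w n))"
      by (intro zn.cau_if_null_diff[OF zn_cau[OF y(1)] rS])
    then show ?thesis using rS by (simp add: cau_cut_iff)
  qed
  have "(\<lambda>n. hnorm (ell2 H) (H.reg.act (?v n) (ket b))) \<longlonglongrightarrow> 0" if b: "b \<in> H" for b
  proof -
    have bS: "b \<in> S" using b H_subset by blast
    have "(\<lambda>n. hnorm (ell2 S) (reg.act (?v n) (ket b))) \<longlonglongrightarrow> 0"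
    proof (cases "b = z")
      case True
      then show ?thesis using act_cut_ket[OF rS z_mem] by (simp add: hnorm_def)
    next
      case False
      obtain B where B: "\<And>n. cnorm (u n) \<le> B" using cn.cau_bounded[OF u] by blast
      \<comment> \<open>The truncated vector is dominated by the image of \<open>ket b\<close> under
        \<open>?w n\<close>, where the left factor of the product is bounded by \<open>B\<close> and
        the right factor yields a null sequence.\<close>
      have le: "hnorm (ell2 S) (reg.act (?v n) (ket b)) \<le> B * hnorm (ell2 S) (reg.act (u n) (ket b))" for n
      proof -
        let ?k = "reg.act (u n) (ket b)"
        have k: "?k \<in> hset (ell2 S)" using uS ket_mem[OF bS] by simp
        have "hnorm (ell2 S) (reg.act (?v n) (ket b)) \<le> hnorm (ell2 S) (reg.act (?w n) (ket b))"
          using act_ket_restriction_le[OF wS b False] False by (simp add: act_cut_ket[OF rS bS])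
        also have "\<dots> = hnorm (ell2 S) (reg.act (astar star (u n)) ?k)"
          using uS ket_mem[OF bS] by (simp add: reg.act_conv)
        also have "\<dots> \<le> cnorm (astar star (u n)) * hnorm (ell2 S) ?k"
          using uS by (intro reg.act_norm k) simp
        also have "\<dots> \<le> B * hnorm (ell2 S) ?k"
          using cn.invol[OF uS] B order_trans k by (intro mult_right_mono) (blast, simp)
        finally show ?thesis .
      qed
      have lim: "(\<lambda>n. B * hnorm (ell2 S) (reg.act (u n) (ket b))) \<longlonglongrightarrow> 0"
        using null bS by (intro tendsto_mult_right_zero) blast
      have "reg.act (?v n) (ket b) \<in> hset (ell2 S)" for n
        using rS ket_mem[OF bS] by simp
      then show ?thesis
        by (intro tendsto_sandwich[OF _ _ tendsto_const lim]) (simp_all add: le)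
    qed
    then show ?thesis using act_ket_norm_H[OF vH bS b] by simp
  qed
  moreover have "H.cn.cau ?v" using v H_cau_iff[of ?v, OF iso vH] by blast
  ultimately have "(\<lambda>n. cstar_norm H mul (?v n)) \<longlonglongrightarrow> 0" using wcH H.weak_containment_iff by blast
  moreover have "cstar_norm H mul (?v n) = znorm (restriction H (?w n))" for n
    using iso vH[of n] by (simp add: cstar_isometric_def supp_in_def znorm_def)
  ultimately have "(\<lambda>n. znorm (restriction H (?w n))) \<longlonglongrightarrow> 0" by simp
  then have zn: "(\<lambda>n. znorm (u n)) \<longlonglongrightarrow> 0" using faithful u faithful_iff[OF ext H_subset] by blast
  \<comment> \<open>Faithfulness controls \<open>u\<close> modulo \<open>z\<close> only. The rest is
    \<open>total (u n)\<close> times \<open>z\<close>, and this coefficient is the entry at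
    \<open>z\<close> of a vector that tends to zero by assumption.\<close>
  have "(\<lambda>n. total (u n)) \<longlonglongrightarrow> 0"
  proof (rule Lim_null_comparison)
    show "(\<lambda>n. hnorm (ell2 S) (reg.act (u n) (ket z))) \<longlonglongrightarrow> 0" using null by simp
    have "cmod (total (u n)) \<le> hnorm (ell2 S) (reg.act (u n) (ket z))" for n
    proof -
      have "reg.act (u n) (ket z) z = total (u n)"
        unfolding total_def act_ket_apply[OF uS z_mem]
        using uS[of n] by (intro pairing_cong) (auto simp: supp_in_def)
      then show ?thesis
        using ell2_component_le[of "reg.act (u n) (ket z)" S z] uS ket_mem[OF z_mem] by simp
    qed
    then show "\<forall>\<^sub>F n in sequentially. cmod (total (u n)) \<le> hnorm (ell2 S) (reg.act (u n) (ket z))"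
      by simp
  qed
  from cnorm_single_z_null[OF this] have "(\<lambda>n. cnorm (single z (total (u n)))) \<longlonglongrightarrow> 0" by simp
  with zn show "(\<lambda>n. cnorm (u n)) \<longlonglongrightarrow> 0"
    unfolding znorm_def
  proof (rule cn.null_dominated[where C = 1])
    show "cnorm (u n) \<le> 1 * (cnorm (cut (u n)) + cnorm (single z (total (u n))))" for n
      using cn.triangle[of "cut (u n)" "single z (total (u n))"] uS by (simp add: cut_def)
  qed (rule uS)
qed

end

theorem theorem3p2:
  fixes S :: "'a set" and mul :: "'a \<Rightarrow> 'a \<Rightarrow> 'a" and z :: 'a
    and G :: "('g, 'm) monoid_scheme" and \<phi> :: "'a \<Rightarrow> 'g option"
    and H :: "'a set"
    and \<epsilon> :: "(nat \<Rightarrow> 'a \<Rightarrow>\<^sub>0 complex) set set \<Rightarrow> (nat \<Rightarrow> 'a \<Rightarrow>\<^sub>0 complex) set set"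
  assumes "inverse_semigroup S mul"
    and "zero_element S mul z"
    and "group G"
    and "grading S mul z G \<phi>"
    and "H = {s \<in> S. \<phi> s = \<one>\<^bsub>adjoin_zero G\<^esub>} \<union> {z}"
    and "cstar_isometric S mul H"
    and "extends_restriction S mul z H \<epsilon>"
  shows "weak_containment S mul \<longleftrightarrow>
    faithful (cstar0 S mul z) \<epsilon> \<and> weak_containment H mul"
proof -
  interpret graded_isg S mul z G \<phi> H
    using assms by (simp add: graded_isg_def graded_isg_axioms_def isg_zero_def isg_zero_axioms_def)
  show ?thesis
    using assms(6,7) weak_containment_imp faithful_if_weak_containment weak_containment_if_faithful
    by blast
qed

end
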